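(* Let $w\in S_n$ with reduced expression $\underline w$, and fix an extension $\underline w_0=\underline w\,s_{i_{\ell(w)+1}}\cdots s_{i_N}$ to a reduced expression of the longest element $w_0\in S_n$, $N=\binom n2$. Then $\mathcal S_{\underline w}$ is the cone defined by the tropicalization of the restricted superpotential: $$\mathcal S_{\underline w}=\{x\in\mathbb R^{\ell(w)+n-1}\mid \operatorname{res}_{\underline w}(W|_{\mathcal X_{s_{\underline w_0}}})^{\operatorname{trop}}(x)\ge0\}.$$
   Context: Pseudoline arrangement. For a reduced expression $\underline w=s_{i_1}\cdots s_{i_\ell}$, $\operatorname{pa}(\underline w)$ consists of lines $l_1,\dots,l_n$ drawn from left to right, $l_i$ starting at height $i$ (from the bottom); the $j$-th crossing interchanges the lines at heights $i_j,i_j+1$ and is at level $i_j$; if it crosses $l_k,l_m$ ($k<m$) it is denoted $v_{(k,m)}$. The right end of $l_i$ is $L_i$, at height $h(i)$. The strip at level $r$ (between heights $r,r+1$) is cut by the crossings at level $r$ into faces: $F_r$, unbounded to the left, and for each crossing at level $r$ (the $j$-th, $=v_{(k,m)}$) the face $F_{i_j}=F_{(k,m)}$ with that crossing as left endpoint. $J(i)=\{j\mid s_{i_j}=s_i\}=\{j_1<\dots<j_{n_i}\}$. $\mathbb R^{\ell+n-1}$ has standard basis $e_F$ ($F$ a face); write $e_{(k,m)}=e_{F_{(k,m)}}$, $e_i=e_{F_i}$, and $X_F=z^{e_F}$ for the coordinates of the torus $\mathcal X_{s_{\underline w}}$. GP-paths. For $i\in[n-1]$ orient $l_1,\dots,l_i$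 from right to left and $l_{i+1},\dots,l_n$ from left to right. A directed path along the lines is rigorous if it never goes straight along $l_a$ through a crossing with $l_b$ where either $a<b$ and both are oriented to the left, or $a>b$ and both are oriented to the right. A GP-path is a rigorous path from some $L_p$ to some $L_q$ with $p\le i<q$, $h(i+1)\le h(p)\le h(i)$, $h(i+1)\le h(q)\le h(i)$. $\mathcal P_{\underline w}$ is the set of all GP-paths for all $i$. Weighted area cone. For $\mathbf p\in\mathcal P_{\underline w}$, $e_{\mathbf p}=-\sum e_F$ over the faces $F$ in the region enclosed by $\mathbf p$ (to its left); $e_{[i:k]}=-e_{F_i}-\sum_{j\in J(i),j\le j_k}e_{F_{i_j}}$, $0\le k\le n_i$ ($e_{[i:0]}=-e_{F_i}$). $\mathcal S_{\underline w}=\{x\in\mathbb R^{\ell+n-1}\mid e_{\mathbf p}^tx\ge0\ \forall\mathbf p\in\mathcal P_{\underline w},\ e_{[i:k]}^tx\ge0\ \forall i\in[n-1],0\le k\le n_i\}$. Superpotential. $W$ is the Gross-Hacking-Keel-Kontsevich superpotential (sum of the $\vartheta$-functions of the frozen variables) on the mirror dual $\mathcal X$ of the $\mathcal A$-cluster variety $G^{e,w_0}=B\cap B^-w_0B^-\subset SL_n$. Explicitly, in the initial seed of $\hat{\underline w}_0=s_1\,s_2s_1\,s_3s_2s_1\cdots s_{n-1}\cdots s_2s_1$ (Magee): $$W|_{\mathcal X_{s_0}}=\sum_{i=1}^{n-1}\Big(\sum_{k=0}^{n-1-i}z^{-e_i-\sum_{j=1}^ke_{(j,i+j)}}+\sum_{k=0}^{n-1-i}z^{-\sum_{j=0}^ke_{(i,n-j)}}\Big).$$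 Any reduced expression of $w_0$ is reached from $\hat{\underline w}_0$ by commutations (which do not change the faces up to obvious identification) and braid moves; under a braid move the expression of $W$ changes by $\mathcal X$-mutation as follows. Suppose the letters $j,j+1,j+2$ are $s_rs_ts_r$ with $|r-t|=1$, replaced by $s_ts_rs_t$. Let $F$ be the level-$r$ face between crossings $j$ and $j+2$; $E_1$ the level-$r$ face with right endpoint crossing $j$; $E_2$ the level-$t$ face with left endpoint crossing $j+1$; $E_3$ the level-$r$ face with left endpoint crossing $j+2$; $E_4$ the level-$t$ face with right endpoint crossing $j+1$. In the new arrangement $F$ is replaced by the level-$t$ face $F'$ between crossings $j$ and $j+2$, and $E_1,E_2,E_3,E_4$ become respectively: the level-$r$ face with right endpoint $j+1$, the level-$t$ face with left endpoint $j+2$, the level-$r$ face with left endpoint $j+1$, the level-$t$ face with right endpoint $j$; other faces are unchanged. The old coordinates are expressed by the new ones $X'$ through $X_F=X_{F'}'^{-1}$, $X_{E}=X_E'(1+X'_{F'})$ for $E=E_1,E_2$, $X_E=X'_E(1+X_{F'}'^{-1})^{-1}$ for $E=E_3,E_4$, and $X_E=X_E'$ otherwise; $W|_{\mathcal X_{s_{\underline w_0}}}$ is the resulting Laurent polynomial. Restriction. The faces of $\operatorname{pa}(\underline w)$ are identified with those faces of $\operatorname{pa}(\underline w_0)$ that are unbounded to the left or have one of the first $\ell(w)$ crossings as left endpoint. $\operatorname{res}_{\underline w}:\mathbb C[\mathcal X_{s_{\underline w_0}}]\to\mathbb C[\mathcal X_{s_{\underline w}}]$ is restriction of functions to the subtorus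 where $z^{e_F}=1$ for all faces $F$ of $\operatorname{pa}(\underline w_0)$ that are not faces of $\operatorname{pa}(\underline w)$. Tropicalization: for a Laurent polynomial $\sum_ua_uz^u$ with positive coefficients, its tropicalization is $x\mapsto\min\{u^tx\mid a_u\neq0\}$ (constant terms contribute $0$). *)

theory Defs
  imports
    Complex_Main
    "HOL-Library.FuncSet"
    "HOL-Library.Extended_Real"
    "HOL-Library.Poly_Mapping"
    "HOL-Combinatorics.Permutations"
begin

section \<open>Reduced expressions\<close>

text \<open>A word \<open>[i\<^sub>1, \<dots>, i\<^sub>l]\<close> of letters in \<open>{1..<n}\<close> stands for
  \<open>s\<^bsub>i\<^sub>1\<^esub> \<cdots> s\<^bsub>i\<^sub>l\<^esub>\<close>.\<close>

definition word_perm :: "nat list \<Rightarrow> nat \<Rightarrow> nat" where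
  "word_perm w = foldr (\<lambda>i \<pi>. transpose i (Suc i) \<circ> \<pi>) w id"

definition reduced_expression :: "nat \<Rightarrow> nat list \<Rightarrow> (nat \<Rightarrow> nat) \<Rightarrow> bool" where
  "reduced_expression n w \<sigma> \<longleftrightarrow>
     set w \<subseteq> {1..<n} \<and> word_perm w = \<sigma> \<and>
     (\<forall>v. set v \<subseteq> {1..<n} \<and> word_perm v = \<sigma> \<longrightarrow> length w \<le> length v)"

definition longest_perm :: "nat \<Rightarrow> nat \<Rightarrow> nat" where
  "longest_perm n = (\<lambda>i. if i \<in> {1..n} then n + 1 - i else i)"


section \<open>Pseudoline arrangements\<close>

text \<open>Lines, heights and levels are numbered from 1 and crossings from 0: crossing \<open>c\<close> belongs to
  the letter \<open>w ! c\<close>. Column \<open>c\<close> of the arrangement (\<open>0 \<le> c \<le> length w\<close>) is the part between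
  crossing \<open>c - 1\<close> and crossing \<open>c\<close>.\<close>

text \<open>The line at height \<open>h\<close> in column \<open>c\<close>. Appending the letter \<open>i\<close> interchanges the
  lines at heights \<open>i\<close> and \<open>i + 1\<close>, i.e. composes with \<open>s\<^sub>i\<close> on the right.\<close>

definition line_at :: "nat list \<Rightarrow> nat \<Rightarrow> nat \<Rightarrow> nat" where
  "line_at w c h = word_perm (take c w) h"

definition height_in :: "nat list \<Rightarrow> nat \<Rightarrow> nat \<Rightarrow> nat" where
  "height_in w c a = inv (word_perm (take c w)) a"

definition end_height :: "nat list \<Rightarrow> nat \<Rightarrow> nat" where
  "end_height w a = height_in w (length w) a"

definition crossing_lines :: "nat list \<Rightarrow> nat \<Rightarrow> nat set" where
  "crossing_lines w c = {line_at w c (w ! c), line_at w c (Suc (w ! c))}"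

text \<open>\<open>Initial r\<close> is the face at level \<open>r\<close> that is unbounded to the left; \<open>After c\<close> is the face
  with crossing \<open>c\<close> as its left endpoint.\<close>

datatype face = Initial nat | After nat

definition faces :: "nat \<Rightarrow> nat list \<Rightarrow> face set" where
  "faces n w = Initial ` {1..<n} \<union> After ` {..<length w}"

lemma finite_faces: "finite (faces n w)"
  by (simp add: faces_def)

lemma card_faces: "card (faces n w) = length w + (n - 1)"
proof -
  have "card (faces n w) = card (Initial ` {1..<n}) + card (After ` {..<length w})"
    unfolding faces_def by (rule card_Un_disjoint) auto
  then show ?thesis by (simp add: card_image inj_on_def)
qed

definition face_column :: "face \<Rightarrow> nat" where
  "face_column F = (case F of Initial r \<Rightarrow> 0 | After c \<Rightarrow> Suc c)"

definition face_level :: "nat list \<Rightarrow> face \<Rightarrow> nat" where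
  "face_level w F = (case F of Initial r \<Rightarrow> r | After c \<Rightarrow> w ! c)"

text \<open>\<open>F\<^bsub>(k,m)\<^esub>\<close>\<close>

definition pair_face :: "nat list \<Rightarrow> nat \<Rightarrow> nat \<Rightarrow> face" where
  "pair_face w k m = After (THE c. c < length w \<and> crossing_lines w c = {k, m})"

text \<open>The face with crossing \<open>c\<close> as its right endpoint.\<close>

definition face_before :: "nat list \<Rightarrow> nat \<Rightarrow> face" where
  "face_before w c =
     (if \<exists>b<c. w ! b = w ! c then After (Max {b. b < c \<and> w ! b = w ! c}) else Initial (w ! c))"


section \<open>GP-paths\<close>

text \<open>A piece \<open>(c, a)\<close> is the part of line \<open>a\<close> lying in column \<open>c\<close>. Relative to \<open>i\<close>, the lines
  \<open>a \<le> i\<close> are oriented to the left and the lines \<open>a > i\<close> to the right; \<open>in_piece i c a\<close> and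
  \<open>out_piece i c a\<close> are the pieces of \<open>a\<close> through which \<open>a\<close> reaches and leaves crossing \<open>c\<close>.\<close>

type_synonym piece = "nat \<times> nat"

definition in_piece :: "nat \<Rightarrow> nat \<Rightarrow> nat \<Rightarrow> piece" where
  "in_piece i c a = (if a \<le> i then (Suc c, a) else (c, a))"

definition out_piece :: "nat \<Rightarrow> nat \<Rightarrow> nat \<Rightarrow> piece" where
  "out_piece i c a = (if a \<le> i then (c, a) else (Suc c, a))"

definition may_go_straight :: "nat list \<Rightarrow> nat \<Rightarrow> nat \<Rightarrow> nat \<Rightarrow> bool" where
  "may_go_straight w i c a \<longleftrightarrow>
     (\<forall>b. crossing_lines w c = {a, b} \<longrightarrow>
        \<not> (a < b \<and> a \<le> i \<and> b \<le> i) \<and> \<not> (b < a \<and> i < a \<and> i < b))"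

definition rigorous_step :: "nat list \<Rightarrow> nat \<Rightarrow> piece \<Rightarrow> piece \<Rightarrow> bool" where
  "rigorous_step w i P Q \<longleftrightarrow>
     (\<exists>c<length w. \<exists>a b. P = in_piece i c a \<and> Q = out_piece i c b \<and>
        (if a = b then may_go_straight w i c a else crossing_lines w c = {a, b}))"

text \<open>A path is the list of its pieces. For a reduced word the oriented arrangement has no directed
  cycle (at its leftmost point a simple cycle would have to turn counterclockwise, at its rightmost
  point clockwise), so such a list never meets a piece or a crossing twice. The orientation is part
  of a path, hence the component \<open>i\<close>.\<close>

definition gp_paths :: "nat \<Rightarrow> nat list \<Rightarrow> (nat \<times> piece list) set" where
  "gp_paths n w = {(i, ps). i \<in> {1..<n} \<and> ps \<noteq> [] \<and> successively (rigorous_step w i) ps \<and>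
     (\<exists>p q. hd ps = (length w, p) \<and> last ps = (length w, q) \<and>
        1 \<le> p \<and> p \<le> i \<and> i < q \<and> q \<le> n \<and>
        end_height w (i + 1) \<le> end_height w p \<and> end_height w p \<le> end_height w i \<and>
        end_height w (i + 1) \<le> end_height w q \<and> end_height w q \<le> end_height w i)}"

text \<open>Close the path by the vertical segment from \<open>L\<^sub>q\<close> to \<open>L\<^sub>p\<close> at the right end. Its winding
  number around a point of \<open>F\<close> just right of the left endpoint of \<open>F\<close> is read off on the upward
  vertical ray: pieces traversed to the left count 1, those traversed to the right count -1.
  It is positive exactly when \<open>F\<close> is enclosed with the path having \<open>F\<close> to its left.\<close>

definition path_winding :: "nat list \<Rightarrow> nat \<Rightarrow> piece list \<Rightarrow> face \<Rightarrow> int" where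
  "path_winding w i ps F =
     (\<Sum>(c, a)\<leftarrow>ps. if c = face_column F \<and> face_level w F < height_in w c a
                   then (if a \<le> i then 1 else -1) else 0)"

definition enclosed_faces :: "nat \<Rightarrow> nat list \<Rightarrow> nat \<Rightarrow> piece list \<Rightarrow> face set" where
  "enclosed_faces n w i ps = {F \<in> faces n w. path_winding w i ps F > 0}"


section \<open>The weighted area cone\<close>

abbreviation e_face :: "face \<Rightarrow> face \<Rightarrow>\<^sub>0 int" where
  "e_face F \<equiv> Poly_Mapping.single F 1"

definition path_vector :: "nat \<Rightarrow> nat list \<Rightarrow> nat \<Rightarrow> piece list \<Rightarrow> face \<Rightarrow>\<^sub>0 int" where
  "path_vector n w i ps = - (\<Sum>F\<in>enclosed_faces n w i ps. e_face F)"

definition level_crossings :: "nat list \<Rightarrow> nat \<Rightarrow> nat list" where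
  "level_crossings w i = filter (\<lambda>c. w ! c = i) [0..<length w]"

text \<open>\<open>e\<^bsub>[i:k]\<^esub>\<close>\<close>

definition level_vector :: "nat list \<Rightarrow> nat \<Rightarrow> nat \<Rightarrow> face \<Rightarrow>\<^sub>0 int" where
  "level_vector w i k =
     - e_face (Initial i) - (\<Sum>c\<in>set (take k (level_crossings w i)). e_face (After c))"

definition pairing :: "(face \<Rightarrow>\<^sub>0 int) \<Rightarrow> (face \<Rightarrow> real) \<Rightarrow> real" where
  "pairing u x = (\<Sum>F\<in>Poly_Mapping.keys u. of_int (Poly_Mapping.lookup u F) * x F)"

definition weighted_area_cone :: "nat \<Rightarrow> nat list \<Rightarrow> (face \<Rightarrow> real) set" where
  "weighted_area_cone n w =
     {x \<in> faces n w \<rightarrow>\<^sub>E UNIV.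
        (\<forall>(i, ps)\<in>gp_paths n w. 0 \<le> pairing (path_vector n w i ps) x) \<and>
        (\<forall>i\<in>{1..<n}. \<forall>k\<le>length (level_crossings w i). 0 \<le> pairing (level_vector w i k) x)}"


section \<open>Laurent polynomials on the tori\<close>

type_synonym laurent = "(face \<Rightarrow>\<^sub>0 int) \<Rightarrow>\<^sub>0 complex"

abbreviation z_pow :: "(face \<Rightarrow>\<^sub>0 int) \<Rightarrow> laurent" where
  "z_pow u \<equiv> Poly_Mapping.single u 1"

definition laurent_eval :: "laurent \<Rightarrow> (face \<Rightarrow> complex) \<Rightarrow> complex" where
  "laurent_eval P X =
     (\<Sum>u\<in>Poly_Mapping.keys P. Poly_Mapping.lookup P u *
        (\<Prod>F\<in>Poly_Mapping.keys u. X F powi Poly_Mapping.lookup u F))"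

text \<open>Restriction to the subtorus \<open>X\<^sub>F = 1\<close> for all \<open>F \<notin> A\<close>.\<close>

definition restrict_exponent :: "face set \<Rightarrow> (face \<Rightarrow>\<^sub>0 int) \<Rightarrow> face \<Rightarrow>\<^sub>0 int" where
  "restrict_exponent A u =
     (\<Sum>F\<in>Poly_Mapping.keys u \<inter> A. Poly_Mapping.single F (Poly_Mapping.lookup u F))"

definition restrict_laurent :: "face set \<Rightarrow> laurent \<Rightarrow> laurent" where
  "restrict_laurent A P =
     (\<Sum>u\<in>Poly_Mapping.keys P. Poly_Mapping.single (restrict_exponent A u) (Poly_Mapping.lookup P u))"

text \<open>For a nonzero polynomial this is a minimum over a finite nonempty set; extended reals only
  matter for the zero polynomial (which occurs for \<open>n \<le> 1\<close>), whose tropicalization is \<open>\<infinity>\<close>.\<close>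

definition tropicalization :: "laurent \<Rightarrow> (face \<Rightarrow> real) \<Rightarrow> ereal" where
  "tropicalization P x = (INF u\<in>Poly_Mapping.keys P. ereal (pairing u x))"


section \<open>The superpotential\<close>

definition initial_word :: "nat \<Rightarrow> nat list" where
  "initial_word n = concat (map (\<lambda>m. rev [1..<Suc m]) [1..<n])"

definition initial_superpotential :: "nat \<Rightarrow> laurent" where
  "initial_superpotential n =
     (let e = (\<lambda>k m. e_face (pair_face (initial_word n) k m)) in
      \<Sum>i\<in>{1..<n}.
        (\<Sum>k=0..n-1-i. z_pow (- e_face (Initial i) - (\<Sum>j=1..k. e j (i + j)))) +
        (\<Sum>k=0..n-1-i. z_pow (- (\<Sum>j=0..k. e i (n - j)))))"

text \<open>Old coordinates in terms of new ones when the crossings \<open>j\<close> and \<open>j + 1\<close> commute: each face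
  keeps its left endpoint, whose position changes.\<close>

definition commutation_coords :: "nat \<Rightarrow> (face \<Rightarrow> complex) \<Rightarrow> face \<Rightarrow> complex" where
  "commutation_coords j X' = X' \<circ> transpose (After j) (After (Suc j))"

text \<open>Old coordinates in terms of new ones when the letters \<open>j, j + 1, j + 2\<close> of \<open>w\<close> are changed from
  \<open>r, t, r\<close> to \<open>t, r, t\<close>, giving \<open>w'\<close>. In the order of the cases, the old face is the face between
  crossings \<open>j\<close> and \<open>j + 2\<close>, then \<open>E\<^sub>1\<close>, \<open>E\<^sub>2\<close>, \<open>E\<^sub>3\<close>, \<open>E\<^sub>4\<close> around it: the level-\<open>r\<close>
  face ending at \<open>j\<close>, the level-\<open>t\<close> face starting at \<open>j + 1\<close>, the level-\<open>r\<close> face starting at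
  \<open>j + 2\<close>, the level-\<open>t\<close> face ending at \<open>j + 1\<close>.\<close>

definition braid_coords ::
  "nat list \<Rightarrow> nat list \<Rightarrow> nat \<Rightarrow> (face \<Rightarrow> complex) \<Rightarrow> face \<Rightarrow> complex" where
  "braid_coords w w' j X' E =
     (if E = After j then inverse (X' (After j))
      else if E = face_before w j
        then X' (face_before w' (j + 1)) * (1 + X' (After j))
      else if E = After (j + 1)
        then X' (After (j + 2)) * (1 + X' (After j))
      else if E = After (j + 2)
        then X' (After (j + 1)) * inverse (1 + inverse (X' (After j)))
      else if E = face_before w (j + 1)
        then X' (face_before w' j) * inverse (1 + inverse (X' (After j)))
      else X' E)"

text \<open>\<open>superpotential_via n w W\<close>: some sequence of commutations and braid moves from the initial
  word to \<open>w\<close> transforms the initial expression of the superpotential into \<open>W\<close>. After a braid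
  move the new expression is the Laurent polynomial that agrees with the mutated old one on the part
  of the new torus where the mutation map is defined and takes values in the old torus.\<close>

inductive superpotential_via :: "nat \<Rightarrow> nat list \<Rightarrow> laurent \<Rightarrow> bool" for n :: nat where
  initial: "superpotential_via n (initial_word n) (initial_superpotential n)"
| commutation:
    "superpotential_via n (u @ [r, t] @ v) W \<Longrightarrow> r + 1 < t \<or> t + 1 < r \<Longrightarrow>
     (\<And>X'. (\<forall>E. X' E \<noteq> 0) \<Longrightarrow>
        laurent_eval W' X' = laurent_eval W (commutation_coords (length u) X')) \<Longrightarrow>
     superpotential_via n (u @ [t, r] @ v) W'"
| braid:
    "superpotential_via n (u @ [r, t, r] @ v) W \<Longrightarrow> t = r + 1 \<or> r = t + 1 \<Longrightarrow>
     (\<And>X'. (\<forall>E. X' E \<noteq> 0) \<Longrightarrow> 1 + X' (After (length u)) \<noteq> 0 \<Longrightarrow>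
        laurent_eval W' X' =
        laurent_eval W (braid_coords (u @ [r, t, r] @ v) (u @ [t, r, t] @ v) (length u) X')) \<Longrightarrow>
     superpotential_via n (u @ [t, r, t] @ v) W'"

text \<open>The result does not depend on the chosen sequence of moves.\<close>

definition superpotential :: "nat \<Rightarrow> nat list \<Rightarrow> laurent" where
  "superpotential n w = (THE W. superpotential_via n w W)"

end

(*
Cutting the arrangement at its last crossing expresses the sum over all rigorous paths from L_p to
L_q, weighted by z^(-enclosed faces), through the corresponding sums of the shorter word; the key
point is that the parts of a path in a column descend strictly and alternate in orientation. These
recursions show that the sum of z^(e_p) over the GP-paths p of a reduced word of w_0 and of
z^(e_[i:k]) with k < n_i is invariant under commutations and (by a computation with three lines)
braid moves, and that it agrees with Magee's formula at the initial word. Since reduced words are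
connected by such moves, it is the superpotential at every reduced word of w_0. Its coefficients
are positive, so the restricted tropicalization is nonnegative exactly where all restricted
exponents are. A GP-path of w_0 meets the part of w in finitely many GP-paths, the winding numbers
of which add up; conversely each GP-path of w extends to w_0. The missing e_[i:k], k = n_i, is
redundant: the last face at level i is enclosed alone by a GP-path.
*)
theory Submission
  imports Defs
begin


section \<open>Ascending words and the word property\<close>

text \<open>No planar topology is used: the absence of directed cycles, the disjointness of regions
  and the bound of winding numbers by 0 and 1 all come from inductions that remove crossings from
  the right. The ends of paths must be arbitrary in these inductions, since a GP-path breaks into
  pieces with other ends. What remains of planarity in the algebra is that path sums from a line to
  a higher one vanish. In a braid move after the prefix \<open>u\<close>, the faces E_2 and E_3
  start inside the move, whereas E_1 and E_4 start further left and are the last faces of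
  \<open>u\<close> at their levels. Rescaling the coordinate of such a face only multiplies the path
  sums of \<open>u\<close> by factors depending on the heights of the two ends. This turns the
  mutation into an identity between expressions in the path sums of one and the same word. The
  mutation rules are given pointwise, so Laurent polynomials are identified through their values;
  positive points suffice, and there 1 + X_F never vanishes.\<close>

abbreviation adj_swap :: "nat \<Rightarrow> nat \<Rightarrow> nat" where
  "adj_swap r \<equiv> transpose r (Suc r)"

lemma word_perm_Nil [simp]: "word_perm [] = id"
  and word_perm_Cons: "word_perm (r # w) = adj_swap r \<circ> word_perm w"
  by (simp_all add: word_perm_def)

lemma word_perm_append: "word_perm (u @ v) = word_perm u \<circ> word_perm v"
  by (induction u) (simp_all add: word_perm_Cons comp_assoc)

lemma word_perm_snoc: "word_perm (w @ [r]) = word_perm w \<circ> adj_swap r"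
  by (simp add: word_perm_append word_perm_Cons)

lemma bij_word_perm: "bij (word_perm w)"
proof (induction w)
  case (Cons r w)
  then show ?case unfolding word_perm_Cons by (rule bij_comp) simp
qed (unfold word_perm_Nil, rule bij_id)

lemma word_perm_eq_iff [simp]: "word_perm w x = word_perm w y \<longleftrightarrow> x = y"
  using bij_word_perm[of w] by (auto simp: bij_def inj_def)

lemma word_perm_permutes: "set w \<subseteq> {1..<n} \<Longrightarrow> word_perm w permutes {1..n}"
proof (induction w)
  case (Cons r w)
  have "adj_swap r permutes {1..n}"
    using Cons.prems by (intro permutes_swap_id) auto
  moreover have "word_perm w permutes {1..n}"
    using Cons by simp
  ultimately show ?case
    unfolding word_perm_Cons by (rule permutes_compose[rotated])
qed (unfold word_perm_Nil, rule permutes_id)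

lemma adj_swap_involutory [simp]: "f \<circ> adj_swap r \<circ> adj_swap r = f"
  by (simp add: comp_assoc)

lemma adj_swap_commute:
  "Suc r < t \<or> Suc t < r \<Longrightarrow> adj_swap r \<circ> adj_swap t = adj_swap t \<circ> adj_swap r"
  by (auto simp: fun_eq_iff transpose_def)

lemma adj_swap_braid:
  "t = Suc r \<or> r = Suc t \<Longrightarrow>
   adj_swap r \<circ> adj_swap t \<circ> adj_swap r = adj_swap t \<circ> adj_swap r \<circ> adj_swap t"
  by (auto simp: fun_eq_iff transpose_def)

text \<open>Here \<open>\<pi>\<close> sends a height to the line found there, so the word is read
  starting from an arbitrary arrangement. This makes the condition compatible with
  concatenation.\<close>

fun asc_from :: "(nat \<Rightarrow> nat) \<Rightarrow> nat list \<Rightarrow> bool" where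
  "asc_from \<pi> [] = True"
| "asc_from \<pi> (r # v) = (\<pi> r < \<pi> (Suc r) \<and> asc_from (\<pi> \<circ> adj_swap r) v)"

text \<open>Every crossing interchanges two lines that have not met before. These turn out to be the
  reduced words.\<close>

definition ascending :: "nat list \<Rightarrow> bool" where
  "ascending w \<longleftrightarrow> asc_from id w"

lemma asc_from_append:
  "asc_from \<pi> (u @ v) \<longleftrightarrow> asc_from \<pi> u \<and> asc_from (\<pi> \<circ> word_perm u) v"
  by (induction u arbitrary: \<pi>) (auto simp: word_perm_Cons comp_assoc)

lemma ascending_Nil [simp]: "ascending []"
  by (simp add: ascending_def)

lemma ascending_append: "ascending (u @ v) \<longleftrightarrow> ascending u \<and> asc_from (word_perm u) v"
  by (simp add: ascending_def asc_from_append)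

lemma ascending_snoc:
  "ascending (w @ [r]) \<longleftrightarrow> ascending w \<and> word_perm w r < word_perm w (Suc r)"
  by (simp add: ascending_append)

inductive move :: "nat list \<Rightarrow> nat list \<Rightarrow> bool" where
  commute: "Suc r < t \<or> Suc t < r \<Longrightarrow> move (u @ [r, t] @ v) (u @ [t, r] @ v)"
| braid: "t = Suc r \<or> r = Suc t \<Longrightarrow> move (u @ [r, t, r] @ v) (u @ [t, r, t] @ v)"

lemma move_invariants:
  assumes "move w w'"
  shows "word_perm w' = word_perm w" "set w' = set w" "length w' = length w"
    "ascending w \<Longrightarrow> ascending w'"
proof -
  have comm: "word_perm [t, r] = word_perm [r, t]" if "Suc r < t \<or> Suc t < r" for r t
    using adj_swap_commute[OF that] by (simp add: word_perm_Cons)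
  have br: "word_perm [t, r, t] = word_perm [r, t, r]" if "t = Suc r \<or> r = Suc t" for r t
    using adj_swap_braid[OF that] by (simp add: word_perm_Cons comp_assoc)
  have asc_comm: "asc_from \<pi> [t, r] = asc_from \<pi> [r, t]" if "Suc r < t \<or> Suc t < r" for r t \<pi>
    using that by (auto simp: transpose_def)
  have asc_br: "asc_from \<pi> [t, r, t] = asc_from \<pi> [r, t, r]" if "t = Suc r \<or> r = Suc t" for r t \<pi>
    using that by (auto simp: transpose_def)
  show "word_perm w' = word_perm w"
    using assms
  proof cases
    case c: (commute r t u v)
    show ?thesis unfolding c(1,2) word_perm_append comm[OF c(3)] ..
  next
    case c: (braid t r u v)
    show ?thesis unfolding c(1,2) word_perm_append br[OF c(3)] ..
  qed
  show "set w' = set w" using assms by cases auto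
  show "length w' = length w" using assms by cases auto
  show "ascending w'" if "ascending w"
    using assms
  proof cases
    case c: (commute r t u v)
    show ?thesis using that unfolding c(1,2) ascending_append asc_from_append comm[OF c(3)] asc_comm[OF c(3)] .
  next
    case c: (braid t r u v)
    show ?thesis using that unfolding c(1,2) ascending_append asc_from_append br[OF c(3)] asc_br[OF c(3)] .
  qed
qed

lemma moves_invariants:
  assumes "move\<^sup>*\<^sup>* w w'"
  shows "word_perm w' = word_perm w" "set w' = set w" "length w' = length w"
    "ascending w \<Longrightarrow> ascending w'"
  using assms by (induction rule: rtranclp_induct) (simp_all add: move_invariants)

lemma move_append: "move w w' \<Longrightarrow> move (w @ x) (w' @ x)"
  by (induction rule: move.induct) (metis append.assoc move.intros)+

lemma moves_append: "move\<^sup>*\<^sup>* w w' \<Longrightarrow> move\<^sup>*\<^sup>* (w @ x) (w' @ x)"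
  by (induction rule: rtranclp_induct) (auto intro: rtranclp.rtrancl_into_rtrancl move_append)

text \<open>Bubble sort: as long as some descent is left, interchange it and record the letter. The
  weight n - i of position i decreases to the right, so moving the larger value to the right lowers
  the weighted sum; without descents the permutation is the identity.\<close>

lemma exists_ascending_word:
  assumes "\<pi> permutes {1..n}"
  shows "\<exists>w. set w \<subseteq> {1..<n} \<and> ascending w \<and> word_perm w = \<pi>"
  using assms
proof (induction "\<Sum>i=1..n. (n - i) * \<pi> i" arbitrary: \<pi> rule: less_induct)
  case less
  show ?case
  proof (cases "\<exists>r\<in>{1..<n}. \<pi> (Suc r) < \<pi> r")
    case False
    have noneq: "\<pi> r \<noteq> \<pi> (Suc r)" for r
      by (simp add: inj_eq[OF permutes_inj[OF less.prems]])
    then have mono: "\<pi> r < \<pi> (Suc r)" if "r \<in> {1..<n}" for r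
      using False that by (metis linorder_neqE_nat)
    have "k \<le> n \<Longrightarrow> 1 \<le> k \<Longrightarrow> k \<le> \<pi> k" for k
    proof (induction k)
      case (Suc k)
      then show ?case
        using mono[of k] permutes_in_image[OF less.prems, of 1] by (cases "k = 0") auto
    qed simp
    then have "\<pi> = id"
      by (intro permutes_natset_ge[OF less.prems]) auto
    then show ?thesis by (intro exI[of _ "[]"]) auto
  next
    case True
    then obtain r where r: "r \<in> {1..<n}" "\<pi> (Suc r) < \<pi> r" by blast
    let ?\<rho> = "\<pi> \<circ> adj_swap r"
    have perm: "?\<rho> permutes {1..n}"
      using r by (intro permutes_compose[OF permutes_swap_id less.prems]) auto
    have split: "(\<Sum>i=1..n. (n - i) * f i) =
        (\<Sum>i\<in>{1..n} - {r, Suc r}. (n - i) * f i) + ((n - r) * f r + (n - Suc r) * f (Suc r))"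
      for f :: "nat \<Rightarrow> nat"
      using r by (subst sum.subset_diff[of "{r, Suc r}"]) auto
    have nr: "n - r = Suc (n - Suc r)" using r by auto
    have "(\<Sum>i\<in>{1..n} - {r, Suc r}. (n - i) * ?\<rho> i) = (\<Sum>i\<in>{1..n} - {r, Suc r}. (n - i) * \<pi> i)"
      by (intro sum.cong) (auto simp: transpose_def)
    then have "(\<Sum>i=1..n. (n - i) * ?\<rho> i) < (\<Sum>i=1..n. (n - i) * \<pi> i)"
      using r unfolding split by (simp add: nr)
    from less.hyps[OF this perm] obtain w where
      w: "set w \<subseteq> {1..<n}" "ascending w" "word_perm w = ?\<rho>" by blast
    have "ascending (w @ [r])" "word_perm (w @ [r]) = \<pi>" "set (w @ [r]) \<subseteq> {1..<n}"
      using w r by (auto simp: ascending_snoc word_perm_snoc)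
    then show ?thesis by blast
  qed
qed

text \<open>If \<open>\<pi>\<close> has descents at two different positions, then it has reduced words ending with the two
  sides of a commutation or of a braid relation; the induction hypothesis connects these
  to the given words.\<close>

lemma ascending_words_connected:
  assumes "set w \<subseteq> {1..<n}" "set w' \<subseteq> {1..<n}" "ascending w" "ascending w'"
    "word_perm w = word_perm w'"
  shows "move\<^sup>*\<^sup>* w w'"
  using assms
proof (induction "length w" arbitrary: w w' rule: less_induct)
  case less
  have desc: "word_perm (u @ [r]) (Suc r) < word_perm (u @ [r]) r" if "ascending (u @ [r])" for u r
    using that by (simp add: ascending_snoc word_perm_snoc)
  show ?case
  proof (cases w rule: rev_cases)
    case Nil
    show ?thesis
    proof (cases w' rule: rev_cases)
      case (snoc u t)
      then show ?thesis using desc[of u t] less.prems Nil by simp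
    qed (simp add: Nil)
  next
    case (snoc u r)
    note wu = snoc
    let ?\<pi> = "word_perm w"
    have dr: "?\<pi> (Suc r) < ?\<pi> r" using desc[of u r] less.prems snoc by simp
    show ?thesis
    proof (cases w' rule: rev_cases)
      case Nil
      then show ?thesis using dr less.prems by simp
    next
      case (snoc u' t)
      have dt: "?\<pi> (Suc t) < ?\<pi> t" using desc[of u' t] less.prems snoc by simp
      have pu: "word_perm u = ?\<pi> \<circ> adj_swap r" using wu by (simp add: word_perm_snoc)
      have pu': "word_perm u' = ?\<pi> \<circ> adj_swap t" using snoc less.prems by (simp add: word_perm_snoc)
      have asc: "ascending u" "ascending u'" using less.prems wu snoc by (auto simp: ascending_snoc)
      have letters: "set u \<subseteq> {1..<n}" "set u' \<subseteq> {1..<n}" "r \<in> {1..<n}" "t \<in> {1..<n}"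
        using less.prems wu snoc by auto
      have perm: "?\<pi> permutes {1..n}" by (rule word_perm_permutes) fact
      have swp: "adj_swap r permutes {1..n}" "adj_swap t permutes {1..n}"
        using letters by (auto intro: permutes_swap_id)
      have IH: "move\<^sup>*\<^sup>* x y" if "length x < length w" "set x \<subseteq> {1..<n}" "set y \<subseteq> {1..<n}"
        "ascending x" "ascending y" "word_perm x = word_perm y" for x y
        using less.hyps that by blast
      have join: ?thesis
        if x: "ascending (x @ [r])" "ascending (y @ [t])" "word_perm (x @ [r]) = ?\<pi>"
          "word_perm (y @ [t]) = ?\<pi>" "set x \<subseteq> {1..<n}" "set y \<subseteq> {1..<n}"
          "move (x @ [r]) (y @ [t])" for x y
      proof -
        have "word_perm x = ?\<pi> \<circ> adj_swap r" "word_perm y = ?\<pi> \<circ> adj_swap t"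
          using x by (simp_all add: word_perm_snoc flip: x(3)) (metis adj_swap_involutory x(4) word_perm_snoc)
        then have "move\<^sup>*\<^sup>* u x"
          using x wu asc letters pu by (intro IH) (auto simp: ascending_snoc)
        \<comment> \<open>The length of \<open>y\<close> is controlled only indirectly: moves
          preserve length, and they lead from \<open>u\<close> to \<open>x\<close> and from
          \<open>x @ [r]\<close> to \<open>y @ [t]\<close>.\<close>
        moreover have "length y < length w"
          using moves_invariants(3)[OF calculation] move_invariants(3)[OF x(7)] wu by simp
        then have "move\<^sup>*\<^sup>* y u'"
          using \<open>word_perm y = _\<close> x asc letters pu' by (intro IH) (auto simp: ascending_snoc)
        ultimately show ?thesis
          using moves_append[of u x "[r]"] moves_append[of y u' "[t]"] x(7) wu snoc
          by (metis converse_rtranclp_into_rtranclp rtranclp_trans)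
      qed
      consider "r = t" | "Suc r < t \<or> Suc t < r" | "t = Suc r \<or> r = Suc t" by linarith
      then show ?thesis
      proof cases
        case 1
        then have "move\<^sup>*\<^sup>* u u'"
          using wu asc letters pu pu' by (intro IH) auto
        then show ?thesis using 1 wu snoc moves_append by blast
      next
        case 2
        have "?\<pi> \<circ> adj_swap r \<circ> adj_swap t permutes {1..n}"
          using perm swp by (intro permutes_compose) auto
        then obtain x where x: "set x \<subseteq> {1..<n}" "ascending x" "word_perm x = ?\<pi> \<circ> adj_swap r \<circ> adj_swap t"
          using exists_ascending_word by blast
        have "word_perm (x @ [r, t]) = ?\<pi>"
          using x adj_swap_commute[OF 2]
          by (simp add: word_perm_append word_perm_Cons comp_assoc) (simp flip: comp_assoc)
        moreover have "word_perm (x @ [t, r]) = ?\<pi>"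
          using x by (simp add: word_perm_append word_perm_Cons flip: comp_assoc)
        moreover have "ascending (x @ [r, t])" "ascending (x @ [t, r])"
          using x dr dt 2 by (auto simp: ascending_append transpose_def)
        ultimately show ?thesis
          using x letters move.commute[of t r x "[]"] 2
          by (intro join[of "x @ [t]" "x @ [r]"]) auto
      next
        case 3
        have "?\<pi> \<circ> adj_swap r \<circ> adj_swap t \<circ> adj_swap r permutes {1..n}"
          using perm swp by (intro permutes_compose) auto
        then obtain x where x: "set x \<subseteq> {1..<n}" "ascending x"
          "word_perm x = ?\<pi> \<circ> adj_swap r \<circ> adj_swap t \<circ> adj_swap r"
          using exists_ascending_word by blast
        have "word_perm (x @ [r, t, r]) = ?\<pi>"
          using x by (simp add: word_perm_append word_perm_Cons flip: comp_assoc)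
        moreover have "word_perm (x @ [t, r, t]) = word_perm (x @ [r, t, r])"
          using 3 move_invariants(1)[OF move.braid[of t r x "[]"]] by simp
        moreover have "ascending (x @ [r, t, r])"
          using x dr dt 3 by (auto simp: ascending_append transpose_def)
        moreover have "move (x @ [r, t, r]) (x @ [t, r, t])"
          using 3 move.braid[of t r x "[]"] by simp
        ultimately show ?thesis
          using x letters move_invariants(4)[of "x @ [r, t, r]" "x @ [t, r, t]"]
          by (intro join[of "x @ [r, t]" "x @ [t, r]"]) auto
      qed
    qed
  qed
qed

text \<open>Exchange argument: where two lines meet again for the first time, the prefix
  \<open>u\<close> already has a descent at the next letter \<open>r\<close>. Hence \<open>u\<close>
  is connected by moves to a word \<open>x @ [r]\<close> of the same length, the two letters
  \<open>r\<close> cancel, and \<open>x @ v\<close> is shorter by two letters.\<close>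

lemma reduced_imp_ascending:
  assumes "reduced_expression n w \<sigma>"
  shows "ascending w"
proof (rule ccontr)
  assume "\<not> ascending w"
  moreover have w: "set w \<subseteq> {1..<n}" "word_perm w = \<sigma>"
    and min: "\<And>v. set v \<subseteq> {1..<n} \<Longrightarrow> word_perm v = \<sigma> \<Longrightarrow> length w \<le> length v"
    using assms by (auto simp: reduced_expression_def)
  have "\<exists>u r v. w = u @ [r] @ v \<and> ascending u \<and> \<not> ascending (u @ [r])" if "\<not> ascending w" for w
    using that
  proof (induction w rule: rev_induct)
    case (snoc r w)
    show ?case
    proof (cases "ascending w")
      case True
      have "w @ [r] = w @ [r] @ []" by simp
      then show ?thesis using snoc.prems True by blast
    next
      case False
      then obtain u r' v where "w = u @ [r'] @ v" "ascending u" "\<not> ascending (u @ [r'])"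
        using snoc.IH by blast
      then have "w @ [r] = u @ [r'] @ (v @ [r])" by simp
      then show ?thesis using \<open>ascending u\<close> \<open>\<not> ascending (u @ [r'])\<close> by blast
    qed
  qed simp
  ultimately obtain u r v where u: "w = u @ [r] @ v" "ascending u" "\<not> ascending (u @ [r])"
    by blast
  let ?\<rho> = "word_perm u \<circ> adj_swap r"
  have letters: "set u \<subseteq> {1..<n}" "r \<in> {1..<n}" "set v \<subseteq> {1..<n}" using u w by auto
  have "?\<rho> permutes {1..n}"
    using word_perm_permutes[of "u @ [r]" n] letters by (simp add: word_perm_snoc)
  then obtain x where x: "set x \<subseteq> {1..<n}" "ascending x" "word_perm x = ?\<rho>"
    using exists_ascending_word by blast
  have "word_perm u (Suc r) < word_perm u r"
    using u by (auto simp: ascending_snoc not_less order_le_less)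
  then have "ascending (x @ [r])" "word_perm (x @ [r]) = word_perm u"
    using x by (auto simp: ascending_snoc word_perm_snoc)
  then have "move\<^sup>*\<^sup>* u (x @ [r])"
    using u letters x by (intro ascending_words_connected[of u n "x @ [r]"]) auto
  note moves_invariants(3)[OF this]
  moreover have "word_perm (x @ v) = \<sigma>"
    using x u w by (auto simp: word_perm_append word_perm_Cons comp_assoc)
  ultimately show False using min[of "x @ v"] x letters u by auto
qed


section \<open>Rigorous paths in one more column\<close>

text \<open>The height conditions of GP-paths are dropped: cutting off a crossing produces paths
  whose ends need not satisfy them, and the recursion has to cover all of these.\<close>

definition paths :: "nat list \<Rightarrow> nat \<Rightarrow> nat \<Rightarrow> nat \<Rightarrow> piece list set" where
  "paths w i p q = {ps. ps \<noteq> [] \<and> successively (rigorous_step w i) ps \<and>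
     hd ps = (length w, p) \<and> last ps = (length w, q)}"

text \<open>\<open>link i A B a b\<close>: a path may arrive along \<open>a\<close> at the crossing of \<open>A < B\<close>, or bypass it,
  and continue along \<open>b\<close>.\<close>

definition link :: "nat \<Rightarrow> nat \<Rightarrow> nat \<Rightarrow> nat \<Rightarrow> nat \<Rightarrow> bool" where
  "link i A B a b \<longleftrightarrow>
     (if a = b then \<not> (a = A \<and> B \<le> i) \<and> \<not> (a = B \<and> i < A) else {A, B} = {a, b})"

lemma line_at_append: "c \<le> length w \<Longrightarrow> line_at (w @ v) c = line_at w c"
  by (simp add: line_at_def fun_eq_iff)

lemma height_in_append: "c \<le> length w \<Longrightarrow> height_in (w @ v) c = height_in w c"
  by (simp add: height_in_def fun_eq_iff)

lemma crossing_lines_append: "c < length w \<Longrightarrow> crossing_lines (w @ v) c = crossing_lines w c"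
  by (simp add: crossing_lines_def line_at_append nth_append)

lemma crossing_lines_snoc:
  "crossing_lines (w @ [r]) (length w) = {word_perm w r, word_perm w (Suc r)}"
  by (simp add: crossing_lines_def line_at_def)

text \<open>The new steps are those between the last two columns. They include lines not taking part
  in the crossing, for which \<open>may_go_straight\<close> holds vacuously.\<close>

lemma rigorous_step_snoc:
  assumes "word_perm w r < word_perm w (Suc r)"
  shows "rigorous_step (w @ [r]) i P Q \<longleftrightarrow> rigorous_step w i P Q \<or>
    (\<exists>a b. P = in_piece i (length w) a \<and> Q = out_piece i (length w) b \<and>
       link i (word_perm w r) (word_perm w (Suc r)) a b)"
proof -
  have straight: "may_go_straight (w @ [r]) i c a = may_go_straight w i c a" if "c < length w" for c a
    using that by (simp add: may_go_straight_def crossing_lines_append)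
  have last_straight: "may_go_straight (w @ [r]) i (length w) a \<longleftrightarrow>
      link i (word_perm w r) (word_perm w (Suc r)) a a" for a
    using assms by (auto simp: may_go_straight_def crossing_lines_snoc link_def doubleton_eq_iff)
  have ex_Suc: "(\<exists>c<Suc m. S c) \<longleftrightarrow> (\<exists>c<m. S c) \<or> S m" for S m
    by (auto simp: less_Suc_eq)
  have "rigorous_step (w @ [r]) i P Q \<longleftrightarrow> (\<exists>c<length w. \<exists>a b. P = in_piece i c a \<and> Q = out_piece i c b \<and>
        (if a = b then may_go_straight (w @ [r]) i c a else crossing_lines (w @ [r]) c = {a, b})) \<or>
      (\<exists>a b. P = in_piece i (length w) a \<and> Q = out_piece i (length w) b \<and>
        (if a = b then may_go_straight (w @ [r]) i (length w) a
         else crossing_lines (w @ [r]) (length w) = {a, b}))"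
    unfolding rigorous_step_def length_append_singleton ex_Suc ..
  also have "\<dots> \<longleftrightarrow> rigorous_step w i P Q \<or>
      (\<exists>a b. P = in_piece i (length w) a \<and> Q = out_piece i (length w) b \<and>
       link i (word_perm w r) (word_perm w (Suc r)) a b)"
  proof -
    have "(\<exists>c<length w. \<exists>a b. P = in_piece i c a \<and> Q = out_piece i c b \<and>
        (if a = b then may_go_straight (w @ [r]) i c a else crossing_lines (w @ [r]) c = {a, b})) \<longleftrightarrow>
        rigorous_step w i P Q"
      unfolding rigorous_step_def by (simp add: straight crossing_lines_append cong: conj_cong)
    moreover have "(if a = b then may_go_straight (w @ [r]) i (length w) a
         else crossing_lines (w @ [r]) (length w) = {a, b}) \<longleftrightarrow>
         link i (word_perm w r) (word_perm w (Suc r)) a b" for a b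
      unfolding last_straight crossing_lines_snoc by (auto simp: link_def)
    ultimately show ?thesis by simp
  qed
  finally show ?thesis .
qed

text \<open>In the last column a right-oriented piece has no successor and a left-oriented piece has
  no predecessor. Hence a path meets the last column only with its first and last piece.\<close>

lemma rigorous_step_columns:
  assumes "rigorous_step w i P Q"
  shows "fst P \<le> length w" "fst Q \<le> length w" "i < snd P \<Longrightarrow> fst P < length w"
    "snd Q \<le> i \<Longrightarrow> fst Q < length w"
  using assms by (auto simp: rigorous_step_def in_piece_def out_piece_def split: if_splits)

lemma successively_interior:
  "successively R (x # ys @ [z]) \<Longrightarrow> y \<in> set ys \<Longrightarrow> (\<exists>a. R a y) \<and> (\<exists>b. R y b)"
proof (induction ys arbitrary: x)
  case (Cons a ys)
  then show ?case by (cases ys) auto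
qed simp

text \<open>Only the part before the cut is free of exceptional steps; the remainder may contain
  further ones and is handled by a second application.\<close>

lemma successively_split:
  assumes "successively (\<lambda>x y. R x y \<or> (x = a \<and> y = b)) xs" "xs \<noteq> []"
  obtains "successively R xs"
  | ys zs where "xs = ys @ zs" "ys \<noteq> []" "zs \<noteq> []" "last ys = a" "hd zs = b" "successively R ys"
      "successively (\<lambda>x y. R x y \<or> (x = a \<and> y = b)) zs"
proof -
  have "successively R xs \<or> (\<exists>ys zs. xs = ys @ zs \<and> ys \<noteq> [] \<and> zs \<noteq> [] \<and> last ys = a \<and> hd zs = b \<and>
      successively R ys \<and> successively (\<lambda>x y. R x y \<or> (x = a \<and> y = b)) zs)"
    using assms
  proof (induction xs)
    case (Cons x xs)
    show ?case
    proof (cases xs)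
      case (Cons y xs')
      have step: "R x y \<or> (x = a \<and> y = b)"
        and tl: "successively (\<lambda>x y. R x y \<or> (x = a \<and> y = b)) xs"
        using Cons.prems Cons by auto
      show ?thesis
      proof (cases "R x y")
        case False
        then show ?thesis
          using step tl Cons by (intro disjI2 exI[of _ "[x]"] exI[of _ xs]) auto
      next
        case True
        from Cons.IH tl Cons consider "successively R xs"
          | ys zs where "xs = ys @ zs" "ys \<noteq> []" "zs \<noteq> []" "last ys = a" "hd zs = b"
            "successively R ys" "successively (\<lambda>x y. R x y \<or> (x = a \<and> y = b)) zs"
          by blast
        then show ?thesis
        proof cases
          case 1
          then show ?thesis using True Cons by simp
        next
          case 2
          then have "hd ys = y" using Cons by (cases ys) auto
          then have "successively R (x # ys)"
            using True 2 by (cases ys) auto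
          then show ?thesis
            using 2 by (intro disjI2 exI[of _ "x # ys"] exI[of _ zs]) auto
        qed
      qed
    qed simp
  qed simp
  then show ?thesis using that by blast
qed

context
  fixes w :: "nat list" and r i A B K :: nat
  defines "A \<equiv> word_perm w r" and "B \<equiv> word_perm w (Suc r)" and "K \<equiv> Suc (length w)"
  assumes asc: "A < B"
begin

lemmas step_snoc = rigorous_step_snoc[of w r i, folded A_def B_def, OF asc]

lemma last_step_iff:
  "(\<exists>a b. (c, x) = in_piece i (length w) a \<and> (d, y) = out_piece i (length w) b \<and> link i A B a b)
   \<longleftrightarrow> c = (if x \<le> i then K else length w) \<and> d = (if y \<le> i then length w else K) \<and> link i A B x y"
  by (auto simp: in_piece_def out_piece_def K_def)

text \<open>Between its two end pieces a path stays in the columns of \<open>w\<close>, except that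
  it may touch the new crossing from the left, turning from \<open>B\<close> to \<open>A\<close>.
  Two such turns would enclose a path from \<open>A\<close> to \<open>B\<close>, so there is at most
  one. The hypothesis \<open>no_cycle\<close> cannot be discharged here: it follows from
  \<open>path_descends\<close>, whose induction rests on this very case distinction.\<close>

lemma paths_snoc_cases_raw:
  assumes ps: "ps \<in> paths (w @ [r]) i p q" and pq: "p \<le> i" "i < q"
    and no_cycle: "A \<le> i \<longrightarrow> i < B \<longrightarrow> paths w i A B = {}"
  obtains (turn) "p = A" "q = B" "ps = [(K, p), (K, q)]"
  | (single) p' q' \<pi> where "p' \<le> i" "i < q'" "link i A B p p'" "link i A B q' q"
      "\<pi> \<in> paths w i p' q'" "ps = (K, p) # \<pi> @ [(K, q)]"
  | (double) \<pi> \<pi>' where "A \<le> i" "i < B" "p \<noteq> A" "q \<noteq> B" "\<pi> \<in> paths w i p B" "\<pi>' \<in> paths w i A q"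
      "ps = (K, p) # (\<pi> @ \<pi>') @ [(K, q)]"
proof -
  let ?R = "rigorous_step (w @ [r]) i"
  let ?l = "length w"
  have ne: "ps \<noteq> []" and succ: "successively ?R ps" and hd: "hd ps = (K, p)" and last: "last ps = (K, q)"
    using ps by (auto simp: paths_def K_def)
  obtain ps' where ps': "ps = (K, p) # ps'" using ne hd by (cases ps) auto
  have "ps' \<noteq> []" using last pq ps' by auto
  then obtain mid where mid: "ps = (K, p) # mid @ [(K, q)]"
    using last ps' by (cases ps' rule: rev_cases) auto
  have w_cols: "c \<le> ?l \<and> d \<le> ?l" if "rigorous_step w i (c, x) (d, y)" for c d x y
    using rigorous_step_columns[OF that] by auto
  have R_iff: "?R (c, x) (d, y) \<longleftrightarrow> rigorous_step w i (c, x) (d, y) \<or>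
     (c = (if x \<le> i then K else ?l) \<and> d = (if y \<le> i then ?l else K) \<and> link i A B x y)" for c x d y
    unfolding step_snoc last_step_iff ..
  have interior: "fst x \<le> ?l" if x: "x \<in> set mid" for x
  proof -
    obtain a b where ab: "?R a x" "?R x b" using successively_interior[OF succ[unfolded mid] x] by blast
    then show ?thesis
      using rigorous_step_columns(4)[OF ab(1)] rigorous_step_columns(3)[OF ab(2)]
      by (cases "snd x \<le> i") auto
  qed
  have AB: "x = A \<and> y = B" if "link i A B x y" "x \<le> i" "i < y" for x y
    using that asc by (auto simp: link_def doubleton_eq_iff split: if_splits)
  have BA: "x = B \<and> y = A" if "link i A B x y" "y \<le> i" "i < x" for x y
    using that asc by (auto simp: link_def doubleton_eq_iff split: if_splits)
  show thesis
  proof (cases "mid = []")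
    case True
    then have "?R (K, p) (K, q)" using succ mid by simp
    then have "link i A B p q" using w_cols[of K p K q] pq by (auto simp: R_iff K_def)
    then show thesis using AB pq mid True turn by auto
  next
    case False
    obtain c p' where hd_mid: "hd mid = (c, p')" by (cases "hd mid")
    obtain d q' where last_mid: "last mid = (d, q')" by (cases "last mid")
    have "c \<le> ?l" "d \<le> ?l" using interior[OF hd_in_set[OF False]] interior[OF last_in_set[OF False]]
        hd_mid last_mid by auto
    have "?R (K, p) (c, p')"
      using succ mid False hd_mid by (cases mid) auto
    then have p': "c = ?l" "p' \<le> i" "link i A B p p'"
      using w_cols[of K p c p'] pq \<open>c \<le> ?l\<close> by (auto simp: R_iff K_def split: if_splits)
    have "?R (d, q') (K, q)"
      using succ mid False last_mid by (simp add: successively_append_iff successively_Cons)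
    then have q': "d = ?l" "i < q'" "link i A B q' q"
      using w_cols[of d q' K q] pq \<open>d \<le> ?l\<close> by (auto simp: R_iff K_def split: if_splits)
    have "successively ?R mid"
      using succ mid False by (simp add: successively_append_iff successively_Cons)
    \<comment> \<open>A step through the new crossing that starts and ends in column
      \<open>length w\<close> arrives on a right-oriented line and leaves on a left-oriented one,
      which forces it to be the turn from \<open>B\<close> to \<open>A\<close>.\<close>
    then have "successively (\<lambda>x y. rigorous_step w i x y \<or> (x = (?l, B) \<and> y = (?l, A) \<and> A \<le> i \<and> i < B)) mid"
    proof (rule successively_mono)
      fix x y assume xy: "?R x y" "x \<in> set mid" "y \<in> set mid"
      obtain c x' where x: "x = (c, x')" by (cases x)
      obtain d y' where y: "y = (d, y')" by (cases y)
      show "rigorous_step w i x y \<or> (x = (?l, B) \<and> y = (?l, A) \<and> A \<le> i \<and> i < B)"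
        using interior[OF xy(2)] interior[OF xy(3)] xy(1) BA[of x' y']
        unfolding x y R_iff by (auto simp: K_def split: if_splits)
    qed
    note mid_succ = this
    show thesis
    proof (cases "A \<le> i \<and> i < B")
      case False
      then have "successively (rigorous_step w i) mid" using mid_succ by (auto simp: successively_conv_nth)
      then have "mid \<in> paths w i p' q'"
        using \<open>mid \<noteq> []\<close> hd_mid last_mid p' q' by (auto simp: paths_def)
      then show thesis using single p' q' mid by blast
    next
      case True
      then have "successively (\<lambda>x y. rigorous_step w i x y \<or> (x = (?l, B) \<and> y = (?l, A))) mid"
        using mid_succ by simp
      from this \<open>mid \<noteq> []\<close> show thesis
      proof (cases rule: successively_split)
        case 1
        then have "mid \<in> paths w i p' q'"
          using \<open>mid \<noteq> []\<close> hd_mid last_mid p' q' by (auto simp: paths_def)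
        then show thesis using single p' q' mid by blast
      next
        case s: (2 \<pi> \<pi>')
        have \<pi>: "\<pi> \<in> paths w i p' B"
          using s hd_mid p' by (auto simp: paths_def)
        from s(7,3) have \<pi>': "\<pi>' \<in> paths w i A q'"
        proof (cases rule: successively_split)
          case 1
          then show ?thesis using s last_mid q' by (auto simp: paths_def)
        next
          \<comment> \<open>A second turn: the part between the two turns runs from \<open>A\<close>
            to \<open>B\<close> inside \<open>w\<close>.\<close>
          case t: (2 \<rho> \<rho>')
          then have "\<rho> \<in> paths w i A B" using s by (auto simp: paths_def)
          then show ?thesis using no_cycle True by auto
        qed
        have "p' = p" "q' = q"
          using p' q' pq True asc by (auto simp: link_def doubleton_eq_iff split: if_splits)
        moreover have "p \<noteq> A" "q \<noteq> B"
          using \<pi> \<pi>' no_cycle True calculation by auto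
        ultimately show thesis using double \<pi> \<pi>' True s(1) mid by simp
      qed
    qed
  qed
qed

lemma paths_snoc_turn:
  assumes "A \<le> i" "i < B"
  shows "[(K, A), (K, B)] \<in> paths (w @ [r]) i A B"
  using assms asc last_step_iff[of K A K B]
  by (simp add: paths_def K_def step_snoc link_def)

lemma paths_snoc_single:
  assumes "p' \<le> i" "i < q'" "p \<le> i" "i < q" "link i A B p p'" "link i A B q' q" "\<pi> \<in> paths w i p' q'"
  shows "(K, p) # \<pi> @ [(K, q)] \<in> paths (w @ [r]) i p q"
proof -
  have "rigorous_step (w @ [r]) i (K, p) (length w, p')" "rigorous_step (w @ [r]) i (length w, q') (K, q)"
    unfolding step_snoc last_step_iff using assms by auto
  moreover have "successively (rigorous_step (w @ [r]) i) \<pi>"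
    using assms(7) by (auto simp: paths_def step_snoc elim: successively_mono)
  ultimately show ?thesis
    using assms(7) by (auto simp: paths_def K_def successively_append_iff successively_Cons hd_append)
qed

lemma paths_snoc_double:
  assumes "A \<le> i" "i < B" "p \<le> i" "i < q" "p \<noteq> A" "q \<noteq> B" "\<pi> \<in> paths w i p B" "\<pi>' \<in> paths w i A q"
  shows "(K, p) # (\<pi> @ \<pi>') @ [(K, q)] \<in> paths (w @ [r]) i p q"
proof -
  have "rigorous_step (w @ [r]) i (K, p) (length w, p)" "rigorous_step (w @ [r]) i (length w, q) (K, q)"
    "rigorous_step (w @ [r]) i (length w, B) (length w, A)"
    unfolding step_snoc last_step_iff using assms asc by (auto simp: link_def doubleton_eq_iff)
  moreover have "successively (rigorous_step (w @ [r]) i) \<pi>" "successively (rigorous_step (w @ [r]) i) \<pi>'"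
    using assms(7,8) by (auto simp: paths_def step_snoc elim: successively_mono)
  ultimately show ?thesis
    using assms(7,8) by (auto simp: paths_def K_def successively_append_iff successively_Cons hd_append)
qed

end

lemma paths_Nil: "p \<noteq> q \<Longrightarrow> paths [] i p q = {}"
proof -
  assume "p \<noteq> q"
  have "ps = [] \<or> hd ps = last ps" if "successively (rigorous_step [] i) ps" for ps
    using that by (cases ps rule: remdups_adj.cases) (auto simp: rigorous_step_def)
  then have False if "ps \<in> paths [] i p q" for ps
    using that \<open>p \<noteq> q\<close> unfolding paths_def by fastforce
  then show ?thesis by blast
qed


section \<open>Winding numbers of rigorous paths\<close>

lemma end_height_iff: "end_height w a = h \<longleftrightarrow> word_perm w h = a"
  unfolding end_height_def height_in_def using bij_word_perm[of w]
  by (simp add: bij_inv_eq_iff eq_commute)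

lemma end_height_word_perm [simp]: "end_height w (word_perm w h) = h"
  by (simp add: end_height_iff)

lemma word_perm_end_height [simp]: "word_perm w (end_height w a) = a"
  using end_height_iff by blast

lemma end_height_eq_iff [simp]: "end_height w a = end_height w b \<longleftrightarrow> a = b"
  by (metis word_perm_end_height)

lemma end_height_snoc: "end_height (w @ [r]) a = adj_swap r (end_height w a)"
  by (simp add: end_height_iff word_perm_snoc)

lemma end_height_snoc_cases:
  "end_height (w @ [r]) a =
    (if a = word_perm w r then Suc r else if a = word_perm w (Suc r) then r else end_height w a)"
  using end_height_iff[of w a r] end_height_iff[of w a "Suc r"]
  by (auto simp: end_height_snoc transpose_def)

lemma end_height_Nil: "end_height [] a = a"
  by (simp add: end_height_iff)

text \<open>This is what excludes directed cycles: just before \<open>A\<close> and \<open>B\<close>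
  cross, \<open>A\<close> is the lower of the two, so no path leads from \<open>A\<close> to
  \<open>B\<close>, and the turn back from \<open>B\<close> to \<open>A\<close> cannot close
  up.\<close>

lemma path_descends:
  assumes "ascending w" "\<pi> \<in> paths w i p q" "p \<le> i" "i < q"
  shows "end_height w q < end_height w p"
  using assms
proof (induction w arbitrary: \<pi> p q rule: rev_induct)
  case Nil
  then show ?case using paths_Nil[of p q i] by auto
next
  case (snoc r w)
  define A where "A = word_perm w r"
  define B where "B = word_perm w (Suc r)"
  have asc: "ascending w" "A < B" using snoc.prems by (auto simp: ascending_snoc A_def B_def)
  have E: "end_height w x = r \<longleftrightarrow> x = A" "end_height w x = Suc r \<longleftrightarrow> x = B" for x
    by (auto simp: end_height_iff A_def B_def)
  have E': "end_height (w @ [r]) x = (if x = A then Suc r else if x = B then r else end_height w x)" for x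
    by (simp add: end_height_snoc_cases A_def B_def)
  have no_cycle: "A \<le> i \<longrightarrow> i < B \<longrightarrow> paths w i A B = {}"
    using snoc.IH[of _ A B] asc E[of A] E[of B] by fastforce
  from asc(2)[unfolded A_def B_def] snoc.prems(2-4) no_cycle[unfolded A_def B_def] show ?case
  proof (cases rule: paths_snoc_cases_raw)
    case turn
    then show ?thesis using asc by (simp add: E' flip: A_def B_def)
  next
    case c: (single p' q' \<pi>)
    have "end_height w q' < end_height w p'" using c snoc.IH asc by blast
    moreover have "p' = p \<or> {A, B} = {p, p'}" "q' = q \<or> {A, B} = {q', q}"
      using c by (auto simp: link_def A_def B_def split: if_splits)
    \<comment> \<open>The order of the ends could be reversed only if \<open>p'\<close> and
      \<open>q'\<close> were the two crossing lines. The induction hypothesis would then give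
      \<open>q' = A\<close> and \<open>p' = B\<close>, contradicting \<open>A < B\<close> and
      \<open>p' \<le> i < q'\<close>.\<close>
    ultimately show ?thesis
      using c(1,2) snoc.prems(3,4) asc E[of p] E[of p'] E[of q] E[of q']
      unfolding E' by (auto simp: doubleton_eq_iff)
  next
    case c: (double \<rho> \<rho>')
    \<comment> \<open>Here \<open>A\<close> and \<open>B\<close> have heights \<open>r\<close> and
      \<open>Suc r\<close>, so \<open>p\<close> ends above both and \<open>q\<close> below
      both.\<close>
    have "end_height w B < end_height w p" "end_height w q < end_height w A"
      using c snoc.IH[of \<rho> p B] snoc.IH[of \<rho>' A q] asc snoc.prems by (auto simp: A_def B_def)
    then show ?thesis
      using c(1-4) asc(2) snoc.prems(3,4) E[of p] E[of q] E[of A] E[of B]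
      unfolding E' A_def[symmetric] B_def[symmetric] by auto
  qed
qed

lemma no_path_upwards:
  "ascending w \<Longrightarrow> p \<le> i \<Longrightarrow> i < q \<Longrightarrow> end_height w p \<le> end_height w q \<Longrightarrow> paths w i p q = {}"
  using path_descends by fastforce

lemma paths_snoc_cases:
  assumes "ascending (w @ [r])" "ps \<in> paths (w @ [r]) i p q" "p \<le> i" "i < q"
    and "A = word_perm w r" "B = word_perm w (Suc r)" "K = Suc (length w)"
  obtains (turn) "p = A" "q = B" "ps = [(K, p), (K, q)]"
  | (single) p' q' \<pi> where "p' \<le> i" "i < q'" "link i A B p p'" "link i A B q' q"
      "\<pi> \<in> paths w i p' q'" "ps = (K, p) # \<pi> @ [(K, q)]"
  | (double) \<pi> \<pi>' where "A \<le> i" "i < B" "p \<noteq> A" "q \<noteq> B" "\<pi> \<in> paths w i p B" "\<pi>' \<in> paths w i A q"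
      "ps = (K, p) # (\<pi> @ \<pi>') @ [(K, q)]"
proof -
  have asc: "ascending w" "word_perm w r < word_perm w (Suc r)"
    using assms(1) by (auto simp: ascending_snoc)
  have "word_perm w r \<le> i \<longrightarrow> i < word_perm w (Suc r) \<longrightarrow>
      paths w i (word_perm w r) (word_perm w (Suc r)) = {}"
    using asc by (intro impI no_path_upwards) auto
  from asc(2) assms(2-4) this show thesis
    by (cases rule: paths_snoc_cases_raw) (use that assms(5-7) in blast)+
qed


text \<open>\<open>path_winding\<close> at a free column and height. The free height allows enclosed
  points of different paths to be compared within a column, and a fixed column keeps its meaning
  when the word is extended.\<close>

definition winding :: "nat list \<Rightarrow> nat \<Rightarrow> piece list \<Rightarrow> nat \<Rightarrow> nat \<Rightarrow> int" where
  "winding w i ps c t =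
     (\<Sum>(d, a)\<leftarrow>ps. if d = c \<and> t < height_in w c a then (if a \<le> i then 1 else -1) else 0)"

lemma path_winding_eq: "path_winding w i ps F = winding w i ps (face_column F) (face_level w F)"
  unfolding path_winding_def winding_def
  by (intro arg_cong[of _ _ sum_list] map_cong) auto

lemma winding_append [simp]: "winding w i (ps @ qs) c t = winding w i ps c t + winding w i qs c t"
  by (simp add: winding_def)

lemma winding_Cons:
  "winding w i ((d, a) # ps) c t =
    (if d = c \<and> t < height_in w c a then (if a \<le> i then 1 else -1) else 0) + winding w i ps c t"
  by (simp add: winding_def)

lemma winding_Nil [simp]: "winding w i [] c t = 0"
  by (simp add: winding_def)

lemma winding_snoc_word: "c \<le> length w \<Longrightarrow> winding (w @ v) i ps c t = winding w i ps c t"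
  by (simp add: winding_def height_in_append)

lemma successively_imp_last_or_step:
  "successively R xs \<Longrightarrow> x \<in> set xs \<Longrightarrow> x = last xs \<or> (\<exists>y. R x y)"
proof (induction xs)
  case (Cons a xs)
  then show ?case by (cases xs) auto
qed simp

lemma paths_columns:
  assumes "ps \<in> paths w i p q" "x \<in> set ps"
  shows "fst x \<le> length w"
  using assms successively_imp_last_or_step[of "rigorous_step w i" ps x] rigorous_step_columns(1)[of w i x]
  by (auto simp: paths_def)

lemma winding_outside: "ps \<in> paths w i p q \<Longrightarrow> length w < c \<Longrightarrow> winding v i ps c t = 0"
proof -
  assume "ps \<in> paths w i p q" "length w < c"
  then have "winding v i ps c t = (\<Sum>_\<leftarrow>ps. 0)"
    unfolding winding_def by (intro arg_cong[of _ _ sum_list] map_cong) (auto dest: paths_columns)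
  then show ?thesis by simp
qed

text \<open>In the last column only the two end pieces contribute, the first with sign 1 and the
  last with sign -1.\<close>

lemma winding_snoc_last:
  assumes "ascending (w @ [r])" "ps \<in> paths (w @ [r]) i p q" "p \<le> i" "i < q"
  shows "winding (w @ [r]) i ps (Suc (length w)) t =
    of_bool (t < end_height (w @ [r]) p) - of_bool (t < end_height (w @ [r]) q)"
proof -
  have h: "height_in (w @ [r]) (Suc (length w)) = end_height (w @ [r])"
    by (simp add: end_height_def fun_eq_iff)
  show ?thesis
    using assms
    by (cases rule: paths_snoc_cases[OF _ _ _ _ refl refl refl])
      (auto simp: winding_Cons winding_outside h simp del: append_assoc)
qed

text \<open>The paths are listed from top to bottom. The start \<open>p\<close> of a path is its
  upper end by \<open>path_descends\<close>, so each path ends above the start of the later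
  ones.\<close>

definition stacked :: "nat list \<Rightarrow> nat \<Rightarrow> (nat \<times> nat \<times> piece list) list \<Rightarrow> bool" where
  "stacked w i C \<longleftrightarrow> (\<forall>(p, q, \<rho>)\<in>set C. \<rho> \<in> paths w i p q \<and> p \<le> i \<and> i < q) \<and>
     sorted_wrt (\<lambda>(_, q, _) (p, _, _). end_height w p < end_height w q) C"

text \<open>Cutting off the last column splits a path into at most two, stacked on top of each other.\<close>

lemma paths_snoc_components:
  assumes "ascending (w @ [r])" "ps \<in> paths (w @ [r]) i p q" "p \<le> i" "i < q"
  obtains C where "stacked w i C"
    "\<And>c t. c \<le> length w \<Longrightarrow>
       winding (w @ [r]) i ps c t = (\<Sum>(_, _, \<rho>)\<leftarrow>C. winding w i \<rho> c t)"
    "\<And>p' q' \<rho>. (p', q', \<rho>) \<in> set C \<Longrightarrow>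
       end_height w p' \<le> (if end_height (w @ [r]) p = r then Suc r else end_height (w @ [r]) p) \<and>
       (if end_height (w @ [r]) q = Suc r then r else end_height (w @ [r]) q) \<le> end_height w q'"
proof -
  let ?h' = "end_height (w @ [r])"
  let ?h = "end_height w"
  define A where "A = word_perm w r"
  define B where "B = word_perm w (Suc r)"
  have asc: "ascending w" "A < B" using assms(1) by (auto simp: ascending_snoc A_def B_def)
  have E: "?h x = r \<longleftrightarrow> x = A" "?h x = Suc r \<longleftrightarrow> x = B" for x
    by (auto simp: end_height_iff A_def B_def)
  have E': "?h' x = (if x = A then Suc r else if x = B then r else ?h x)" for x
    by (simp add: end_height_snoc_cases A_def B_def)
  from assms A_def B_def refl show thesis
  proof (cases rule: paths_snoc_cases)
    case turn
    then show ?thesis by (intro that[of "[]"]) (auto simp: winding_Cons stacked_def)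
  next
    case c: (single p' q' \<pi>)
    have *: "p' = p \<or> p = A \<and> p' = B \<or> p = B \<and> p' = A" "q' = q \<or> q = A \<and> q' = B \<or> q = B \<and> q' = A"
      using c by (auto simp: link_def doubleton_eq_iff split: if_splits)
    have "?h p' \<le> (if ?h' p = r then Suc r else ?h' p)"
      using *(1) E[of p] E[of p'] asc unfolding E' by (elim disjE) auto
    moreover have "(if ?h' q = Suc r then r else ?h' q) \<le> ?h q'"
      using *(2) E[of q] E[of q'] asc unfolding E' by (elim disjE) auto
    moreover have "winding (w @ [r]) i ps c t = winding w i \<pi> c t" if "c \<le> length w" for c t
      using that c by (simp add: winding_Cons winding_snoc_word)
    ultimately show ?thesis
      using c by (intro that[of "[(p', q', \<pi>)]"]) (simp_all add: stacked_def)
  next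
    case c: (double \<rho> \<rho>')
    have *: "?h B < ?h p" "?h q < ?h A"
      using c path_descends[of w \<rho> i p B] path_descends[of w \<rho>' i A q] asc assms by auto
    have "winding (w @ [r]) i ps c t = winding w i \<rho> c t + winding w i \<rho>' c t" if "c \<le> length w" for c t
      using that c by (simp add: winding_Cons winding_snoc_word)
    moreover have "p \<noteq> B" "q \<noteq> A" using c assms by auto
    then have "?h' p = ?h p" "?h' q = ?h q"
      using c by (simp_all add: E')
    ultimately show ?thesis
      using c * assms E[of A] E[of B] by (intro that[of "[(p, B, \<rho>), (A, q, \<rho>')]"]) (auto simp: stacked_def)
  qed
qed

lemma sum_list_stacked:
  fixes f :: "'a \<Rightarrow> int"
  assumes "sorted_wrt (\<lambda>x y. \<not> (f x = 1 \<and> f y = 1)) xs" "\<And>x. x \<in> set xs \<Longrightarrow> f x \<in> {0, 1}"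
  shows "sum_list (map f xs) \<in> {0, 1}" "sum_list (map f xs) = 1 \<Longrightarrow> \<exists>x\<in>set xs. f x = 1"
proof -
  have "sum_list (map f xs) = 0 \<and> (\<forall>x\<in>set xs. f x = 0) \<or>
        sum_list (map f xs) = 1 \<and> (\<exists>x\<in>set xs. f x = 1)"
    using assms
  proof (induction xs)
    case (Cons x xs)
    then have "f x = 0 \<or> f x = 1" by auto
    then show ?case using Cons by fastforce
  qed simp
  then show "sum_list (map f xs) \<in> {0, 1}" "sum_list (map f xs) = 1 \<Longrightarrow> \<exists>x\<in>set xs. f x = 1"
    by auto
qed

text \<open>The two claims need each other. Removing a crossing writes a winding number as a sum
  over stacked paths; it stays in {0, 1} because stacked paths enclose no common point, which is the
  second claim with \<open>t = t'\<close>. The second claim in turn is traced back to components,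
  which exist where the winding number is 1.\<close>

lemma winding_stacked_aux:
  assumes "ascending w" "c \<le> length w"
  shows "(\<forall>p q \<pi> t. \<pi> \<in> paths w i p q \<and> p \<le> i \<and> i < q \<longrightarrow> winding w i \<pi> c t \<in> {0, 1}) \<and>
    (\<forall>p q \<pi> p' q' \<pi>' t t'. \<pi> \<in> paths w i p q \<and> p \<le> i \<and> i < q \<and>
      \<pi>' \<in> paths w i p' q' \<and> p' \<le> i \<and> i < q' \<and> end_height w p' < end_height w q \<and>
      winding w i \<pi> c t = 1 \<and> winding w i \<pi>' c t' = 1 \<longrightarrow> t' < t)"
  using assms
proof (induction w rule: rev_induct)
  case Nil
  then show ?case using paths_Nil[of _ _ i] by fastforce
next
  case (snoc r w)
  have asc: "ascending w" "word_perm w r < word_perm w (Suc r)"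
    using snoc.prems by (auto simp: ascending_snoc)
  have range: "winding w i \<pi> c t \<in> {0, 1}"
    if "c \<le> length w" "\<pi> \<in> paths w i p q" "p \<le> i" "i < q" for p q \<pi> t
    using snoc.IH[OF asc(1)] that by blast
  have stacked: "t' < t"
    if "c \<le> length w" "\<pi> \<in> paths w i p q" "p \<le> i" "i < q" "\<pi>' \<in> paths w i p' q'" "p' \<le> i" "i < q'"
      "end_height w p' < end_height w q" "winding w i \<pi> c t = 1" "winding w i \<pi>' c t' = 1"
    for p q \<pi> p' q' \<pi>' t t'
    using snoc.IH[OF asc(1)] that by blast
  have old: "(winding (w @ [r]) i \<pi> c t = 0 \<or> winding (w @ [r]) i \<pi> c t = 1) \<and>
      (winding (w @ [r]) i \<pi> c t = 1 \<longrightarrow> (\<exists>p' q' \<rho>. (p', q', \<rho>) \<in> set C \<and> winding w i \<rho> c t = 1))"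
    if "c \<le> length w" and C: "stacked w i C"
      and sum: "winding (w @ [r]) i \<pi> c t = (\<Sum>(_, _, \<rho>)\<leftarrow>C. winding w i \<rho> c t)" for C \<pi> t
  proof -
    let ?f = "\<lambda>(_, _, \<rho>). winding w i \<rho> c t"
    have mem: "\<rho> \<in> paths w i a b" "a \<le> i" "i < b" if "(a, b, \<rho>) \<in> set C" for a b \<rho>
      using C that by (auto simp: stacked_def)
    have "sorted_wrt (\<lambda>(_, q, _) (p, _, _). end_height w p < end_height w q) C"
      using C by (simp add: stacked_def)
    then have st: "sorted_wrt (\<lambda>x y. \<not> (?f x = 1 \<and> ?f y = 1)) C"
    proof (rule sorted_wrt_mono_rel[rotated])
      fix x y assume xy: "x \<in> set C" "y \<in> set C"
        "(\<lambda>(_, q, _) (p, _, _). end_height w p < end_height w q) x y"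
      obtain a b \<rho> a' b' \<rho>' where eq: "x = (a, b, \<rho>)" "y = (a', b', \<rho>')" by (cases x; cases y)
      show "\<not> (?f x = 1 \<and> ?f y = 1)"
        using stacked[OF \<open>c \<le> length w\<close>, of \<rho> a b \<rho>' a' b' t t] mem[of a b \<rho>] mem[of a' b' \<rho>'] xy
        unfolding eq by auto
    qed
    have "?f x \<in> {0, 1}" if "x \<in> set C" for x
      using range[OF \<open>c \<le> length w\<close>] mem that by (cases x) (simp, blast)
    note * = sum_list_stacked[OF st this]
    show ?thesis
    proof (intro conjI impI)
      show "winding (w @ [r]) i \<pi> c t = 0 \<or> winding (w @ [r]) i \<pi> c t = 1"
        unfolding sum using *(1) by simp
      assume "winding (w @ [r]) i \<pi> c t = 1"
      then obtain x where "x \<in> set C" "?f x = 1" using *(2) unfolding sum by blast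
      then show "\<exists>p' q' \<rho>. (p', q', \<rho>) \<in> set C \<and> winding w i \<rho> c t = 1"
        by (cases x rule: prod_cases3) auto
    qed
  qed
  show ?case
  proof (intro conjI allI impI; elim conjE)
    fix p q \<pi> t
    assume pth: "\<pi> \<in> paths (w @ [r]) i p q" "p \<le> i" "i < q"
    show "winding (w @ [r]) i \<pi> c t \<in> {0, 1}"
    proof (cases "c \<le> length w")
      case True
      obtain C where "stacked w i C" "winding (w @ [r]) i \<pi> c t = (\<Sum>(_, _, \<rho>)\<leftarrow>C. winding w i \<rho> c t)"
        by (rule paths_snoc_components[OF snoc.prems(1) pth]) (use True in blast)
      then show ?thesis using old[OF True, of C \<pi> t] by blast
    next
      case False
      then have "c = Suc (length w)" using snoc.prems by simp
      then show ?thesis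
        using winding_snoc_last[OF snoc.prems(1) pth] path_descends[OF snoc.prems(1) pth]
        by simp
    qed
  next
    fix p q \<pi> p' q' \<pi>' t t'
    assume pth: "\<pi> \<in> paths (w @ [r]) i p q" "p \<le> i" "i < q"
      and pth': "\<pi>' \<in> paths (w @ [r]) i p' q'" "p' \<le> i" "i < q'"
      and less: "end_height (w @ [r]) p' < end_height (w @ [r]) q"
      and one: "winding (w @ [r]) i \<pi> c t = 1" "winding (w @ [r]) i \<pi>' c t' = 1"
    show "t' < t"
    proof (cases "c \<le> length w")
      case True
      obtain C where C: "stacked w i C"
          "winding (w @ [r]) i \<pi> c t = (\<Sum>(_, _, \<rho>)\<leftarrow>C. winding w i \<rho> c t)"
          "\<And>a b \<rho>. (a, b, \<rho>) \<in> set C \<Longrightarrow>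
            (if end_height (w @ [r]) q = Suc r then r else end_height (w @ [r]) q) \<le> end_height w b"
        by (rule paths_snoc_components[OF snoc.prems(1) pth]) (use True in blast)
      obtain a b \<rho> where \<rho>: "(a, b, \<rho>) \<in> set C" "winding w i \<rho> c t = 1"
        using old[OF True C(1,2)] one(1) by blast
      obtain C' where C': "stacked w i C'"
          "winding (w @ [r]) i \<pi>' c t' = (\<Sum>(_, _, \<rho>)\<leftarrow>C'. winding w i \<rho> c t')"
          "\<And>a b \<rho>. (a, b, \<rho>) \<in> set C' \<Longrightarrow>
            end_height w a \<le> (if end_height (w @ [r]) p' = r then Suc r else end_height (w @ [r]) p')"
        by (rule paths_snoc_components[OF snoc.prems(1) pth']) (use True in blast)
      obtain a' b' \<rho>' where \<rho>': "(a', b', \<rho>') \<in> set C'" "winding w i \<rho>' c t' = 1"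
        using old[OF True C'(1,2)] one(2) by blast
      have mem: "\<rho> \<in> paths w i a b" "a \<le> i" "i < b" and mem': "\<rho>' \<in> paths w i a' b'" "a' \<le> i" "i < b'"
        using C(1) \<rho>(1) C'(1) \<rho>'(1) by (auto simp: stacked_def)
      \<comment> \<open>The bounds on the ends of components are weaker by one at the heights of the
        crossing. Both would be weakened only in this configuration, where \<open>p'\<close> and
        \<open>q\<close> would be the larger and the smaller crossing line although
        \<open>p' \<le> i < q\<close>.\<close>
      have "\<not> (end_height (w @ [r]) p' = r \<and> end_height (w @ [r]) q = Suc r)"
        using asc(2) pth pth' by (auto simp: end_height_iff word_perm_snoc)
      then have "end_height w a' < end_height w b"
        using C(3)[OF \<rho>(1)] C'(3)[OF \<rho>'(1)] less by (auto split: if_splits)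
      then show ?thesis by (rule stacked[OF True mem mem' _ \<rho>(2) \<rho>'(2)])
    next
      case False
      then have "c = Suc (length w)" using snoc.prems by simp
      then show ?thesis
        using winding_snoc_last[OF snoc.prems(1) pth, of t] winding_snoc_last[OF snoc.prems(1) pth', of t']
          less one by (auto simp: of_bool_def split: if_splits)
    qed
  qed
qed

lemma winding_range:
  assumes "ascending w" "\<pi> \<in> paths w i p q" "p \<le> i" "i < q" "c \<le> length w"
  shows "winding w i \<pi> c t \<in> {0, 1}"
  using winding_stacked_aux[OF assms(1,5)] assms(2-4) by blast

text \<open>Faces unbounded to the left are never enclosed: peeling off columns from the right, each
  piece of a path is met as an end piece in a column of the form
  \<open>Suc (length w)\<close>.\<close>

lemma winding_column_0:
  assumes "ascending w" "\<pi> \<in> paths w i p q" "p \<le> i" "i < q"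
  shows "winding w i \<pi> 0 t = 0"
  using assms
proof (induction w arbitrary: \<pi> p q rule: rev_induct)
  case Nil
  then show ?case using paths_Nil[of p q i] by auto
next
  case (snoc r w)
  have "ascending w" using snoc.prems by (simp add: ascending_snoc)
  from snoc.prems show ?case
    by (cases rule: paths_snoc_cases[OF _ _ _ _ refl refl refl])
      (use snoc.IH[OF \<open>ascending w\<close>] in \<open>auto simp: winding_Cons winding_snoc_word\<close>)
qed


section \<open>Path sums\<close>

text \<open>Initial faces are left out since their winding number is 0. Exponents are winding
  numbers instead of indicators of the enclosed region, which makes the weight multiplicative under
  concatenation.\<close>

definition path_weight :: "nat list \<Rightarrow> nat \<Rightarrow> (face \<Rightarrow> complex) \<Rightarrow> piece list \<Rightarrow> complex" where
  "path_weight w i X ps = (\<Prod>c<length w. X (After c) powi (- winding w i ps (Suc c) (w ! c)))"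

definition path_sum :: "nat list \<Rightarrow> nat \<Rightarrow> (face \<Rightarrow> complex) \<Rightarrow> nat \<Rightarrow> nat \<Rightarrow> complex" where
  "path_sum w i X p q = (\<Sum>ps\<in>paths w i p q. path_weight w i X ps)"

text \<open>The effect of the crossing of two lines \<open>A < B\<close> on path sums, with weights ignored.\<close>

definition cross_sum :: "nat \<Rightarrow> nat \<Rightarrow> nat \<Rightarrow> (nat \<Rightarrow> nat \<Rightarrow> complex) \<Rightarrow> nat \<Rightarrow> nat \<Rightarrow> complex" where
  "cross_sum i A B M p q =
    (if B \<le> i then if p = A then M B q else if p = B then M A q + M B q else M p q
     else if i < A then if q = A then M p A + M p B else if q = B then M p A else M p q
     else of_bool (p = A \<and> q = B) + M p q + M p B * M A q)"

lemma path_sum_Nil: "p \<noteq> q \<Longrightarrow> path_sum [] i X p q = 0"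
  by (simp add: path_sum_def paths_Nil)

lemma path_sum_upwards:
  "ascending w \<Longrightarrow> p \<le> i \<Longrightarrow> i < q \<Longrightarrow> end_height w p \<le> end_height w q \<Longrightarrow> path_sum w i X p q = 0"
  by (simp add: path_sum_def no_path_upwards)

lemma path_sum_cong:
  "(\<And>c. c < length w \<Longrightarrow> X (After c) = Y (After c)) \<Longrightarrow> path_sum w i X p q = path_sum w i Y p q"
  by (simp add: path_sum_def path_weight_def)

text \<open>The set of concatenations carries no condition \<open>p \<noteq> A\<close> or
  \<open>q \<noteq> B\<close>: in these cases one factor is the empty set of paths from
  \<open>A\<close> to \<open>B\<close>.\<close>

lemma paths_snoc_eq:
  assumes "ascending (w @ [r])" "p \<le> i" "i < q"
    and "A = word_perm w r" "B = word_perm w (Suc r)" "K = Suc (length w)"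
  shows "paths (w @ [r]) i p q = (if p = A \<and> q = B then {[(K, p), (K, q)]} else {}) \<union>
    (\<lambda>\<pi>. (K, p) # \<pi> @ [(K, q)]) `
      ((\<Union>p'\<in>{p'. p' \<le> i \<and> link i A B p p'}. \<Union>q'\<in>{q'. i < q' \<and> link i A B q' q}. paths w i p' q') \<union>
       (if A \<le> i \<and> i < B then (\<lambda>(\<pi>, \<pi>'). \<pi> @ \<pi>') ` (paths w i p B \<times> paths w i A q) else {}))"
    (is "?L = ?R")
proof -
  have asc: "ascending w" "A < B"
    using assms by (auto simp: ascending_snoc)
  note AB = \<open>A = _\<close> \<open>B = _\<close> and K = \<open>K = _\<close>
  have no_cycle: "paths w i A B = {}" if "A \<le> i" "i < B"
    using asc that AB by (intro no_path_upwards) auto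
  show ?thesis
  proof (intro equalityI subsetI)
    fix ps assume "ps \<in> ?L"
    from assms(1) this assms(2-) show "ps \<in> ?R"
    proof (cases rule: paths_snoc_cases)
      case turn
      then show ?thesis by simp
    next
      case (single p' q' \<pi>)
      then show ?thesis by blast
    next
      case (double \<pi> \<pi>')
      then have "\<pi> @ \<pi>' \<in> (\<lambda>(\<pi>, \<pi>'). \<pi> @ \<pi>') ` (paths w i p B \<times> paths w i A q)" by blast
      then show ?thesis using double by simp
    qed
  next
    fix ps assume "ps \<in> ?R"
    then consider "p = A" "q = B" "ps = [(K, p), (K, q)]"
      | p' q' \<pi> where "p' \<le> i" "i < q'" "link i A B p p'" "link i A B q' q" "\<pi> \<in> paths w i p' q'"
          "ps = (K, p) # \<pi> @ [(K, q)]"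
      | \<pi> \<pi>' where "A \<le> i" "i < B" "\<pi> \<in> paths w i p B" "\<pi>' \<in> paths w i A q"
          "ps = (K, p) # (\<pi> @ \<pi>') @ [(K, q)]"
      by (auto split: if_splits)
    then show "ps \<in> ?L"
    proof cases
      case 1
      then show ?thesis
        using paths_snoc_turn[OF asc(2)[unfolded AB], of i] assms unfolding AB K by simp
    next
      case 2
      then show ?thesis
        using paths_snoc_single[OF asc(2)[unfolded AB], of p' i q' p q \<pi>] assms unfolding AB K by simp
    next
      case 3
      then have "p \<noteq> A" "q \<noteq> B" using no_cycle by auto
      then show ?thesis
        using 3 paths_snoc_double[OF asc(2)[unfolded AB], of i p q \<pi> \<pi>'] assms unfolding AB K by simp
    qed
  qed
qed

lemma link_left:
  assumes "p \<le> i" "A < B"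
  shows "{p'. p' \<le> i \<and> link i A B p p'} =
    (if B \<le> i then if p = A then {B} else if p = B then {A, B} else {p} else {p})"
  using assms by (auto simp: link_def doubleton_eq_iff split: if_splits)

lemma link_right:
  assumes "i < q" "A < B"
  shows "{q'. i < q' \<and> link i A B q' q} =
    (if i < A then if q = A then {A, B} else if q = B then {A} else {q} else {q})"
  using assms by (auto simp: link_def doubleton_eq_iff split: if_splits)

lemma finite_paths:
  assumes "ascending w" "p \<le> i" "i < q"
  shows "finite (paths w i p q)"
  using assms
proof (induction w arbitrary: p q rule: rev_induct)
  case Nil
  then show ?case by (simp add: paths_Nil)
next
  case (snoc r w)
  have asc: "ascending w" "word_perm w r < word_perm w (Suc r)"
    using snoc.prems by (auto simp: ascending_snoc)
  let ?A = "word_perm w r" and ?B = "word_perm w (Suc r)"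
  have "finite {p'. p' \<le> i \<and> link i ?A ?B p p'}" "finite {q'. i < q' \<and> link i ?A ?B q' q}"
    using link_left[OF snoc.prems(2) asc(2)] link_right[OF snoc.prems(3) asc(2)] by auto
  then have "finite (\<Union>p'\<in>{p'. p' \<le> i \<and> link i ?A ?B p p'}.
      \<Union>q'\<in>{q'. i < q' \<and> link i ?A ?B q' q}. paths w i p' q')"
    using snoc.IH[OF asc(1)] by (intro finite_UN_I) auto
  then show ?case
    using snoc.IH[OF asc(1)] snoc.prems
    by (subst paths_snoc_eq[OF snoc.prems refl refl refl]) auto
qed

text \<open>A right-oriented piece in the last column ends every path of \<open>w\<close>. Hence the
  joint in a concatenation of two paths can be recognized, and such a concatenation is never itself
  a path of \<open>w\<close>.\<close>

lemma no_step_back: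
  assumes "successively (rigorous_step w i) (\<pi> @ \<rho>)" "\<pi> \<noteq> []" "\<rho> \<noteq> []" "last \<pi> = (length w, b)"
  shows "b \<le> i"
proof (rule ccontr)
  assume "\<not> b \<le> i"
  moreover have "rigorous_step w i (last \<pi>) (hd \<rho>)"
    using assms by (auto simp: successively_append_iff)
  ultimately show False
    using rigorous_step_columns(3)[of w i "last \<pi>" "hd \<rho>"] assms(4) by simp
qed

lemma inj_on_append_paths:
  assumes "i < b"
  shows "inj_on (\<lambda>(\<pi>, \<pi>'). \<pi> @ \<pi>') (paths w i p b \<times> paths w i a q)"
proof (rule inj_onI, clarify)
  fix \<pi> \<pi>' \<sigma> \<sigma>'
  assume p: "\<pi> \<in> paths w i p b" "\<sigma> \<in> paths w i p b" "\<pi>' \<in> paths w i a q" "\<sigma>' \<in> paths w i a q"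
    and eq: "\<pi> @ \<pi>' = \<sigma> @ \<sigma>'"
  from eq obtain \<rho> where \<rho>: "\<pi> = \<sigma> @ \<rho> \<and> \<rho> @ \<pi>' = \<sigma>' \<or> \<pi> @ \<rho> = \<sigma> \<and> \<pi>' = \<rho> @ \<sigma>'"
    unfolding append_eq_append_conv2 by blast
  have "\<rho> = []"
    using \<rho> p no_step_back[of w i \<sigma> \<rho> b] no_step_back[of w i \<pi> \<rho> b] assms by (fastforce simp: paths_def)
  then show "\<pi> = \<sigma> \<and> \<pi>' = \<sigma>'" using \<rho> by auto
qed

lemma path_weight_append:
  assumes "\<And>c. X (After c) \<noteq> 0"
  shows "path_weight w i X (ps @ qs) = path_weight w i X ps * path_weight w i X qs"
  using assms by (simp add: path_weight_def flip: prod.distrib power_int_add)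

lemma path_weight_wrap:
  assumes "ascending (w @ [r])" "ps \<in> paths (w @ [r]) i p q" "p \<le> i" "i < q"
    and ps: "ps = (Suc (length w), p) # \<pi> @ [(Suc (length w), q)]" and X: "X (After (length w)) \<noteq> 0"
  shows "path_weight (w @ [r]) i X ps =
    (if r < end_height (w @ [r]) p then inverse (X (After (length w))) else 1) *
    (if r < end_height (w @ [r]) q then X (After (length w)) else 1) * path_weight w i X \<pi>"
proof -
  have "winding (w @ [r]) i ps (Suc c) t = winding w i \<pi> (Suc c) t" if "c < length w" for c t
    using that unfolding ps by (simp add: winding_Cons winding_snoc_word)
  then have "path_weight (w @ [r]) i X ps =
      path_weight w i X \<pi> * X (After (length w)) powi (- winding (w @ [r]) i ps (Suc (length w)) r)"
    by (simp add: path_weight_def nth_append)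
  also have "winding (w @ [r]) i ps (Suc (length w)) r =
      of_bool (r < end_height (w @ [r]) p) - of_bool (r < end_height (w @ [r]) q)"
    by (rule winding_snoc_last[OF assms(1-4)])
  finally show ?thesis
    using path_descends[OF assms(1-4)] X by (auto simp: power_int_minus)
qed

text \<open>The two factors in front are the contribution of the face to the right of the new
  crossing, which only the end pieces see. \<open>cross_sum\<close> collects the direct turn, the
  single paths and the products of two paths.\<close>

lemma path_sum_snoc:
  assumes asc: "ascending (w @ [r])" and pq: "p \<le> i" "i < q" and X: "\<And>c. X (After c) \<noteq> 0"
  shows "path_sum (w @ [r]) i X p q =
    (if r < end_height (w @ [r]) p then inverse (X (After (length w))) else 1) *
    (if r < end_height (w @ [r]) q then X (After (length w)) else 1) *
    cross_sum i (word_perm w r) (word_perm w (Suc r)) (path_sum w i X) p q"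
proof -
  let ?wt = "path_weight w i X"
  let ?S = "path_sum w i X"
  define A where "A = word_perm w r"
  define B where "B = word_perm w (Suc r)"
  define K where "K = Suc (length w)"
  have asc': "ascending w" "A < B"
    using asc by (auto simp: ascending_snoc A_def B_def)
  have fin: "finite (paths w i p' q')" if "p' \<le> i" "i < q'" for p' q'
    using finite_paths asc' that by blast
  define f where "f = (if r < end_height (w @ [r]) p then inverse (X (After (length w))) else 1) *
    (if r < end_height (w @ [r]) q then X (After (length w)) else 1)"
  define wrap where "wrap = (\<lambda>\<pi>. (K, p) # \<pi> @ [(K, q)])"
  define S where "S = {p'. p' \<le> i \<and> link i A B p p'}"
  define T where "T = {q'. i < q' \<and> link i A B q' q}"
  \<comment> \<open>\<open>P1\<close>, \<open>P2\<close>, \<open>P3\<close> are the three kinds of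
    paths with their end pieces removed; the empty list stands for the direct turn at the new
    crossing.\<close>
  define P1 where "P1 = (if p = A \<and> q = B then {[]} else {} :: piece list set)"
  define P2 where "P2 = (\<Union>p'\<in>S. \<Union>q'\<in>T. paths w i p' q')"
  define P3 where "P3 = (if A \<le> i \<and> i < B then (\<lambda>(\<pi>, \<pi>'). \<pi> @ \<pi>') ` (paths w i p B \<times> paths w i A q) else {})"
  have S: "finite S" "\<And>p'. p' \<in> S \<Longrightarrow> p' \<le> i" and T: "finite T" "\<And>q'. q' \<in> T \<Longrightarrow> i < q'"
    using link_left[OF pq(1) asc'(2)] link_right[OF pq(2) asc'(2)] by (auto simp: S_def T_def)
  have eq: "paths (w @ [r]) i p q = wrap ` (P1 \<union> P2 \<union> P3)"
    unfolding paths_snoc_eq[OF asc pq A_def B_def K_def] P1_def P2_def P3_def S_def T_def wrap_def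
    by (simp add: image_Un Un_assoc)
  have inj: "inj wrap" by (auto simp: wrap_def inj_def)
  have fin1: "finite P1" by (simp add: P1_def)
  have fin2: "finite P2" using S T fin by (auto simp: P2_def)
  have fin3: "finite P3" using fin pq by (auto simp: P3_def)
  have dis12: "P1 \<inter> P2 = {}" by (auto simp: P1_def P2_def paths_def)
  have dis3: "(P1 \<union> P2) \<inter> P3 = {}"
  proof -
    have False if "\<pi> @ \<pi>' \<in> P1 \<union> P2" "\<pi> \<in> paths w i p B" "\<pi>' \<in> paths w i A q" "i < B" for \<pi> \<pi>'
    proof -
      have "\<pi> @ \<pi>' \<in> P2" using that by (auto simp: P1_def paths_def split: if_splits)
      then have "successively (rigorous_step w i) (\<pi> @ \<pi>')" by (auto simp: P2_def paths_def)
      then show False using no_step_back[of w i \<pi> \<pi>' B] that by (auto simp: paths_def)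
    qed
    then show ?thesis by (fastforce simp: P3_def split: if_splits)
  qed
  have "path_sum (w @ [r]) i X p q = (\<Sum>\<pi>\<in>P1 \<union> P2 \<union> P3. path_weight (w @ [r]) i X (wrap \<pi>))"
    unfolding path_sum_def eq using inj by (simp add: sum.reindex inj_on_subset[OF inj])
  also have "\<dots> = (\<Sum>\<pi>\<in>P1 \<union> P2 \<union> P3. f * ?wt \<pi>)"
  proof (rule sum.cong[OF refl])
    fix \<pi> assume "\<pi> \<in> P1 \<union> P2 \<union> P3"
    then have "wrap \<pi> \<in> paths (w @ [r]) i p q" unfolding eq by blast
    from path_weight_wrap[of w r _ i p q _ X, OF asc this pq] X show "path_weight (w @ [r]) i X (wrap \<pi>) = f * ?wt \<pi>"
      by (simp add: f_def wrap_def K_def)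
  qed
  also have "\<dots> = f * ((\<Sum>\<pi>\<in>P1. ?wt \<pi>) + (\<Sum>\<pi>\<in>P2. ?wt \<pi>) +
      (\<Sum>\<pi>\<in>P3. ?wt \<pi>))"
    using fin1 fin2 fin3 dis12 dis3 by (simp add: sum.union_disjoint flip: sum_distrib_left)
  also have "(\<Sum>\<pi>\<in>P1. ?wt \<pi>) = of_bool (p = A \<and> q = B)"
    by (simp add: P1_def path_weight_def)
  also have "(\<Sum>\<pi>\<in>P2. ?wt \<pi>) = (\<Sum>p'\<in>S. \<Sum>q'\<in>T. ?S p' q')"
  proof -
    have "(\<Sum>\<pi>\<in>P2. ?wt \<pi>) = (\<Sum>p'\<in>S. \<Sum>\<pi>\<in>(\<Union>q'\<in>T. paths w i p' q'). ?wt \<pi>)"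
      unfolding P2_def using S T fin by (intro sum.UNION_disjoint) (auto simp: paths_def)
    also have "\<dots> = (\<Sum>p'\<in>S. \<Sum>q'\<in>T. ?S p' q')"
      unfolding path_sum_def using S T fin
      by (intro sum.cong[OF refl] sum.UNION_disjoint) (auto simp: paths_def)
    finally show ?thesis .
  qed
  also have "(\<Sum>\<pi>\<in>P3. ?wt \<pi>) =
      (if A \<le> i \<and> i < B then ?S p B * ?S A q else 0)"
  proof (cases "A \<le> i \<and> i < B")
    case True
    then have "(\<Sum>\<pi>\<in>P3. ?wt \<pi>) =
        (\<Sum>(\<pi>, \<pi>')\<in>paths w i p B \<times> paths w i A q. ?wt (\<pi> @ \<pi>'))"
      unfolding P3_def using inj_on_append_paths[of i B w p A q]
      by (simp add: sum.reindex case_prod_unfold)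
    also have "\<dots> = ?S p B * ?S A q"
      unfolding path_sum_def sum_product
      by (simp add: path_weight_append[of X, OF X] sum.cartesian_product)
    finally show ?thesis using True by simp
  qed (auto simp: P3_def)
  also have "of_bool (p = A \<and> q = B) + (\<Sum>p'\<in>S. \<Sum>q'\<in>T. ?S p' q') +
      (if A \<le> i \<and> i < B then ?S p B * ?S A q else 0) =
      cross_sum i A B (?S) p q"
    unfolding S_def T_def link_left[OF pq(1) asc'(2)] link_right[OF pq(2) asc'(2)]
    using asc'(2) pq by (auto simp: cross_sum_def)
  finally show ?thesis unfolding f_def A_def B_def .
qed

text \<open>\<open>x\<close> is the coordinate of the face opened by the crossing, and
  \<open>up\<close> tells which lines run above it. The face is counted exactly if \<open>p\<close>
  ends above it and \<open>q\<close> does not; if both do, the factors cancel.\<close>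

definition cross_step ::
  "nat \<Rightarrow> nat \<Rightarrow> nat \<Rightarrow> complex \<Rightarrow> (nat \<Rightarrow> bool) \<Rightarrow> (nat \<Rightarrow> nat \<Rightarrow> complex) \<Rightarrow> nat \<Rightarrow> nat \<Rightarrow> complex" where
  "cross_step i A B x up M p q =
    (if up p then inverse x else 1) * (if up q then x else 1) * cross_sum i A B M p q"

lemma path_sum_snoc_step:
  assumes "ascending (w @ [r])" "p \<le> i" "i < q" "\<And>c. X (After c) \<noteq> 0"
  shows "path_sum (w @ [r]) i X p q = cross_step i (word_perm w r) (word_perm w (Suc r))
    (X (After (length w))) (\<lambda>a. r < end_height (w @ [r]) a) (path_sum w i X) p q"
  unfolding cross_step_def by (rule path_sum_snoc) (use assms in blast)+

lemma cross_step_cong: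
  assumes "A < B" "p \<le> i" "i < q" "\<And>p q. p \<le> i \<Longrightarrow> i < q \<Longrightarrow> M p q = M' p q"
  shows "cross_step i A B x up M p q = cross_step i A B x up M' p q"
proof -
  have "cross_sum i A B M p q = cross_sum i A B M' p q"
    unfolding cross_sum_def using assms(1-3) by (auto simp: assms(4))
  then show ?thesis by (simp only: cross_step_def)
qed

text \<open>The recursion sees the prefix only through its permutation, its length and its path
  sums. Invariance under a move thus has to be checked only for moves at the end of a word.\<close>

lemma path_sum_suffix:
  assumes "ascending (u @ v)" "ascending (u' @ v)" "length u = length u'" "word_perm u = word_perm u'"
    and "\<And>p q. p \<le> i \<Longrightarrow> i < q \<Longrightarrow> path_sum u i X p q = path_sum u' i Y p q"
    and "\<And>c. length u \<le> c \<Longrightarrow> X (After c) = Y (After c)"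
    and "\<And>c. X (After c) \<noteq> 0" "\<And>c. Y (After c) \<noteq> 0" "p \<le> i" "i < q"
  shows "path_sum (u @ v) i X p q = path_sum (u' @ v) i Y p q"
  using assms(1,2,9,10)
proof (induction v arbitrary: p q rule: rev_induct)
  case Nil
  then show ?case using assms(5) by simp
next
  case (snoc r v)
  have asc: "ascending ((u @ v) @ [r])" "ascending ((u' @ v) @ [r])" using snoc.prems by simp_all
  have perm: "word_perm (u @ v) = word_perm (u' @ v)" using assms(4) by (simp add: word_perm_append)
  have h: "end_height ((u @ v) @ [r]) = end_height ((u' @ v) @ [r])"
    by (intro ext) (simp add: end_height_def height_in_def word_perm_snoc perm del: append_assoc)
  have IH: "path_sum (u @ v) i X p q = path_sum (u' @ v) i Y p q" if "p \<le> i" "i < q" for p q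
    by (rule snoc.IH[OF _ _ that]) (use asc in \<open>simp_all only: ascending_snoc\<close>)
  have Xl: "X (After (length (u @ v))) = Y (After (length (u' @ v)))"
    using assms(3,6) by simp
  show ?case
    unfolding append_assoc[symmetric] path_sum_snoc_step[of "u @ v" r p i q X, OF asc(1) snoc.prems(3,4) assms(7)]
      path_sum_snoc_step[of "u' @ v" r p i q Y, OF asc(2) snoc.prems(3,4) assms(8)]
    unfolding h perm Xl
    using asc(2) by (intro cross_step_cong[OF _ snoc.prems(3,4) IH]) (simp_all only: ascending_snoc)
qed


text \<open>The face at level \<open>r\<close> still open at the right end of \<open>w\<close>. For
  a braid move directly after \<open>w\<close> these are the faces E_1 and E_4.\<close>

definition last_face :: "nat list \<Rightarrow> nat \<Rightarrow> face" where
  "last_face w r = (if \<exists>b<length w. w ! b = r then After (Max {b. b < length w \<and> w ! b = r}) else Initial r)"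

lemma last_face_Nil: "last_face [] r = Initial r"
  by (simp add: last_face_def)

lemma last_face_snoc: "last_face (w @ [s]) r = (if s = r then After (length w) else last_face w r)"
proof (cases "s = r")
  case True
  have "Max {b. b < length (w @ [s]) \<and> (w @ [s]) ! b = r} = length w"
    using True by (intro Max_eqI) (auto simp: nth_append)
  then show ?thesis using True by (auto simp: last_face_def intro!: exI[of _ "length w"])
next
  case False
  then have "b < length (w @ [s]) \<and> (w @ [s]) ! b = r \<longleftrightarrow> b < length w \<and> w ! b = r" for b
    by (auto simp: nth_append less_Suc_eq)
  then show ?thesis unfolding last_face_def using False by simp
qed

lemma last_face_cases: "last_face w r = Initial r \<or> (\<exists>c<length w. last_face w r = After c \<and> w ! c = r)"
proof (induction w rule: rev_induct)
  case (snoc s w)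
  then show ?case by (auto simp: last_face_snoc nth_append less_Suc_eq)
qed (simp add: last_face_Nil)

lemma last_face_inj: "last_face w r = last_face w s \<longleftrightarrow> r = s"
  using last_face_cases[of w r] last_face_cases[of w s] by (metis face.distinct(1) face.inject)

lemma face_before_eq: "face_before (u @ t # v) (length u) = last_face u t"
proof -
  have "b < length u \<and> (u @ t # v) ! b = (u @ t # v) ! length u \<longleftrightarrow> b < length u \<and> u ! b = t" for b
    by (auto simp: nth_append)
  then show ?thesis unfolding face_before_def last_face_def by simp
qed

text \<open>The last face at a level reaches the right end of the arrangement, so whether a path
  encloses it depends only on the final heights of \<open>p\<close> and \<open>q\<close>. The
  coordinate therefore enters the path sum as a common factor.\<close>

lemma path_sum_scale:
  assumes "ascending w" "p \<le> i" "i < q" "\<And>F. X F \<noteq> 0" "l \<noteq> 0"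
  shows "path_sum w i (X(last_face w r := l * X (last_face w r))) p q =
    (if r < end_height w p then inverse l else 1) * (if r < end_height w q then l else 1) * path_sum w i X p q"
  using assms(1-3)
proof (induction w arbitrary: p q rule: rev_induct)
  case Nil
  then show ?case by (simp add: path_sum_Nil)
next
  case (snoc s w)
  let ?F = "last_face (w @ [s]) r"
  let ?Y = "X(?F := l * X ?F)"
  have Y: "?Y F \<noteq> 0" for F using assms by simp
  have asc: "ascending w" "word_perm w s < word_perm w (Suc s)"
    using snoc.prems by (auto simp: ascending_snoc)
  show ?case
  proof (cases "s = r")
    case True
    then have F: "?F = After (length w)" by (simp add: last_face_snoc)
    have "path_sum w i ?Y = path_sum w i X"
      unfolding F by (intro ext path_sum_cong) simp
    then show ?thesis
      using assms(4,5) True F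
      unfolding path_sum_snoc_step[of w s p i q ?Y, OF snoc.prems Y]
        path_sum_snoc_step[of w s p i q X, OF snoc.prems assms(4)]
      by (simp add: cross_step_def)
  next
    case False
    then have F: "?F = last_face w r" by (simp add: last_face_snoc)
    have Yl: "?Y (After (length w)) = X (After (length w))"
      using last_face_cases[of w r] unfolding F by auto
    have h: "r < end_height (w @ [s]) x \<longleftrightarrow> r < end_height w x" for x
      using False by (auto simp: end_height_snoc transpose_def)
    have AB: "r < s \<longleftrightarrow> r < Suc s" using False by auto
    have IH: "path_sum w i ?Y p q =
      (if r < end_height w p then inverse l else 1) * (if r < end_height w q then l else 1) * path_sum w i X p q"
      if "p \<le> i" "i < q" for p q
      unfolding F using snoc.IH[OF asc(1)] that by blast
    \<comment> \<open>For \<open>s \<noteq> r\<close> the lines at heights \<open>s\<close> and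
      \<open>Suc s\<close> are on the same side of level \<open>r\<close>. The factors of the
      intermediate ends cancel in the product of two path sums, and the direct turn has factor
      1.\<close>
    have C: "cross_sum i (word_perm w s) (word_perm w (Suc s)) (path_sum w i ?Y) p q =
      (if r < end_height w p then inverse l else 1) * (if r < end_height w q then l else 1) *
      cross_sum i (word_perm w s) (word_perm w (Suc s)) (path_sum w i X) p q"
      using snoc.prems(2,3) asc(2) AB \<open>l \<noteq> 0\<close>
      by (auto simp: cross_sum_def IH algebra_simps)
    show ?thesis
      unfolding path_sum_snoc_step[of w s p i q ?Y, OF snoc.prems Y]
        path_sum_snoc_step[of w s p i q X, OF snoc.prems assms(4)] cross_step_def C Yl h
      by simp
  qed
qed

text \<open>The computation with three lines \<open>a < b < c\<close>. The old word crosses the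
  pairs ab, ac, bc in this order and the new word in the reverse order; \<open>hi\<close> marks the
  lines above all three. The relation between \<open>M\<close> and \<open>M'\<close> is the effect
  of rescaling E_1 and E_4, and the vanishing terms are paths going upwards. The abbreviation
  \<open>e\<close> keeps 1 + y1 opaque while denominators are cleared.\<close>

lemma braid_algebra:
  fixes y1 y2 y3 x1 x2 x3 e :: complex
  assumes ord: "a < b" "b < c" and hi: "\<not> hi a" "\<not> hi b" "\<not> hi c"
    and y: "y1 \<noteq> 0" "y2 \<noteq> 0" "y3 \<noteq> 0" "e \<noteq> 0" and e: "e = 1 + y1"
    and x: "x1 = inverse y1" "x2 = y3 * e" "x3 = y2 * y1 / e"
    and zero: "a \<le> i \<Longrightarrow> i < b \<Longrightarrow> M' a b = 0" "a \<le> i \<Longrightarrow> i < c \<Longrightarrow> M' a c = 0" "b \<le> i \<Longrightarrow> i < c \<Longrightarrow> M' b c = 0"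
    and M: "\<And>p q. p \<le> i \<Longrightarrow> i < q \<Longrightarrow> M p q =
      inverse (if p = b then e else if p = c \<or> hi p then y1 else 1) *
      (if q = b then e else if q = c \<or> hi q then y1 else 1) * M' p q"
    and pq: "p \<le> i" "i < q"
  shows "cross_step i b c x3 (\<lambda>p. p = a \<or> p = b \<or> hi p) (cross_step i a c x2 (\<lambda>p. p = a \<or> hi p)
      (cross_step i a b x1 (\<lambda>p. p = a \<or> p = c \<or> hi p) M)) p q =
    cross_step i a b y3 (\<lambda>p. p = a \<or> hi p) (cross_step i a c y2 (\<lambda>p. p = a \<or> p = b \<or> hi p)
      (cross_step i b c y1 (\<lambda>p. p = b \<or> hi p) M')) p q"
proof -
  note defs = cross_step_def cross_sum_def
  \<comment> \<open>The cases record how many of the three lines are oriented to the left.\<close>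
  consider "c \<le> i" | "b \<le> i" "i < c" | "a \<le> i" "i < b" | "i < a" by linarith
  then show ?thesis
  proof cases
    case 1
    then have q: "q \<noteq> a" "q \<noteq> b" "q \<noteq> c" using ord pq by auto
    consider "p = a" | "p = b" | "p = c" | "p \<noteq> a" "p \<noteq> b" "p \<noteq> c" by blast
    then show ?thesis
      using 1 q ord hi pq y
      by cases (cases "hi q"; cases "hi p"; simp add: defs M x divide_simps; simp add: e algebra_simps)+
  next
    case 2
    then have q: "q \<noteq> a" "q \<noteq> b" "p \<noteq> c" using ord pq by auto
    consider "p = a" | "p = b" | "p \<noteq> a" "p \<noteq> b" by blast
    then show ?thesis
      using 2 q ord hi pq y
      by cases (cases "q = c"; cases "hi q"; cases "hi p";
        simp add: defs M x zero divide_simps; simp add: e algebra_simps)+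
  next
    case 3
    then have q: "q \<noteq> a" "p \<noteq> b" "p \<noteq> c" using ord pq by auto
    consider "q = b" | "q = c" | "q \<noteq> b" "q \<noteq> c" by blast
    then show ?thesis
      using 3 q ord hi pq y
      by cases (cases "p = a"; cases "hi p"; cases "hi q";
        simp add: defs M x zero divide_simps; simp add: e algebra_simps)+
  next
    case 4
    then have q: "p \<noteq> a" "p \<noteq> b" "p \<noteq> c" using ord pq by auto
    consider "q = a" | "q = b" | "q = c" | "q \<noteq> a" "q \<noteq> b" "q \<noteq> c" by blast
    then show ?thesis
      using 4 q ord hi pq y
      by cases (cases "hi q"; cases "hi p"; simp add: defs M x divide_simps; simp add: e algebra_simps)+
  qed
qed


section \<open>Invariance under braid moves and commutations\<close>

lemma path_sum_two_steps:
  assumes asc: "ascending ((u @ [r]) @ [s])" and pq: "p \<le> i" "i < q" and X: "\<And>F. X F \<noteq> 0"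
  shows "path_sum ((u @ [r]) @ [s]) i X p q =
    cross_step i (word_perm (u @ [r]) s) (word_perm (u @ [r]) (Suc s)) (X (After (Suc (length u))))
      (\<lambda>a. s < end_height ((u @ [r]) @ [s]) a)
    (cross_step i (word_perm u r) (word_perm u (Suc r)) (X (After (length u)))
      (\<lambda>a. r < end_height (u @ [r]) a) (path_sum u i X)) p q" (is "_ = ?rhs")
proof -
  have asc': "ascending (u @ [r])" "word_perm (u @ [r]) s < word_perm (u @ [r]) (Suc s)"
    using asc unfolding ascending_snoc by blast+
  have "path_sum ((u @ [r]) @ [s]) i X p q =
      cross_step i (word_perm (u @ [r]) s) (word_perm (u @ [r]) (Suc s)) (X (After (Suc (length u))))
        (\<lambda>a. s < end_height ((u @ [r]) @ [s]) a) (path_sum (u @ [r]) i X) p q"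
    using path_sum_snoc_step[of "u @ [r]" s p i q X, OF asc pq X] by simp
  also have "\<dots> = ?rhs"
    by (rule cross_step_cong[OF asc'(2) pq path_sum_snoc_step[OF asc'(1) _ _ X]])
  finally show ?thesis .
qed

lemma path_sum_three_steps:
  assumes asc: "ascending (((u @ [r]) @ [s]) @ [t])" and pq: "p \<le> i" "i < q" and X: "\<And>F. X F \<noteq> 0"
  shows "path_sum (((u @ [r]) @ [s]) @ [t]) i X p q =
    cross_step i (word_perm ((u @ [r]) @ [s]) t) (word_perm ((u @ [r]) @ [s]) (Suc t))
      (X (After (Suc (Suc (length u))))) (\<lambda>a. t < end_height (((u @ [r]) @ [s]) @ [t]) a)
    (cross_step i (word_perm (u @ [r]) s) (word_perm (u @ [r]) (Suc s)) (X (After (Suc (length u))))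
      (\<lambda>a. s < end_height ((u @ [r]) @ [s]) a)
    (cross_step i (word_perm u r) (word_perm u (Suc r)) (X (After (length u)))
      (\<lambda>a. r < end_height (u @ [r]) a) (path_sum u i X))) p q"
proof -
  have asc': "ascending (u @ [r])" "word_perm (u @ [r]) s < word_perm (u @ [r]) (Suc s)"
    using asc unfolding ascending_snoc by blast+
  show ?thesis
    unfolding path_sum_two_steps[of "u @ [r]" s t p i q X, OF asc pq X] length_append_singleton
    using asc unfolding ascending_snoc
    by (intro cross_step_cong[OF _ pq] cross_step_cong[OF asc'(2)] path_sum_snoc_step[OF asc'(1) _ _ X]) auto
qed

text \<open>E_2 and E_3 are the faces opened by crossings of the move, so their coordinates enter
  through \<open>cross_step\<close>. E_1 and E_4 belong to \<open>u\<close>, and their change is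
  moved into the path sums of \<open>u\<close> by \<open>path_sum_scale\<close>.\<close>

lemma path_sum_braid_local:
  fixes u :: "nat list" and m i :: nat and X X' :: "face \<Rightarrow> complex"
  defines "j \<equiv> length u"
  defines "f \<equiv> X' (After j)"
  assumes asc: "ascending (u @ [m, Suc m, m])"
    and nz: "\<And>F. X F \<noteq> 0" "\<And>F. X' F \<noteq> 0" and f: "1 + f \<noteq> 0"
    and X: "X (After j) = inverse f" "X (After (j + 1)) = X' (After (j + 2)) * (1 + f)"
      "X (After (j + 2)) = X' (After (j + 1)) * inverse (1 + inverse f)"
      "X (last_face u m) = X' (last_face u m) * (1 + f)"
      "X (last_face u (Suc m)) = X' (last_face u (Suc m)) * inverse (1 + inverse f)"
      "\<And>c. c < j \<Longrightarrow> After c \<noteq> last_face u m \<Longrightarrow> After c \<noteq> last_face u (Suc m) \<Longrightarrow> X (After c) = X' (After c)"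
    and pq: "p \<le> i" "i < q"
  shows "path_sum (u @ [m, Suc m, m]) i X p q = path_sum (u @ [Suc m, m, Suc m]) i X' p q"
proof -
  define a where "a = word_perm u m"
  define b where "b = word_perm u (Suc m)"
  define c where "c = word_perm u (Suc (Suc m))"
  define hi where "hi = (\<lambda>p. Suc (Suc m) < end_height u p)"
  define M where "M = path_sum u i X"
  define M' where "M' = path_sum u i X'"
  have asc1: "ascending (u @ [m])" "ascending ((u @ [m]) @ [Suc m])" "ascending (((u @ [m]) @ [Suc m]) @ [m])"
    using asc by (auto simp: ascending_append)
  have ascu: "ascending u" using asc1 by (simp add: ascending_snoc)
  have "ascending (u @ [Suc m, m, Suc m])"
    using move_invariants(4)[OF move.braid[of "Suc m" m u "[]"]] asc by simp
  then have asc2: "ascending (u @ [Suc m])" "ascending ((u @ [Suc m]) @ [m])"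
    "ascending (((u @ [Suc m]) @ [m]) @ [Suc m])"
    by (auto simp: ascending_append)
  have E: "end_height u x = m \<longleftrightarrow> x = a" "end_height u x = Suc m \<longleftrightarrow> x = b"
    "end_height u x = Suc (Suc m) \<longleftrightarrow> x = c" for x
    by (auto simp: end_height_iff a_def b_def c_def)
  have dist: "a \<noteq> b" "a \<noteq> c" "b \<noteq> c" by (auto simp: a_def b_def c_def)
  have ord: "a < b" "b < c"
    using asc1 asc2 by (auto simp: ascending_snoc word_perm_snoc a_def b_def c_def transpose_def)
  have nhi: "\<not> hi a" "\<not> hi b" "\<not> hi c"
    using E[of a] E[of b] E[of c] dist by (auto simp: hi_def)
  have E3: "end_height u a = m" "end_height u b = Suc m" "end_height u c = Suc (Suc m)"
    by (auto simp: E)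
  have up1: "(\<lambda>x. m < end_height (u @ [m]) x) = (\<lambda>p. p = a \<or> p = c \<or> hi p)"
    and up2: "(\<lambda>x. Suc m < end_height ((u @ [m]) @ [Suc m]) x) = (\<lambda>p. p = a \<or> hi p)"
    and up3: "(\<lambda>x. m < end_height (((u @ [m]) @ [Suc m]) @ [m]) x) = (\<lambda>p. p = a \<or> p = b \<or> hi p)"
    and up1': "(\<lambda>x. Suc m < end_height (u @ [Suc m]) x) = (\<lambda>p. p = b \<or> hi p)"
    and up2': "(\<lambda>x. m < end_height ((u @ [Suc m]) @ [m]) x) = (\<lambda>p. p = a \<or> p = b \<or> hi p)"
    and up3': "(\<lambda>x. Suc m < end_height (((u @ [Suc m]) @ [m]) @ [Suc m]) x) = (\<lambda>p. p = a \<or> hi p)"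
    unfolding end_height_snoc
    by (intro ext; unfold hi_def E[symmetric] transpose_def; auto)+
  have ps: "path_sum (((u @ [m]) @ [Suc m]) @ [m]) i X p q =
      cross_step i b c (X (After (j + 2))) (\<lambda>p. p = a \<or> p = b \<or> hi p)
      (cross_step i a c (X (After (j + 1))) (\<lambda>p. p = a \<or> hi p)
        (cross_step i a b (X (After j)) (\<lambda>p. p = a \<or> p = c \<or> hi p) M)) p q"
    using path_sum_three_steps[of u m "Suc m" m p i q X, OF asc1(3) pq nz(1)] unfolding up1 up2 up3
    by (simp add: word_perm_append word_perm_Cons a_def b_def c_def j_def M_def)
  have ps': "path_sum (((u @ [Suc m]) @ [m]) @ [Suc m]) i X' p q =
      cross_step i a b (X' (After (j + 2))) (\<lambda>p. p = a \<or> hi p)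
      (cross_step i a c (X' (After (j + 1))) (\<lambda>p. p = a \<or> p = b \<or> hi p)
        (cross_step i b c (X' (After j)) (\<lambda>p. p = b \<or> hi p) M')) p q"
    using path_sum_three_steps[of u "Suc m" m "Suc m" p i q X', OF asc2(3) pq nz(2)] unfolding up1' up2' up3'
    by (simp add: word_perm_append word_perm_Cons a_def b_def c_def j_def M'_def)
  define E1 where "E1 = last_face u m"
  define E4 where "E4 = last_face u (Suc m)"
  define l where "l = inverse (1 + inverse f)"
  \<comment> \<open>On the faces of \<open>u\<close>, \<open>X\<close> and \<open>X'\<close> differ
    only at E_1 and E_4; \<open>Y\<close> is the intermediate point with E_1 alone rescaled.\<close>
  define Y where "Y = X'(E1 := (1 + f) * X' E1)"
  have "f \<noteq> 0" unfolding f_def by (rule nz)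
  then have l: "l = f / (1 + f)" using f by (simp add: l_def field_simps)
  then have "l \<noteq> 0" using f \<open>f \<noteq> 0\<close> by simp
  have Y: "Y F \<noteq> 0" for F using nz f by (simp add: Y_def)
  have "E1 \<noteq> E4" by (simp add: E1_def E4_def last_face_inj)
  have "M = path_sum u i (Y(E4 := l * Y E4))"
    unfolding M_def
  proof (intro ext path_sum_cong)
    fix c assume "c < length u"
    then show "X (After c) = (Y(E4 := l * Y E4)) (After c)"
      using X(4,5,6)[folded E1_def E4_def l_def] \<open>E1 \<noteq> E4\<close> by (auto simp: Y_def j_def)
  qed
  then have M: "M p q = (if Suc m < end_height u p then inverse l else 1) * (if Suc m < end_height u q then l else 1) *
      ((if m < end_height u p then inverse (1 + f) else 1) * (if m < end_height u q then 1 + f else 1) * M' p q)"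
    if "p \<le> i" "i < q" for p q
    using path_sum_scale[of u p i q Y l "Suc m", OF ascu that Y \<open>l \<noteq> 0\<close>, folded E4_def]
      path_sum_scale[of u p i q X' "1 + f" m, OF ascu that nz(2) f, folded E1_def, folded Y_def]
    by (simp add: M'_def)
  have up: "m < end_height u x \<longleftrightarrow> x = b \<or> x = c \<or> hi x" "Suc m < end_height u x \<longleftrightarrow> x = c \<or> hi x" for x
    unfolding hi_def E[symmetric] by auto
  \<comment> \<open>Among the ends, \<open>b\<close> lies above E_1 only and gets the factor 1 + f,
    while \<open>c\<close> and all higher lines lie above both faces and get (1 + f) * (f / (1 + f))
    = f.\<close>
  have M2: "M p q = inverse (if p = b then 1 + f else if p = c \<or> hi p then f else 1) *
      (if q = b then 1 + f else if q = c \<or> hi q then f else 1) * M' p q" if "p \<le> i" "i < q" for p q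
    unfolding M[OF that] up l using f \<open>f \<noteq> 0\<close> dist nhi
    by (cases "p = b"; cases "p = c \<or> hi p"; cases "q = b"; cases "q = c \<or> hi q")
      (auto simp: divide_simps)
  have zero: "M' x y = 0" if "x \<le> i" "i < y" "end_height u x \<le> end_height u y" for x y
    unfolding M'_def by (rule path_sum_upwards[OF ascu that])
  have "cross_step i b c (X (After (j + 2))) (\<lambda>p. p = a \<or> p = b \<or> hi p)
      (cross_step i a c (X (After (j + 1))) (\<lambda>p. p = a \<or> hi p)
        (cross_step i a b (X (After j)) (\<lambda>p. p = a \<or> p = c \<or> hi p) M)) p q =
      cross_step i a b (X' (After (j + 2))) (\<lambda>p. p = a \<or> hi p)
      (cross_step i a c (X' (After (j + 1))) (\<lambda>p. p = a \<or> p = b \<or> hi p)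
        (cross_step i b c (X' (After j)) (\<lambda>p. p = b \<or> hi p) M')) p q"
  proof (rule braid_algebra[where e = "1 + f", OF ord nhi])
    show "X (After (j + 2)) = X' (After (j + 1)) * X' (After j) / (1 + f)"
      unfolding X(3)[folded l_def] l f_def by simp
    show "M p q = inverse (if p = b then 1 + f else if p = c \<or> hi p then X' (After j) else 1) *
      (if q = b then 1 + f else if q = c \<or> hi q then X' (After j) else 1) * M' p q" if "p \<le> i" "i < q" for p q
      using M2[OF that] unfolding f_def .
  qed (use nz X f pq zero E3 in \<open>auto simp: f_def\<close>)
  then show ?thesis
    using ps ps' by simp
qed


text \<open>The mutation as a relation between old and new points, expressed by faces of the prefix
  \<open>u\<close> and thus independent of the suffix. In this form it is visibly of the same shape
  in both directions.\<close>

definition braid_related ::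
  "nat list \<Rightarrow> nat \<Rightarrow> nat \<Rightarrow> (face \<Rightarrow> complex) \<Rightarrow> (face \<Rightarrow> complex) \<Rightarrow> bool" where
  "braid_related u r t X X' \<longleftrightarrow>
    (let j = length u; f = X' (After j) in
     X (After j) = inverse f \<and>
     X (last_face u r) = X' (last_face u r) * (1 + f) \<and>
     X (After (j + 1)) = X' (After (j + 2)) * (1 + f) \<and>
     X (After (j + 2)) = X' (After (j + 1)) * inverse (1 + inverse f) \<and>
     X (last_face u t) = X' (last_face u t) * inverse (1 + inverse f) \<and>
     (\<forall>F. F \<notin> {After j, After (j + 1), After (j + 2), last_face u r, last_face u t} \<longrightarrow> X F = X' F))"

lemma last_face_neq_After: "last_face u r \<noteq> After (length u + k)"
  using last_face_cases[of u r] by auto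

lemma braid_related_elsewhere:
  assumes "braid_related u r t X X'" "F \<notin> After ` {length u, length u + 1, length u + 2}"
    "F \<noteq> last_face u r" "F \<noteq> last_face u t"
  shows "X F = X' F"
  using assms unfolding braid_related_def Let_def by auto

lemma braid_related_After:
  assumes "braid_related u r t X X'" "length u + 3 \<le> c"
  shows "X (After c) = X' (After c)"
  using last_face_cases[of u r] last_face_cases[of u t] assms(2)
  by (intro braid_related_elsewhere[OF assms(1)]) auto

lemma braid_related_braid_coords:
  assumes "r \<noteq> t"
  shows "braid_related u r t (braid_coords (u @ [r, t, r] @ v) (u @ [t, r, t] @ v) (length u) X') X'"
proof -
  have b: "face_before (u @ [a, b, a] @ v) (length u) = last_face u a"
    "face_before (u @ [a, b, a] @ v) (length u + 1) = last_face u b" if "a \<noteq> b" for a b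
    using face_before_eq[of u a "[b, a] @ v"] face_before_eq[of "u @ [a]" b "[a] @ v"] that
    by (simp_all add: last_face_snoc)
  have "last_face u r \<noteq> last_face u t" using assms by (simp add: last_face_inj)
  then show ?thesis
    unfolding braid_related_def braid_coords_def Let_def b[OF assms] b[OF assms[symmetric]]
    using last_face_neq_After[of u r 0] last_face_neq_After[of u r 1] last_face_neq_After[of u r 2]
      last_face_neq_After[of u t 0] last_face_neq_After[of u t 1] last_face_neq_After[of u t 2]
    by (simp add: eq_commute)
qed

text \<open>The inverse mutation is again a mutation, with f replaced by its inverse and the roles
  of the levels exchanged. A computation for \<open>t = Suc r\<close> therefore covers
  \<open>r = Suc t\<close> as well.\<close>

lemma braid_related_sym:
  assumes "braid_related u r t X X'" "X' (After (length u)) \<noteq> 0" "1 + X' (After (length u)) \<noteq> 0"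
  shows "braid_related u t r X' X"
proof -
  let ?f = "X' (After (length u))"
  have f: "inverse (1 + inverse ?f) = ?f / (1 + ?f)" using assms(2,3) by (simp add: field_simps)
  have X: "X (After (length u)) = inverse ?f"
    using assms(1) by (simp add: braid_related_def Let_def)
  have f': "1 + X (After (length u)) = (1 + ?f) / ?f" "inverse (1 + inverse (X (After (length u)))) = inverse (1 + ?f)"
    using assms(2) unfolding X by (simp_all add: field_simps)
  show ?thesis
    using assms unfolding braid_related_def Let_def f f' by (simp add: insert_commute)
qed

lemma braid_related_nonzero:
  assumes "braid_related u r t X X'" "\<And>F. X' F \<noteq> 0" "1 + X' (After (length u)) \<noteq> 0"
  shows "X F \<noteq> 0" "1 + X (After (length u)) \<noteq> 0"
proof -
  let ?f = "X' (After (length u))"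
  have *: "1 + inverse ?f = (1 + ?f) / ?f" using assms(2) by (simp add: field_simps)
  then show "1 + X (After (length u)) \<noteq> 0"
    using assms unfolding braid_related_def Let_def by simp
  have "inverse (1 + inverse ?f) \<noteq> 0" using assms(2,3) unfolding * by simp
  then show "X F \<noteq> 0"
    using assms unfolding braid_related_def Let_def
    by (cases "F \<in> {After (length u), After (length u + 1), After (length u + 2), last_face u r, last_face u t}")
      auto
qed

lemma path_sum_braid:
  assumes asc: "ascending (u @ [r, t, r] @ v)" and rt: "t = Suc r \<or> r = Suc t"
    and rel: "braid_related u r t X X'" and nz: "\<And>F. X' F \<noteq> 0" "1 + X' (After (length u)) \<noteq> 0"
    and pq: "p \<le> i" "i < q"
  shows "path_sum (u @ [r, t, r] @ v) i X p q = path_sum (u @ [t, r, t] @ v) i X' p q"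
proof -
  let ?u = "u @ [r, t, r]"
  let ?u' = "u @ [t, r, t]"
  have asc': "ascending (u @ [t, r, t] @ v)"
    using move_invariants(4)[OF move.braid[OF rt]] asc .
  have perm: "word_perm ?u = word_perm ?u'"
    using move_invariants(1)[OF move.braid[OF rt, of u "[]"]] by simp
  have X: "\<And>F. X F \<noteq> 0" "1 + X (After (length u)) \<noteq> 0"
    using braid_related_nonzero[OF rel nz] by blast+
  have a: "ascending ?u" "ascending ?u'"
    using asc asc' by (simp_all add: ascending_append)
  have local: "path_sum (u @ [m, Suc m, m]) i X p q = path_sum (u @ [Suc m, m, Suc m]) i X' p q"
    if "braid_related u m (Suc m) X X'" "\<And>F. X F \<noteq> 0" "\<And>F. X' F \<noteq> 0" "1 + X' (After (length u)) \<noteq> 0"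
      "ascending (u @ [m, Suc m, m])" "p \<le> i" "i < q" for m X X' p q
    using that(1) unfolding braid_related_def Let_def
    by (intro path_sum_braid_local that) auto
  have "path_sum ?u i X p q = path_sum ?u' i X' p q" if "p \<le> i" "i < q" for p q
  proof (cases "t = Suc r")
    case True
    then show ?thesis using local[of r X X' p q] rel X nz a that by simp
  next
    case False
    then have r: "r = Suc t" using rt by simp
    show ?thesis
      using local[of t X' X p q] braid_related_sym[OF rel nz(1,2)] X nz a that unfolding r by simp
  qed
  moreover have "X (After c) = X' (After c)" if "length ?u \<le> c" for c
    using braid_related_After[OF rel] that by simp
  ultimately have "path_sum (?u @ v) i X p q = path_sum (?u' @ v) i X' p q"
    using asc asc' perm X nz pq
    by (intro path_sum_suffix) simp_all
  then show ?thesis by simp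
qed


text \<open>The monomial of k = n_i. It joins \<open>level_sum\<close> only when a further crossing
  at level \<open>i\<close> is appended.\<close>

definition level_prod :: "nat list \<Rightarrow> nat \<Rightarrow> (face \<Rightarrow> complex) \<Rightarrow> complex" where
  "level_prod w i X = inverse (X (Initial i)) * (\<Prod>c\<in>set (level_crossings w i). inverse (X (After c)))"

text \<open>The term of \<open>k = n\<^sub>i\<close> is missing: it does not occur in \<open>W\<close>, and only because of this the sum is
  invariant under mutations.\<close>

definition level_sum :: "nat list \<Rightarrow> nat \<Rightarrow> (face \<Rightarrow> complex) \<Rightarrow> complex" where
  "level_sum w i X = (\<Sum>k<length (level_crossings w i).
     inverse (X (Initial i)) * (\<Prod>c\<in>set (take k (level_crossings w i)). inverse (X (After c))))"

lemma level_crossings_Nil: "level_crossings [] i = []"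
  by (simp add: level_crossings_def)

lemma level_crossings_snoc:
  "level_crossings (w @ [r]) i = level_crossings w i @ (if r = i then [length w] else [])"
proof -
  have "filter (\<lambda>c. (w @ [r]) ! c = i) [0..<length w] = filter (\<lambda>c. w ! c = i) [0..<length w]"
    by (intro filter_cong) (auto simp: nth_append)
  then show ?thesis by (simp add: level_crossings_def)
qed

lemma set_level_crossings: "set (level_crossings w i) = {c. c < length w \<and> w ! c = i}"
  by (auto simp: level_crossings_def)

lemma level_prod_snoc:
  "level_prod (w @ [r]) i X = level_prod w i X * (if r = i then inverse (X (After (length w))) else 1)"
  by (simp add: level_prod_def level_crossings_snoc set_level_crossings)

lemma level_sum_snoc:
  "level_sum (w @ [r]) i X = level_sum w i X + (if r = i then level_prod w i X else 0)"
  by (simp add: level_sum_def level_prod_def level_crossings_snoc)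

lemma level_sum_Nil: "level_sum [] i X = 0"
  and level_prod_Nil: "level_prod [] i X = inverse (X (Initial i))"
  by (simp_all add: level_sum_def level_prod_def level_crossings_Nil)

lemma level_cong:
  assumes "X (Initial i) = Y (Initial i)" "\<And>c. c < length w \<Longrightarrow> w ! c = i \<Longrightarrow> X (After c) = Y (After c)"
  shows "level_prod w i X = level_prod w i Y" "level_sum w i X = level_sum w i Y"
proof -
  show "level_prod w i X = level_prod w i Y"
    using assms by (simp add: level_prod_def set_level_crossings)
  have "X (After c) = Y (After c)" if "c \<in> set (take k (level_crossings w i))" for k c
    using assms(2) set_take_subset[of k "level_crossings w i"] that unfolding set_level_crossings by blast
  then show "level_sum w i X = level_sum w i Y"
    using assms(1) by (simp add: level_sum_def)
qed

text \<open>The last face at level \<open>i\<close> occurs only in the monomial of k = n_i, which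
  \<open>level_sum\<close> omits. So the change of E_1 or E_4 in a braid move leaves the level sum
  of the prefix alone and appears only in \<open>level_prod\<close>.\<close>

lemma level_cong_last_face:
  assumes "\<And>F. F \<noteq> last_face w i \<Longrightarrow> F = Initial i \<or> (\<exists>c<length w. w ! c = i \<and> F = After c) \<Longrightarrow> X F = Y F"
    and "X (last_face w i) = Y (last_face w i) * l"
  shows "level_prod w i X = level_prod w i Y * inverse l" "level_sum w i X = level_sum w i Y"
proof -
  have "level_prod w i X = level_prod w i Y * inverse l \<and> level_sum w i X = level_sum w i Y"
    using assms
  proof (induction w rule: rev_induct)
    case Nil
    then show ?case by (simp add: level_prod_Nil level_sum_Nil last_face_Nil)
  next
    case (snoc r w)
    show ?case
    proof (cases "r = i")
      case True
      have "level_prod w i X = level_prod w i Y" "level_sum w i X = level_sum w i Y"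
        using snoc.prems(1) True by (auto intro!: level_cong simp: last_face_snoc nth_append less_Suc_eq)
      then show ?thesis
        using snoc.prems(2) True by (simp add: level_prod_snoc level_sum_snoc last_face_snoc)
    next
      case False
      have "level_prod w i X = level_prod w i Y * inverse l \<and> level_sum w i X = level_sum w i Y"
        using snoc.prems False
        by (intro snoc.IH) (auto simp: last_face_snoc nth_append less_Suc_eq)
      then show ?thesis using False by (simp add: level_prod_snoc level_sum_snoc)
    qed
  qed
  then show "level_prod w i X = level_prod w i Y * inverse l" "level_sum w i X = level_sum w i Y" by auto
qed

lemma level_suffix:
  assumes "length u = length u'" "\<And>c. length u \<le> c \<Longrightarrow> X (After c) = Y (After c)"
    and "level_prod u i X = level_prod u' i Y" "level_sum u i X = level_sum u' i Y"
  shows "level_prod (u @ v) i X = level_prod (u' @ v) i Y \<and> level_sum (u @ v) i X = level_sum (u' @ v) i Y"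
proof (induction v rule: rev_induct)
  case (snoc r v)
  then show ?case
    using assms(1,2) level_prod_snoc[of "u @ v" r i X] level_prod_snoc[of "u' @ v" r i Y]
      level_sum_snoc[of "u @ v" r i X] level_sum_snoc[of "u' @ v" r i Y]
    by simp
qed (use assms in simp)

lemma level_sum_braid:
  assumes rt: "r \<noteq> t"
    and rel: "braid_related u r t X X'" and nz: "\<And>F. X' F \<noteq> 0" "1 + X' (After (length u)) \<noteq> 0"
  shows "level_sum (u @ [r, t, r] @ v) i X = level_sum (u @ [t, r, t] @ v) i X'"
proof -
  have local: "level_prod (u @ [r, t, r]) r X = level_prod (u @ [t, r, t]) r X' \<and>
      level_sum (u @ [r, t, r]) r X = level_sum (u @ [t, r, t]) r X'"
    if rel: "braid_related u r t X X'" and nz: "\<And>F. X' F \<noteq> 0" "1 + X' (After (length u)) \<noteq> 0" "r \<noteq> t" for r t X X'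
  proof -
    let ?f = "X' (After (length u))"
    have f: "inverse (1 + inverse ?f) = ?f / (1 + ?f)" using nz by (simp add: field_simps)
    have X: "X (After (length u)) = inverse ?f" "X (last_face u r) = X' (last_face u r) * (1 + ?f)"
      "X (After (Suc (Suc (length u)))) = X' (After (Suc (length u))) * (?f / (1 + ?f))"
      and X0: "\<And>F. F \<notin> {After (length u), After (length u + 1), After (length u + 2), last_face u r, last_face u t}
        \<Longrightarrow> X F = X' F"
      using rel unfolding braid_related_def Let_def f by auto
    have "X F = X' F" if "F \<noteq> last_face u r" "F = Initial r \<or> (\<exists>c<length u. u ! c = r \<and> F = After c)" for F
      using that last_face_cases[of u t] nz(3) by (intro X0) auto
    note L = level_cong_last_face[of u r X X' "1 + ?f", OF this X(2)]
    have W: "level_prod (u @ [a, b, c]) r Z = level_prod (((u @ [a]) @ [b]) @ [c]) r Z"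
      "level_sum (u @ [a, b, c]) r Z = level_sum (((u @ [a]) @ [b]) @ [c]) r Z" for a b c Z
      by simp_all
    \<comment> \<open>With P = \<open>level_prod u r X'\<close>, the two terms contributed by the
      old crossings at level \<open>r\<close> are P / (1 + f) and P * f / (1 + f); they add up to P,
      the single term of the new word.\<close>
    show ?thesis
      unfolding W level_prod_snoc level_sum_snoc using nz by (simp add: L X(1,3) divide_simps) (simp add: algebra_simps)
  qed
  have "level_prod (u @ [r, t, r]) i X = level_prod (u @ [t, r, t]) i X' \<and>
      level_sum (u @ [r, t, r]) i X = level_sum (u @ [t, r, t]) i X'"
  proof -
    consider "i = r" | "i = t" | "i \<noteq> r" "i \<noteq> t" by blast
    then show ?thesis
    proof cases
      case 1
      then show ?thesis using local[OF rel nz rt] by simp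
    next
      case 2
      then show ?thesis
        using local[OF braid_related_sym[OF rel nz] braid_related_nonzero[OF rel nz] rt[symmetric]] by simp
    next
      case 3
      have "X F = X' F" if "F = Initial i \<or> (\<exists>c<length u. u ! c = i \<and> F = After c)" for F
        using that 3 last_face_cases[of u r] last_face_cases[of u t]
        by (intro braid_related_elsewhere[OF rel]) auto
      then have "level_prod u i X = level_prod u i X'" "level_sum u i X = level_sum u i X'"
        by (auto intro!: level_cong)
      moreover have W: "level_prod (u @ [a, b, c]) i Z = level_prod (((u @ [a]) @ [b]) @ [c]) i Z"
        "level_sum (u @ [a, b, c]) i Z = level_sum (((u @ [a]) @ [b]) @ [c]) i Z" for a b c Z
        by simp_all
      ultimately show ?thesis
        unfolding W level_prod_snoc level_sum_snoc using 3 by simp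
    qed
  qed
  moreover have "X (After c) = X' (After c)" if "length (u @ [r, t, r]) \<le> c" for c
    using braid_related_After[OF rel] that by simp
  ultimately show ?thesis
    using level_suffix[of "u @ [r, t, r]" "u @ [t, r, t]" X X' i v] by simp
qed

section \<open>Path sums and level sums under commutations\<close>

lemma cross_sum_scale:
  assumes "up A = up B" "x \<noteq> 0" "A < B"
  shows "cross_sum i A B (\<lambda>p q. (if up p then inverse x else 1) * (if up q then x else 1) * M p q) p q =
    (if up p then inverse x else 1) * (if up q then x else 1) * cross_sum i A B M p q"
  using assms by (auto simp: cross_sum_def field_simps)

text \<open>The critical case is that both pairs have opposite orientations. The two expansions then
  share the term of three paths p to d, c to b, a to q, and they differ only in terms containing the
  vanishing factor \<open>M a d\<close>.\<close>

lemma cross_sum_commute: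
  assumes ord: "a < b" "c < d" and disj: "{a, b} \<inter> {c, d} = {}"
    and zero: "\<And>x y. x \<in> {a, b} \<Longrightarrow> y \<in> {c, d} \<Longrightarrow> x \<le> i \<Longrightarrow> i < y \<Longrightarrow> M x y = 0"
    and pq: "p \<le> i" "i < q"
  shows "cross_sum i c d (cross_sum i a b M) p q = cross_sum i a b (cross_sum i c d M) p q"
proof -
  have d: "a \<noteq> c" "a \<noteq> d" "b \<noteq> c" "b \<noteq> d" "a \<noteq> b" "c \<noteq> d" using ord disj by auto
  have z: "a \<le> i \<Longrightarrow> i < c \<Longrightarrow> M a c = 0" "a \<le> i \<Longrightarrow> i < d \<Longrightarrow> M a d = 0"
    "b \<le> i \<Longrightarrow> i < c \<Longrightarrow> M b c = 0" "b \<le> i \<Longrightarrow> i < d \<Longrightarrow> M b d = 0"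
    using zero by auto
  consider "b \<le> i" | "a \<le> i" "i < b" | "i < a" by linarith
  then show ?thesis
  proof cases
    case 1
    have q: "q \<noteq> a" "q \<noteq> b" using 1 ord pq by auto
    consider "d \<le> i" | "c \<le> i" "i < d" | "i < c" by linarith
    then show ?thesis
      using 1 ord pq d z by cases (auto simp: cross_sum_def algebra_simps)
  next
    case 2
    consider "d \<le> i" | "c \<le> i" "i < d" | "i < c" by linarith
    then show ?thesis
      using 2 ord pq d z by cases (auto simp: cross_sum_def algebra_simps)
  next
    case 3
    consider "d \<le> i" | "c \<le> i" "i < d" | "i < c" by linarith
    then show ?thesis
      using 3 ord pq d z by cases (auto simp: cross_sum_def algebra_simps)
  qed
qed

lemma path_sum_commute_local:
  fixes u :: "nat list" and X X' :: "face \<Rightarrow> complex"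
  assumes asc: "ascending (u @ [r, t])" and rt: "Suc r < t"
    and nz: "\<And>F. X F \<noteq> 0" "\<And>F. X' F \<noteq> 0"
    and X: "X (After (length u)) = X' (After (Suc (length u)))" "X (After (Suc (length u))) = X' (After (length u))"
      "\<And>c. c < length u \<Longrightarrow> X (After c) = X' (After c)"
    and pq: "p \<le> i" "i < q"
  shows "path_sum (u @ [r, t]) i X p q = path_sum (u @ [t, r]) i X' p q"
proof -
  define a where "a = word_perm u r"
  define b where "b = word_perm u (Suc r)"
  define c where "c = word_perm u t"
  define d where "d = word_perm u (Suc t)"
  define M where "M = path_sum u i X"
  define x where "x = X (After (length u))"
  define y where "y = X (After (Suc (length u)))"
  define upx where "upx = (\<lambda>p. r < end_height (u @ [r]) p)"
  define upy where "upy = (\<lambda>p. t < end_height (u @ [t]) p)"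
  have asc1: "ascending (u @ [r])" "ascending ((u @ [r]) @ [t])"
    using asc by (auto simp: ascending_append)
  have ascu: "ascending u" using asc1 by (simp add: ascending_snoc)
  have "ascending (u @ [t, r])"
    using move_invariants(4)[OF move.commute[of r t u "[]"]] asc rt by simp
  then have asc2: "ascending (u @ [t])" "ascending ((u @ [t]) @ [r])"
    by (auto simp: ascending_append)
  have ord: "a < b" "c < d"
    using asc1 asc2 by (auto simp: ascending_snoc a_def b_def c_def d_def)
  have disj: "{a, b} \<inter> {c, d} = {}" using rt by (auto simp: a_def b_def c_def d_def)
  have E3: "end_height u a = r" "end_height u b = Suc r" "end_height u c = t" "end_height u d = Suc t"
    by (auto simp: a_def b_def c_def d_def)
  have M': "M = path_sum u i X'" unfolding M_def using X(3) by (intro ext path_sum_cong) auto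
  have upy': "(\<lambda>p. t < end_height ((u @ [r]) @ [t]) p) = upy"
    and upx': "(\<lambda>p. r < end_height ((u @ [t]) @ [r]) p) = upx"
    unfolding upx_def upy_def end_height_snoc using rt by (intro ext; auto simp: transpose_def)+
  \<comment> \<open>The lines of each crossing run on the same side of the face opened by the other
    one, so its weight can be pulled out of \<open>cross_sum\<close>.\<close>
  have up: "upx c = upx d" "upy a = upy b"
    using rt by (auto simp: upx_def upy_def end_height_snoc transpose_def E3)
  have perm: "word_perm (u @ [r]) t = c" "word_perm (u @ [r]) (Suc t) = d"
    "word_perm (u @ [t]) r = a" "word_perm (u @ [t]) (Suc r) = b"
    using rt by (auto simp: word_perm_snoc a_def b_def c_def d_def)
  have zero: "M v w = 0" if "v \<in> {a, b}" "w \<in> {c, d}" "v \<le> i" "i < w" for v w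
    unfolding M_def using that E3 rt by (intro path_sum_upwards[OF ascu]) auto
  have l: "path_sum (u @ [r, t]) i X p q = cross_step i c d y upy (cross_step i a b x upx M) p q"
    using path_sum_two_steps[of u r t p i q X, OF asc1(2) pq nz(1)] unfolding upy' perm
    by (simp add: a_def b_def x_def y_def upx_def M_def)
  have r: "path_sum (u @ [t, r]) i X' p q = cross_step i a b x upx (cross_step i c d y upy M) p q"
    using path_sum_two_steps[of u t r p i q X', OF asc2(2) pq nz(2)] unfolding upx' perm
    by (simp add: c_def d_def x_def y_def upy_def X M')
  have xy: "x \<noteq> 0" "y \<noteq> 0" using nz by (auto simp: x_def y_def)
  have "cross_sum i c d (cross_step i a b x upx M) p q =
      (if upx p then inverse x else 1) * (if upx q then x else 1) * cross_sum i c d (cross_sum i a b M) p q"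
    unfolding cross_step_def by (rule cross_sum_scale[OF up(1) xy(1) ord(2)])
  moreover have "cross_sum i a b (cross_step i c d y upy M) p q =
      (if upy p then inverse y else 1) * (if upy q then y else 1) * cross_sum i a b (cross_sum i c d M) p q"
    unfolding cross_step_def by (rule cross_sum_scale[OF up(2) xy(2) ord(1)])
  moreover have "cross_sum i c d (cross_sum i a b M) p q = cross_sum i a b (cross_sum i c d M) p q"
    using ord disj zero pq by (intro cross_sum_commute) auto
  ultimately show ?thesis
    unfolding l r by (simp add: cross_step_def[of i c d y upy "cross_step i a b x upx M"]
      cross_step_def[of i a b x upx "cross_step i c d y upy M"])
qed

lemma path_sum_commute:
  assumes asc: "ascending (u @ [r, t] @ v)" and rt: "Suc r < t \<or> Suc t < r"
    and nz: "\<And>F. X' F \<noteq> 0" and X: "X = commutation_coords (length u) X'"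
    and pq: "p \<le> i" "i < q"
  shows "path_sum (u @ [r, t] @ v) i X p q = path_sum (u @ [t, r] @ v) i X' p q"
proof -
  have asc': "ascending (u @ [t, r] @ v)"
    using move_invariants(4)[OF move.commute[OF rt]] asc .
  have perm: "word_perm (u @ [r, t]) = word_perm (u @ [t, r])"
    using move_invariants(1)[OF move.commute[OF rt, of u "[]"]] by simp
  have a: "ascending (u @ [r, t])" "ascending (u @ [t, r])"
    using asc asc' by (simp_all add: ascending_append)
  have nzX: "X F \<noteq> 0" for F using nz by (simp add: X commutation_coords_def)
  have eq: "X (After (length u)) = X' (After (Suc (length u)))" "X (After (Suc (length u))) = X' (After (length u))"
    "\<And>c. c \<noteq> length u \<Longrightarrow> c \<noteq> Suc (length u) \<Longrightarrow> X (After c) = X' (After c)"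
    by (auto simp: X commutation_coords_def transpose_def)
  have "path_sum (u @ [r, t]) i X p q = path_sum (u @ [t, r]) i X' p q" if "p \<le> i" "i < q" for p q
    using rt
  proof
    assume "Suc r < t"
    then show ?thesis using a nz nzX eq that by (intro path_sum_commute_local) auto
  next
    assume "Suc t < r"
    then show ?thesis using a nz nzX eq that by (intro path_sum_commute_local[symmetric]) auto
  qed
  then have "path_sum ((u @ [r, t]) @ v) i X p q = path_sum ((u @ [t, r]) @ v) i X' p q"
    using asc asc' perm nzX nz eq pq by (intro path_sum_suffix) auto
  then show ?thesis by simp
qed

lemma level_sum_commute:
  assumes rt: "r \<noteq> t" and X: "X = commutation_coords (length u) X'"
  shows "level_sum (u @ [r, t] @ v) i X = level_sum (u @ [t, r] @ v) i X'"
proof -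
  have eq: "X (After (length u)) = X' (After (Suc (length u)))" "X (After (Suc (length u))) = X' (After (length u))"
    "X (Initial i) = X' (Initial i)"
    "\<And>c. c \<noteq> length u \<Longrightarrow> c \<noteq> Suc (length u) \<Longrightarrow> X (After c) = X' (After c)"
    by (auto simp: X commutation_coords_def transpose_def)
  have "level_prod u i X = level_prod u i X'" "level_sum u i X = level_sum u i X'"
    using eq by (auto intro!: level_cong)
  moreover have W: "level_prod (u @ [a, b]) i Z = level_prod ((u @ [a]) @ [b]) i Z"
    "level_sum (u @ [a, b]) i Z = level_sum ((u @ [a]) @ [b]) i Z" for a b Z
    by simp_all
  ultimately have "level_prod (u @ [r, t]) i X = level_prod (u @ [t, r]) i X'"
    "level_sum (u @ [r, t]) i X = level_sum (u @ [t, r]) i X'"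
    unfolding W level_prod_snoc level_sum_snoc using rt by (auto simp: eq)
  then show ?thesis
    using level_suffix[of "u @ [r, t]" "u @ [t, r]" X X' i v] eq(4) by simp
qed


section \<open>The initial word\<close>

definition initial_prefix :: "nat \<Rightarrow> nat \<Rightarrow> nat list" where
  "initial_prefix n k = initial_word n @ rev [Suc n - k..<Suc n]"

lemma initial_word_0: "initial_word 0 = []"
  by (simp add: initial_word_def)

lemma initial_prefix_0: "initial_prefix n 0 = initial_word n"
  by (simp add: initial_prefix_def)

lemma initial_prefix_Suc: "k < n \<Longrightarrow> initial_prefix n (Suc k) = initial_prefix n k @ [n - k]"
  by (simp add: initial_prefix_def upt_conv_Cons Suc_diff_le del: upt_Suc)

lemma initial_word_Suc: "initial_word (Suc n) = initial_prefix n n"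
  by (cases n) (auto simp: initial_prefix_def initial_word_def)

lemma length_initial_prefix: "k \<le> n \<Longrightarrow> length (initial_prefix n k) = length (initial_word n) + k"
  by (auto simp: initial_prefix_def)

lemma set_initial_word: "set (initial_word n) \<subseteq> {1..<n}"
  by (auto simp: initial_word_def)

lemma end_height_initial_prefix:
  assumes "k \<le> n"
  shows "end_height (initial_prefix n k) a = (if a = Suc n then Suc n - k
    else if 1 \<le> a \<and> a \<le> k then Suc (Suc n) - a else if k < a \<and> a \<le> n then Suc n - a else a)"
  using assms
proof (induction n arbitrary: k a)
  case 0
  then show ?case by (auto simp: initial_prefix_0 initial_word_0 end_height_Nil)
next
  case (Suc n)
  show ?case
    using Suc.prems
  proof (induction k arbitrary: a)
    case 0
    show ?case
      unfolding initial_prefix_0 initial_word_Suc Suc.IH[OF order_refl] by auto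
  next
    case (Suc k)
    have "end_height (initial_prefix (Suc n) (Suc k)) a =
        adj_swap (Suc n - k) (end_height (initial_prefix (Suc n) k) a)"
      using Suc.prems by (simp add: initial_prefix_Suc end_height_snoc)
    note eq = this[unfolded Suc.IH[OF Suc_leD[OF Suc.prems]]]
    consider "a = Suc (Suc n)" | "a = Suc k" | "1 \<le> a" "a \<le> k" | "Suc k < a" "a \<le> Suc n" | "a = 0" | "Suc (Suc n) < a"
      by linarith
    then show ?case
    proof cases
      case 3
      then have "Suc (Suc n - k) < Suc (Suc (Suc n)) - a" using Suc.prems by linarith
      then show ?thesis unfolding eq using Suc.prems 3 by (simp add: transpose_def)
    next
      case 4
      then have "Suc (Suc n) - a < Suc n - k" using Suc.prems by simp
      then show ?thesis unfolding eq using Suc.prems 4 by (simp add: transpose_def)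
    next
      case 6
      then have "Suc (Suc n - k) < a" by linarith
      then show ?thesis unfolding eq using 6 Suc.prems by (simp add: transpose_def)
    qed (unfold eq, use Suc.prems in \<open>simp_all add: transpose_def Suc_diff_le\<close>)
  qed
qed

lemma word_perm_initial_prefix:
  assumes "k < n"
  shows "word_perm (initial_prefix n k) (n - k) = Suc k" "word_perm (initial_prefix n k) (Suc (n - k)) = Suc n"
  using assms by (simp_all add: end_height_iff[symmetric] end_height_initial_prefix)

lemma ascending_initial_prefix: "k \<le> n \<Longrightarrow> ascending (initial_prefix n k)"
proof (induction n arbitrary: k)
  case 0
  then show ?case by (simp add: initial_prefix_0 initial_word_0)
next
  case (Suc n)
  show ?case
    using Suc.prems
  proof (induction k)
    case 0
    then show ?case using Suc.IH[of n] by (simp add: initial_prefix_0 initial_word_Suc)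
  next
    case (Suc k)
    then show ?case by (simp add: initial_prefix_Suc ascending_snoc word_perm_initial_prefix)
  qed
qed

lemma ascending_initial_word: "ascending (initial_word n)"
  using ascending_initial_prefix[of 0 n] by (simp add: initial_prefix_0)

lemma end_height_initial_word:
  "end_height (initial_word n) a = (if 1 \<le> a \<and> a \<le> n then Suc n - a else a)"
  using end_height_initial_prefix[of 0 n a] by (auto simp: initial_prefix_0)

lemma word_perm_initial_word: "word_perm (initial_word n) = longest_perm n"
  by (auto simp: fun_eq_iff end_height_iff[symmetric] end_height_initial_word longest_perm_def)

text \<open>\<open>initial_crossing a m\<close> is the position of the crossing of \<open>a < m\<close>.\<close>

definition initial_crossing :: "nat \<Rightarrow> nat \<Rightarrow> nat" where
  "initial_crossing a m = length (initial_word (m - 1)) + (a - 1)"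

text \<open>The line n + 1 is followed through its crossings. Until it meets \<open>i\<close> it is
  too high to be reached. Its crossing with \<open>i\<close> multiplies the old sum by the inverse
  coordinate and creates the direct turn from \<open>i\<close> to n + 1; its crossing with i + 1,
  where both lines are oriented to the right, lets this turn continue along i + 1. Later crossings
  change nothing, since \<open>i\<close> and i + 1 are both above the new faces.\<close>

lemma path_sum_initial_Suc:
  assumes i: "1 \<le> i" "i \<le> n" and X: "\<And>F. X F \<noteq> 0"
  shows "path_sum (initial_word (Suc n)) i X i (Suc i) =
    inverse (X (After (initial_crossing i (Suc n)))) * (1 + path_sum (initial_word n) i X i (Suc i))"
proof -
  let ?S = "path_sum (initial_word n) i X i (Suc i)"
  let ?x = "X (After (initial_crossing i (Suc n)))"
  have step: "path_sum (initial_prefix n (Suc k)) i X p q =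
      (if n - k < end_height (initial_prefix n (Suc k)) p
       then inverse (X (After (length (initial_word n) + k))) else 1) *
      (if n - k < end_height (initial_prefix n (Suc k)) q then X (After (length (initial_word n) + k)) else 1) *
      cross_sum i (Suc k) (Suc n) (path_sum (initial_prefix n k) i X) p q"
    if "k < n" "p \<le> i" "i < q" for k p q
    using path_sum_snoc[of "initial_prefix n k" "n - k" p i q X] ascending_initial_prefix[of "Suc k" n] that X
    by (simp add: initial_prefix_Suc word_perm_initial_prefix length_initial_prefix)
  have zero: "path_sum (initial_prefix n k) i X i (Suc n) = 0" if "k < i" for k
    using that i by (intro path_sum_upwards ascending_initial_prefix) (auto simp: end_height_initial_prefix)
  have before: "path_sum (initial_prefix n k) i X i (Suc i) = ?S" if "k < i" for k
    using that
  proof (induction k)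
    case 0
    show ?case by (simp add: initial_prefix_0)
  next
    case (Suc k)
    have "path_sum (initial_prefix n (Suc k)) i X i (Suc i) = path_sum (initial_prefix n k) i X i (Suc i)"
      using Suc.prems i zero[of k]
      by (subst step) (auto simp: end_height_initial_prefix cross_sum_def)
    then show ?case using Suc by simp
  qed
  have at_i: "path_sum (initial_prefix n i) i X i (Suc n) = inverse ?x"
    "i < n \<Longrightarrow> path_sum (initial_prefix n i) i X i (Suc i) = inverse ?x * ?S"
  proof -
    obtain k where k: "i = Suc k" using i by (cases i) auto
    have nk: "Suc n - k = Suc (n - k)" "\<not> n - k < n - Suc k" using i k by simp_all
    have "path_sum (initial_prefix n (Suc k)) (Suc k) X (Suc k) (Suc n) = inverse ?x"
      using i zero[of k] k step[of k "Suc k" "Suc n"]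
      by (simp add: end_height_initial_prefix cross_sum_def initial_crossing_def nk)
    then show "path_sum (initial_prefix n i) i X i (Suc n) = inverse ?x" unfolding k .
    assume "i < n"
    then have "path_sum (initial_prefix n (Suc k)) (Suc k) X (Suc k) (Suc (Suc k)) = inverse ?x * ?S"
      using i zero[of k] k step[of k "Suc k" "Suc (Suc k)"] before[of k]
      by (simp add: end_height_initial_prefix cross_sum_def initial_crossing_def nk)
    then show "path_sum (initial_prefix n i) i X i (Suc i) = inverse ?x * ?S" unfolding k .
  qed
  show ?thesis
  proof (cases "i = n")
    case True
    then have "?S = 0"
      by (intro path_sum_upwards ascending_initial_word) (auto simp: end_height_initial_word)
    then show ?thesis using at_i(1) True by (simp add: initial_word_Suc)
  next
    case False
    \<comment> \<open>The induction starts right after the crossing with i + 1, where the two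
      contributions are merged.\<close>
    have "Suc (i + k) \<le> n \<Longrightarrow> path_sum (initial_prefix n (Suc (i + k))) i X i (Suc i) = inverse ?x * (1 + ?S)" for k
    proof (induction k)
      case 0
      then show ?case
        using at_i i X step[of i i "Suc i"]
        by (simp add: end_height_initial_prefix cross_sum_def algebra_simps)
    next
      case (Suc k)
      then show ?case
        using i X step[of "Suc (i + k)" i "Suc i"]
        by (simp add: end_height_initial_prefix cross_sum_def)
    qed
    from this[of "n - Suc i"] show ?thesis using False i by (simp add: initial_word_Suc)
  qed
qed

text \<open>Iterating S(n+1) = g * (1 + S(n)) as in Horner's scheme yields the nested products of
  the second sum in Magee's formula.\<close>

lemma path_sum_initial_word:
  assumes "1 \<le> i" "i < n" "\<And>F. X F \<noteq> 0"
  shows "path_sum (initial_word n) i X i (Suc i) =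
    (\<Sum>k=0..n-1-i. \<Prod>j=0..k. inverse (X (After (initial_crossing i (n - j)))))"
  using assms(2)
proof (induction n)
  case (Suc n)
  let ?g = "\<lambda>j. inverse (X (After (initial_crossing i (Suc n - j))))"
  show ?case
  proof (cases "i = n")
    case True
    have "path_sum (initial_word n) n X n (Suc n) = 0"
      by (intro path_sum_upwards ascending_initial_word) (auto simp: end_height_initial_word)
    then show ?thesis using path_sum_initial_Suc[of i n X] assms True by simp
  next
    case False
    then have "i < n" using Suc.prems by simp
    then have n: "Suc n - 1 - i = Suc (n - 1 - i)" by simp
    have "(\<Sum>k=0..Suc n - 1 - i. \<Prod>j=0..k. ?g j) = ?g 0 + (\<Sum>k=0..n - 1 - i. \<Prod>j=0..Suc k. ?g j)"
      unfolding n by (subst sum.atLeast0_atMost_Suc_shift) (simp add: comp_def)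
    also have "\<dots> = ?g 0 + (\<Sum>k=0..n - 1 - i. ?g 0 * (\<Prod>j=0..k. inverse (X (After (initial_crossing i (n - j))))))"
      by (subst prod.atLeast0_atMost_Suc_shift) (simp add: comp_def)
    also have "\<dots> = ?g 0 * (1 + path_sum (initial_word n) i X i (Suc i))"
      using Suc.IH \<open>i < n\<close> by (simp add: algebra_simps sum_distrib_left)
    finally show ?thesis using path_sum_initial_Suc[of i n X] assms Suc.prems by simp
  qed
qed simp

section \<open>Levels and crossings of the initial word\<close>

lemma level_crossings_initial_prefix:
  assumes "k \<le> n"
  shows "level_crossings (initial_prefix n k) i = level_crossings (initial_word n) i @
    (if n - k < i \<and> i \<le> n then [initial_crossing (Suc n - i) (Suc n)] else [])"
  using assms
proof (induction k)
  case (Suc k)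
  have eq: "level_crossings (initial_prefix n (Suc k)) i =
      level_crossings (initial_prefix n k) i @ (if n - k = i then [length (initial_word n) + k] else [])"
    using Suc.prems by (simp add: initial_prefix_Suc level_crossings_snoc length_initial_prefix)
  show ?case
  proof (cases "n - k = i")
    case True
    then have "k = n - i" "i \<le> n" "\<not> n - k < i" "n - Suc k < i" using Suc.prems by auto
    then show ?thesis unfolding eq using Suc by (simp add: initial_crossing_def)
  next
    case False
    then have "n - Suc k < i \<longleftrightarrow> n - k < i" using Suc.prems by linarith
    then show ?thesis unfolding eq using Suc False by simp
  qed
qed (auto simp: initial_prefix_0)

lemma level_crossings_initial_word:
  "1 \<le> i \<Longrightarrow> level_crossings (initial_word n) i = map (\<lambda>j. initial_crossing j (i + j)) [1..<Suc (n - i)]"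
proof (induction n)
  case 0
  then show ?case by (simp add: initial_word_0 level_crossings_Nil)
next
  case (Suc n)
  then show ?case
    by (auto simp: initial_word_Suc level_crossings_initial_prefix Suc_diff_le)
qed

lemma level_sum_initial_word:
  assumes "1 \<le> i" "i < n"
  shows "level_sum (initial_word n) i X =
    (\<Sum>k=0..n-1-i. inverse (X (Initial i)) * (\<Prod>j=1..k. inverse (X (After (initial_crossing j (i + j))))))"
proof -
  have inj: "inj_on (\<lambda>j. initial_crossing j (i + j)) {1..<Suc (n - i)}"
    using level_crossings_initial_word[OF assms(1), of n]
    by (metis distinct_filter distinct_map distinct_upt level_crossings_def set_upt)
  have "(\<Prod>c\<in>set (take k (level_crossings (initial_word n) i)). inverse (X (After c))) =
      (\<Prod>j=1..k. inverse (X (After (initial_crossing j (i + j)))))" if "k < n - i" for k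
  proof -
    have "set (take k (level_crossings (initial_word n) i)) = (\<lambda>j. initial_crossing j (i + j)) ` {1..k}"
      unfolding level_crossings_initial_word[OF assms(1)] take_map using that
      by (simp add: take_upt atLeastLessThanSuc_atLeastAtMost del: upt_Suc)
    moreover have "inj_on (\<lambda>j. initial_crossing j (i + j)) {1..k}"
      using inj that by (auto intro: inj_on_subset)
    ultimately show ?thesis by (simp add: prod.reindex)
  qed
  moreover have "{..<n - i} = {0..n - 1 - i}" using assms by auto
  ultimately show ?thesis
    unfolding level_sum_def using assms
    by (intro sum.cong) (auto simp: level_crossings_initial_word)
qed

lemma crossing_lines_initial_word:
  assumes "1 \<le> a" "a < m" "m \<le> n"
  shows "initial_crossing a m < length (initial_word n)"
    "crossing_lines (initial_word n) (initial_crossing a m) = {a, m}"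
proof -
  obtain k where k: "a = Suc k" using assms by (cases a) auto
  obtain l where l: "m = Suc l" using assms by (cases m) auto
  have "\<exists>v. initial_word n = initial_word m @ v"
    using assms(3)
  proof (induction n rule: dec_induct)
    case (step n)
    then show ?case by (auto simp: initial_word_Suc initial_prefix_def)
  qed simp
  moreover have "\<exists>v. initial_word m = initial_prefix l (Suc k) @ v"
  proof -
    have "[Suc l - l..<Suc l] = [Suc l - l..<Suc l - Suc k] @ [Suc l - Suc k..<Suc l]"
      using assms k l upt_add_eq_append[of "Suc l - l" "Suc l - Suc k" "Suc k"] by simp
    then have "rev [Suc l - l..<Suc l] = rev [Suc l - Suc k..<Suc l] @ rev [Suc l - l..<Suc l - Suc k]"
      by (metis rev_append)
    then show ?thesis
      unfolding l initial_word_Suc initial_prefix_def by (simp del: upt_Suc)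
  qed
  ultimately obtain v where v: "initial_word n = (initial_prefix l k @ [l - k]) @ v"
    using assms k l initial_prefix_Suc[of k l] by auto
  have "initial_crossing a m = length (initial_prefix l k)"
    using assms k l by (simp add: initial_crossing_def length_initial_prefix)
  then show "initial_crossing a m < length (initial_word n)"
    "crossing_lines (initial_word n) (initial_crossing a m) = {a, m}"
    using assms k l unfolding v
    by (simp_all add: crossing_lines_append crossing_lines_snoc word_perm_initial_prefix del: append_assoc)
qed

lemma initial_crossing_cases:
  "c < length (initial_word n) \<Longrightarrow> \<exists>a m. 1 \<le> a \<and> a < m \<and> m \<le> n \<and> c = initial_crossing a m"
proof (induction n)
  case 0
  then show ?case by (simp add: initial_word_0)
next
  case (Suc n)
  show ?case
  proof (cases "c < length (initial_word n)")
    case True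
    then obtain a m where "1 \<le> a" "a < m" "m \<le> n" "c = initial_crossing a m" using Suc.IH by blast
    then show ?thesis using le_SucI by blast
  next
    case False
    then have "c = initial_crossing (Suc (c - length (initial_word n))) (Suc n)"
      "c - length (initial_word n) < n"
      using Suc.prems by (auto simp: initial_crossing_def initial_word_Suc length_initial_prefix)
    then show ?thesis by (intro exI[of _ "Suc (c - length (initial_word n))"] exI[of _ "Suc n"]) auto
  qed
qed

lemma pair_face_initial_word:
  assumes "1 \<le> a" "a < m" "m \<le> n"
  shows "pair_face (initial_word n) a m = After (initial_crossing a m)"
  unfolding pair_face_def
proof (rule arg_cong[of _ _ After], rule the_equality)
  show "initial_crossing a m < length (initial_word n) \<and>
      crossing_lines (initial_word n) (initial_crossing a m) = {a, m}"
    using crossing_lines_initial_word[OF assms] by simp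
  fix c assume c: "c < length (initial_word n) \<and> crossing_lines (initial_word n) c = {a, m}"
  then obtain b l where b: "1 \<le> b" "b < l" "l \<le> n" "c = initial_crossing b l"
    using initial_crossing_cases by blast
  then have "{b, l} = {a, m}" using c crossing_lines_initial_word(2)[OF b(1-3)] by simp
  then show "c = initial_crossing a m" using b assms by (auto simp: doubleton_eq_iff)
qed


section \<open>Laurent polynomials\<close>

abbreviation lookup :: "('a \<Rightarrow>\<^sub>0 'b :: zero) \<Rightarrow> 'a \<Rightarrow> 'b" where
  "lookup \<equiv> Poly_Mapping.lookup"

abbreviation keys :: "('a \<Rightarrow>\<^sub>0 'b :: zero) \<Rightarrow> 'a set" where
  "keys \<equiv> Poly_Mapping.keys"

definition monomial :: "(face \<Rightarrow>\<^sub>0 int) \<Rightarrow> (face \<Rightarrow> complex) \<Rightarrow> complex" where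
  "monomial u X = (\<Prod>F\<in>keys u. X F powi lookup u F)"

lemma monomial_superset:
  assumes "finite S" "keys u \<subseteq> S"
  shows "monomial u X = (\<Prod>F\<in>S. X F powi lookup u F)"
  unfolding monomial_def using assms by (intro prod.mono_neutral_left) (auto simp: in_keys_iff)

lemma monomial_0 [simp]: "monomial 0 X = 1"
  by (simp add: monomial_def)

lemma monomial_add:
  assumes "\<And>F. X F \<noteq> 0"
  shows "monomial (u + v) X = monomial u X * monomial v X"
proof -
  let ?S = "keys u \<union> keys v"
  have "monomial (u + v) X = (\<Prod>F\<in>?S. X F powi lookup (u + v) F)"
    using Poly_Mapping.keys_add[of u v] by (intro monomial_superset) auto
  also have "\<dots> = (\<Prod>F\<in>?S. X F powi lookup u F) * (\<Prod>F\<in>?S. X F powi lookup v F)"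
    using assms by (simp add: lookup_add power_int_add prod.distrib)
  finally show ?thesis by (simp add: monomial_superset[of ?S])
qed

lemma monomial_minus:
  assumes "\<And>F. X F \<noteq> 0"
  shows "monomial (- u) X = inverse (monomial u X)"
proof -
  have "monomial (- u) X * monomial u X = 1"
    using monomial_add[of X "- u" u] assms by simp
  then show ?thesis by (metis inverse_unique mult.commute)
qed

lemma monomial_diff:
  assumes "\<And>F. X F \<noteq> 0"
  shows "monomial (u - v) X = monomial u X * inverse (monomial v X)"
  using monomial_add[of X u "- v"] monomial_minus[of X v] assms by simp

lemma monomial_e_face: "monomial (e_face F) X = X F"
  by (simp add: monomial_def)

lemma monomial_sum:
  assumes "\<And>F. X F \<noteq> 0"
  shows "monomial (\<Sum>j\<in>J. u j) X = (\<Prod>j\<in>J. monomial (u j) X)"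
  using assms by (induction J rule: infinite_finite_induct) (auto simp: monomial_add)

lemma laurent_eval_superset:
  assumes "finite S" "keys P \<subseteq> S"
  shows "laurent_eval P X = (\<Sum>u\<in>S. lookup P u * monomial u X)"
  unfolding laurent_eval_def monomial_def using assms
  by (intro sum.mono_neutral_left) (auto simp: in_keys_iff)

lemma laurent_eval_0 [simp]: "laurent_eval 0 X = 0"
  by (simp add: laurent_eval_def)

lemma laurent_eval_add: "laurent_eval (P + Q) X = laurent_eval P X + laurent_eval Q X"
proof -
  let ?S = "keys P \<union> keys Q"
  have "laurent_eval (P + Q) X = (\<Sum>u\<in>?S. lookup (P + Q) u * monomial u X)"
    using Poly_Mapping.keys_add[of P Q] by (intro laurent_eval_superset) auto
  also have "\<dots> = (\<Sum>u\<in>?S. lookup P u * monomial u X) + (\<Sum>u\<in>?S. lookup Q u * monomial u X)"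
    by (simp add: lookup_add distrib_right sum.distrib)
  finally show ?thesis by (simp add: laurent_eval_superset[of ?S])
qed

lemma laurent_eval_sum: "laurent_eval (\<Sum>j\<in>J. P j) X = (\<Sum>j\<in>J. laurent_eval (P j) X)"
  by (induction J rule: infinite_finite_induct) (auto simp: laurent_eval_add)

lemma laurent_eval_z_pow: "laurent_eval (z_pow u) X = monomial u X"
  by (simp add: laurent_eval_def monomial_def)

text \<open>The monomials are distinct characters of the group of positive points of the torus, hence
  linearly independent (Dedekind).\<close>

lemma monomials_independent:
  assumes "finite S" "\<And>X. (\<forall>F. \<exists>x>0. X F = complex_of_real x) \<Longrightarrow> (\<Sum>u\<in>S. a u * monomial u X) = 0" "u \<in> S"
  shows "a u = 0"
  using assms
proof (induction S arbitrary: a u rule: finite_induct)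
  case (insert v S)
  let ?pos = "\<lambda>X :: face \<Rightarrow> complex. \<forall>F. \<exists>x>0. X F = complex_of_real x"
  have *: "a u = 0" if u: "u \<in> S" for u
  proof -
    have "u \<noteq> v" using u insert.hyps by auto
    then obtain F where F: "lookup u F \<noteq> lookup v F"
      by (meson poly_mapping_eqI)
    \<comment> \<open>Multiplication by \<open>Y\<close> dilates one coordinate in which the
      exponents of \<open>u\<close> and \<open>v\<close> differ, so the characters \<open>u\<close>
      and \<open>v\<close> take different values at \<open>Y\<close>.\<close>
    define Y where "Y = (\<lambda>G. if G = F then 2 else 1 :: complex)"
    have Y: "monomial w Y = 2 powi lookup w F" for w
    proof -
      have "monomial w Y = (\<Prod>G\<in>insert F (keys w). Y G powi lookup w G)"
        by (intro monomial_superset) auto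
      also have "\<dots> = (\<Prod>G\<in>{F}. Y G powi lookup w G)"
        by (intro prod.mono_neutral_right) (auto simp: Y_def)
      finally show ?thesis by (simp add: Y_def)
    qed
    have "a u * (monomial u Y - monomial v Y) = 0"
    proof (rule insert.IH[of "\<lambda>w. a w * (monomial w Y - monomial v Y)", OF _ u])
      fix X assume X: "?pos X"
      have XY: "?pos (\<lambda>G. X G * Y G)"
      proof
        fix G
        obtain x where "x > 0" "X G = complex_of_real x" using X by blast
        then show "\<exists>x>0. X G * Y G = complex_of_real x"
          by (intro exI[of _ "x * (if G = F then 2 else 1)"]) (auto simp: Y_def)
      qed
      have prod: "monomial w (\<lambda>G. X G * Y G) = monomial w X * monomial w Y" for w
        by (simp add: monomial_def power_int_mult_distrib prod.distrib)
      \<comment> \<open>Subtracting \<open>monomial v Y\<close> times the relation at X from the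
        relation at the product point eliminates the term of \<open>v\<close>.\<close>
      have "0 = (\<Sum>w\<in>insert v S. a w * monomial w (\<lambda>G. X G * Y G)) -
          monomial v Y * (\<Sum>w\<in>insert v S. a w * monomial w X)"
        using insert.prems(1) X XY by simp
      also have "\<dots> = (\<Sum>w\<in>insert v S. a w * (monomial w Y - monomial v Y) * monomial w X)"
        unfolding prod sum_distrib_left sum_subtractf[symmetric]
        by (intro sum.cong) (auto simp: algebra_simps)
      also have "\<dots> = (\<Sum>w\<in>S. a w * (monomial w Y - monomial v Y) * monomial w X)"
        using insert.hyps by simp
      finally show "(\<Sum>w\<in>S. a w * (monomial w Y - monomial v Y) * monomial w X) = 0" by simp
    qed
    moreover have "(2 :: real) powi lookup u F \<noteq> 2 powi lookup v F"
      using F power_int_strict_increasing[of "lookup u F" "lookup v F" "2 :: real"]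
        power_int_strict_increasing[of "lookup v F" "lookup u F" "2 :: real"]
      by (cases "lookup u F < lookup v F") auto
    then have "complex_of_real (2 powi lookup u F) \<noteq> complex_of_real (2 powi lookup v F)"
      unfolding of_real_eq_iff .
    then have "monomial u Y \<noteq> monomial v Y"
      unfolding Y by simp
    ultimately show ?thesis by simp
  qed
  have "(\<Sum>w\<in>insert v S. a w * monomial w (\<lambda>_. 1)) = 0"
    by (rule insert.prems(1)) (auto intro: exI[of _ 1])
  moreover have "(\<Sum>w\<in>S. a w * monomial w (\<lambda>_. 1)) = 0"
    using * by (intro sum.neutral) simp
  ultimately have "a v = 0"
    using insert.hyps by (simp add: monomial_def)
  then show ?case using * insert.prems(2) by auto
qed simp

text \<open>The condition on \<open>G\<close> is the one under which a braid move prescribes values.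
  It costs nothing, since it holds at all positive points and these already determine the
  coefficients.\<close>

lemma laurent_eqI:
  assumes "\<And>X. (\<And>F. X F \<noteq> 0) \<Longrightarrow> 1 + X G \<noteq> 0 \<Longrightarrow> laurent_eval P X = laurent_eval Q X"
  shows "P = Q"
proof (rule poly_mapping_eqI)
  fix u
  let ?S = "insert u (keys P \<union> keys Q)"
  have "lookup P u - lookup Q u = 0"
  proof (rule monomials_independent[of ?S "\<lambda>u. lookup P u - lookup Q u"])
    fix X :: "face \<Rightarrow> complex"
    assume X: "\<forall>F. \<exists>x>0. X F = complex_of_real x"
    have "X F \<noteq> 0" for F using X by (metis less_irrefl of_real_eq_0_iff)
    moreover have "1 + X G \<noteq> 0"
    proof -
      obtain x where x: "x > 0" "X G = complex_of_real x" using X by blast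
      have "1 + X G = complex_of_real (1 + x)" unfolding x by simp
      then show ?thesis using x(1) by (metis add_pos_pos less_irrefl of_real_eq_0_iff zero_less_one)
    qed
    ultimately have "laurent_eval P X = laurent_eval Q X" by (intro assms)
    moreover have "laurent_eval P X = (\<Sum>u\<in>?S. lookup P u * monomial u X)"
      "laurent_eval Q X = (\<Sum>u\<in>?S. lookup Q u * monomial u X)"
      by (rule laurent_eval_superset; auto)+
    ultimately show "(\<Sum>u\<in>?S. (lookup P u - lookup Q u) * monomial u X) = 0"
      unfolding left_diff_distrib sum_subtractf by simp
  qed auto
  then show "lookup P u = lookup Q u" by simp
qed

lemma lookup_sum_z_pow:
  assumes "finite J"
  shows "lookup (\<Sum>j\<in>J. z_pow (f j)) u = of_nat (card {j \<in> J. f j = u})"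
  using assms
proof (induction J rule: finite_induct)
  case (insert j J)
  have "{i \<in> insert j J. f i = u} = (if f j = u then insert j {i \<in> J. f i = u} else {i \<in> J. f i = u})"
    by auto
  then show ?case using insert by (simp add: lookup_add lookup_single when_def)
qed simp

lemma keys_sum_z_pow: "finite J \<Longrightarrow> keys (\<Sum>j\<in>J. z_pow (f j)) = f ` J"
  by (auto simp: in_keys_iff lookup_sum_z_pow card_eq_0_iff)

text \<open>No cancellation can occur on restriction, since all coefficients are positive.\<close>

lemma keys_restrict_laurent_sum:
  assumes "finite J"
  shows "keys (restrict_laurent A (\<Sum>j\<in>J. z_pow (f j))) = restrict_exponent A ` f ` J"
proof -
  let ?P = "\<Sum>j\<in>J. z_pow (f j) :: laurent"
  let ?c = "\<lambda>v. \<Sum>u\<in>f ` J. if restrict_exponent A u = v then card {j \<in> J. f j = u} else 0"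
  have lookup: "lookup (restrict_laurent A ?P) v = of_nat (?c v)" for v
    unfolding restrict_laurent_def keys_sum_z_pow[OF assms] lookup_sum_z_pow[OF assms]
    unfolding lookup_sum lookup_single when_def of_nat_sum
    by (intro sum.cong) auto
  have zero: "?c v = 0 \<longleftrightarrow> v \<notin> restrict_exponent A ` f ` J" for v
    using assms by (auto simp: card_eq_0_iff)
  show ?thesis
    by (rule set_eqI) (unfold in_keys_iff lookup of_nat_eq_0_iff zero not_not, rule refl)
qed

section \<open>Pairings with restricted exponents and the tropical inequality\<close>

lemma pairing_superset:
  assumes "finite S" "keys u \<subseteq> S"
  shows "pairing u x = (\<Sum>F\<in>S. of_int (lookup u F) * x F)"
  unfolding pairing_def using assms by (intro sum.mono_neutral_left) (auto simp: in_keys_iff)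

lemma lookup_restrict_exponent:
  "lookup (restrict_exponent A u) F = (if F \<in> A then lookup u F else 0)"
proof -
  have "lookup (restrict_exponent A u) F =
      (\<Sum>G\<in>keys u \<inter> A. if G = F then lookup u G else 0)"
    by (simp add: restrict_exponent_def lookup_sum lookup_single when_def)
  then show ?thesis by (auto simp: in_keys_iff)
qed

lemma pairing_restrict_exponent:
  assumes "finite A"
  shows "pairing (restrict_exponent A u) x = (\<Sum>F\<in>A. of_int (lookup u F) * x F)"
proof -
  have "pairing (restrict_exponent A u) x =
      (\<Sum>F\<in>A. of_int (lookup (restrict_exponent A u) F) * x F)"
    using assms by (intro pairing_superset) (auto simp: in_keys_iff lookup_restrict_exponent split: if_splits)
  then show ?thesis by (simp add: lookup_restrict_exponent)
qed

lemma tropicalization_nonneg_iff: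
  "0 \<le> tropicalization P x \<longleftrightarrow> (\<forall>u\<in>keys P. 0 \<le> pairing u x)"
  by (simp add: tropicalization_def le_INF_iff)


section \<open>The superpotential as a sum over GP-paths\<close>

lemma inverse_prod:
  fixes f :: "'a \<Rightarrow> complex"
  shows "inverse (\<Prod>x\<in>A. f x) = (\<Prod>x\<in>A. inverse (f x))"
  using prod_inversef[of f A] by (simp add: comp_def)

text \<open>The enclosed region is defined by positive winding number. It yields the same exponents
  as the winding numbers themselves because these are 0 or 1, and 0 at the initial faces.\<close>

lemma monomial_path_vector:
  assumes "ascending w" "ps \<in> paths w i p q" "p \<le> i" "i < q" and X: "\<And>F. X F \<noteq> 0"
  shows "monomial (path_vector n w i ps) X = path_weight w i X ps"
proof -
  let ?W = "\<lambda>c. winding w i ps (Suc c) (w ! c)"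
  have range: "?W c \<in> {0, 1}" if "c < length w" for c
    using that winding_range[OF assms(1-4)] by (meson Suc_leI)
  have enc: "enclosed_faces n w i ps = After ` {c. c < length w \<and> ?W c = 1}"
  proof (rule set_eqI)
    fix F
    show "F \<in> enclosed_faces n w i ps \<longleftrightarrow> F \<in> After ` {c. c < length w \<and> ?W c = 1}"
    proof (cases F)
      case (Initial r)
      then show ?thesis
        using winding_column_0[OF assms(1-4)]
        by (auto simp: enclosed_faces_def path_winding_eq face_column_def face_level_def)
    next
      case (After c)
      then show ?thesis
        using range[of c]
        by (auto simp: enclosed_faces_def path_winding_eq face_column_def face_level_def faces_def)
    qed
  qed
  have "monomial (path_vector n w i ps) X = inverse (\<Prod>F\<in>enclosed_faces n w i ps. X F)"
    unfolding path_vector_def monomial_minus[of X, OF X] monomial_sum[of X, OF X] monomial_e_face ..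
  also have "\<dots> = (\<Prod>c\<in>{c. c < length w \<and> ?W c = 1}. inverse (X (After c)))"
    unfolding enc by (simp add: prod.reindex inj_on_def inverse_prod)
  also have "\<dots> = (\<Prod>c<length w. if ?W c = 1 then inverse (X (After c)) else 1)"
    by (simp add: prod.If_cases Int_def conj_commute)
  also have "\<dots> = path_weight w i X ps"
    unfolding path_weight_def
  proof (rule prod.cong[OF refl])
    fix c assume "c \<in> {..<length w}"
    then show "(if ?W c = 1 then inverse (X (After c)) else 1) = X (After c) powi - ?W c"
      using range[of c] by (auto simp: power_int_minus)
  qed
  finally show ?thesis .
qed

lemma monomial_level_vector:
  assumes "\<And>F. X F \<noteq> 0"
  shows "monomial (level_vector w i k) X =
    inverse (X (Initial i)) * (\<Prod>c\<in>set (take k (level_crossings w i)). inverse (X (After c)))"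
  unfolding level_vector_def monomial_diff[of X, OF assms] monomial_minus[of X, OF assms]
    monomial_sum[of X, OF assms] monomial_e_face
  by (simp add: inverse_prod)

text \<open>An index set for the terms rather than a set of exponents: terms with equal exponents
  are counted with multiplicity. The index k = n_i is left out.\<close>

definition superpotential_terms :: "nat \<Rightarrow> nat list \<Rightarrow> (nat \<times> piece list + nat \<times> nat) set" where
  "superpotential_terms n w = gp_paths n w <+> (SIGMA i:{1..<n}. {..<length (level_crossings w i)})"

definition superpotential_exponent ::
  "nat \<Rightarrow> nat list \<Rightarrow> nat \<times> piece list + nat \<times> nat \<Rightarrow> face \<Rightarrow>\<^sub>0 int" where
  "superpotential_exponent n w = case_sum (\<lambda>(i, ps). path_vector n w i ps) (\<lambda>(i, k). level_vector w i k)"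

definition path_superpotential :: "nat \<Rightarrow> nat list \<Rightarrow> laurent" where
  "path_superpotential n w = (\<Sum>j\<in>superpotential_terms n w. z_pow (superpotential_exponent n w j))"

lemma end_height_longest:
  "word_perm w = longest_perm n \<Longrightarrow> end_height w a = (if 1 \<le> a \<and> a \<le> n then Suc n - a else a)"
  by (auto simp: end_height_iff longest_perm_def)

text \<open>For w_0 the lines i and i + 1 end at the adjacent heights n + 1 - i and n - i, so the
  height conditions leave only p = i and q = i + 1.\<close>

lemma gp_paths_longest:
  assumes w: "word_perm w = longest_perm n"
  shows "gp_paths n w = (SIGMA i:{1..<n}. paths w i i (Suc i))"
proof -
  have "(i, ps) \<in> gp_paths n w \<longleftrightarrow> i \<in> {1..<n} \<and> ps \<in> paths w i i (Suc i)" for i ps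
  proof
    assume "(i, ps) \<in> gp_paths n w"
    then obtain p q where i: "i \<in> {1..<n}" and ps: "ps \<in> paths w i p q"
      and pq: "1 \<le> p" "p \<le> i" "i < q" "q \<le> n"
        "end_height w (i + 1) \<le> end_height w p" "end_height w q \<le> end_height w i"
        "end_height w p \<le> end_height w i" "end_height w (i + 1) \<le> end_height w q"
      by (auto simp: gp_paths_def paths_def)
    have "p = i" "q = Suc i"
      using i pq by (simp_all add: end_height_longest[OF w])
    then show "i \<in> {1..<n} \<and> ps \<in> paths w i i (Suc i)" using i ps by simp
  next
    assume R: "i \<in> {1..<n} \<and> ps \<in> paths w i i (Suc i)"
    then have "end_height w (i + 1) \<le> end_height w i" by (simp add: end_height_longest[OF w])
    then show "(i, ps) \<in> gp_paths n w"
      using R by (auto simp: gp_paths_def paths_def)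
  qed
  then show ?thesis by auto
qed

lemma finite_superpotential_terms:
  assumes "ascending w" "word_perm w = longest_perm n"
  shows "finite (superpotential_terms n w)"
  unfolding superpotential_terms_def gp_paths_longest[OF assms(2)]
  by (intro finite_Plus finite_SigmaI finite_paths[OF assms(1)]) auto

lemma eval_path_superpotential:
  assumes w: "ascending w" "word_perm w = longest_perm n" and X: "\<And>F. X F \<noteq> 0"
  shows "laurent_eval (path_superpotential n w) X =
    (\<Sum>i\<in>{1..<n}. path_sum w i X i (Suc i) + level_sum w i X)"
proof -
  have "laurent_eval (path_superpotential n w) X =
      (\<Sum>(i, ps)\<in>gp_paths n w. monomial (path_vector n w i ps) X) +
      (\<Sum>(i, k)\<in>(SIGMA i:{1..<n}. {..<length (level_crossings w i)}). monomial (level_vector w i k) X)"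
    using finite_superpotential_terms[OF w]
    by (simp add: path_superpotential_def laurent_eval_add laurent_eval_sum laurent_eval_z_pow superpotential_terms_def
      superpotential_exponent_def sum.Plus comp_def case_prod_unfold)
  also have "(\<Sum>(i, ps)\<in>gp_paths n w. monomial (path_vector n w i ps) X) =
      (\<Sum>i\<in>{1..<n}. path_sum w i X i (Suc i))"
    unfolding gp_paths_longest[OF w(2)] path_sum_def
    using w finite_paths[OF w(1)] monomial_path_vector[of w _ _ _ _ X, OF w(1) _ _ _ X]
    by (subst sum.Sigma[symmetric]) (auto intro!: sum.cong)
  also have "(\<Sum>(i, k)\<in>(SIGMA i:{1..<n}. {..<length (level_crossings w i)}). monomial (level_vector w i k) X) =
      (\<Sum>i\<in>{1..<n}. level_sum w i X)"
    unfolding level_sum_def monomial_level_vector[of X, OF X]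
    by (subst sum.Sigma[symmetric]) auto
  finally show ?thesis by (simp add: sum.distrib)
qed

lemma initial_superpotential_eq: "initial_superpotential n = path_superpotential n (initial_word n)"
proof (rule laurent_eqI)
  fix X :: "face \<Rightarrow> complex"
  assume X: "\<And>F. X F \<noteq> 0"
  note mon = monomial_minus[of X, OF X] monomial_diff[of X, OF X] monomial_sum[of X, OF X] monomial_e_face
  have "laurent_eval (initial_superpotential n) X =
    (\<Sum>i\<in>{1..<n}.
      (\<Sum>k=0..n-1-i. inverse (X (Initial i)) * (\<Prod>j=1..k. inverse (X (pair_face (initial_word n) j (i + j))))) +
      (\<Sum>k=0..n-1-i. \<Prod>j=0..k. inverse (X (pair_face (initial_word n) i (n - j)))))"
    unfolding initial_superpotential_def Let_def laurent_eval_sum laurent_eval_add laurent_eval_z_pow mon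
    by (simp add: inverse_prod)
  also have "\<dots> = (\<Sum>i\<in>{1..<n}. path_sum (initial_word n) i X i (Suc i) + level_sum (initial_word n) i X)"
  proof (rule sum.cong[OF refl])
    fix i assume "i \<in> {1..<n}"
    then have i: "1 \<le> i" "i < n" by auto
    have "(\<Sum>k=0..n-1-i. inverse (X (Initial i)) * (\<Prod>j=1..k. inverse (X (pair_face (initial_word n) j (i + j))))) =
        level_sum (initial_word n) i X"
      unfolding level_sum_initial_word[OF i] using i
      by (intro sum.cong prod.cong arg_cong2[of _ _ _ _ times] refl) (auto simp: pair_face_initial_word)
    moreover have "(\<Sum>k=0..n-1-i. \<Prod>j=0..k. inverse (X (pair_face (initial_word n) i (n - j)))) =
        path_sum (initial_word n) i X i (Suc i)"
      unfolding path_sum_initial_word[of i n X, OF i X] using i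
      by (intro sum.cong prod.cong refl) (auto simp: pair_face_initial_word)
    ultimately show "(\<Sum>k=0..n-1-i. inverse (X (Initial i)) * (\<Prod>j=1..k. inverse (X (pair_face (initial_word n) j (i + j))))) +
      (\<Sum>k=0..n-1-i. \<Prod>j=0..k. inverse (X (pair_face (initial_word n) i (n - j)))) =
      path_sum (initial_word n) i X i (Suc i) + level_sum (initial_word n) i X" by simp
  qed
  also have "\<dots> = laurent_eval (path_superpotential n (initial_word n)) X"
    using eval_path_superpotential[of _ n X, OF ascending_initial_word word_perm_initial_word X] by simp
  finally show "laurent_eval (initial_superpotential n) X =
      laurent_eval (path_superpotential n (initial_word n)) X" .
qed

lemma eval_path_superpotential_commute:
  assumes w: "ascending (u @ [r, t] @ v)" "word_perm (u @ [r, t] @ v) = longest_perm n"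
    and rt: "r + 1 < t \<or> t + 1 < r" and X: "\<And>F. X' F \<noteq> 0"
  shows "laurent_eval (path_superpotential n (u @ [t, r] @ v)) X' =
    laurent_eval (path_superpotential n (u @ [r, t] @ v)) (commutation_coords (length u) X')"
proof -
  have rt': "Suc r < t \<or> Suc t < r" using rt by simp
  note inv = move_invariants[OF move.commute[OF rt', of u v]]
  have X0: "commutation_coords (length u) X' F \<noteq> 0" for F
    using X by (simp add: commutation_coords_def)
  show ?thesis
    unfolding eval_path_superpotential[of _ n X', OF inv(4)[OF w(1)] inv(1)[unfolded w(2)] X]
      eval_path_superpotential[of _ n "commutation_coords (length u) X'", OF w X0]
    using path_sum_commute[of u r t v X', OF w(1) rt' X refl] level_sum_commute[where u = u and X' = X' and r = r and t = t and v = v, OF _ refl] rt'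
    by (intro sum.cong) (auto simp del: append_Cons)
qed

lemma eval_path_superpotential_braid:
  assumes w: "ascending (u @ [r, t, r] @ v)" "word_perm (u @ [r, t, r] @ v) = longest_perm n"
    and rt: "t = r + 1 \<or> r = t + 1" and X: "\<And>F. X' F \<noteq> 0" "1 + X' (After (length u)) \<noteq> 0"
  shows "laurent_eval (path_superpotential n (u @ [t, r, t] @ v)) X' =
    laurent_eval (path_superpotential n (u @ [r, t, r] @ v))
      (braid_coords (u @ [r, t, r] @ v) (u @ [t, r, t] @ v) (length u) X')"
proof -
  let ?X = "braid_coords (u @ [r, t, r] @ v) (u @ [t, r, t] @ v) (length u) X'"
  have rt': "t = Suc r \<or> r = Suc t" using rt by simp
  then have neq: "r \<noteq> t" by auto
  note inv = move_invariants[OF move.braid[OF rt', of u v]]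
  note rel = braid_related_braid_coords[of r t u v X', OF neq]
  have X0: "?X F \<noteq> 0" for F using braid_related_nonzero(1)[OF rel X] .
  show ?thesis
    unfolding eval_path_superpotential[of _ n X', OF inv(4)[OF w(1)] inv(1)[unfolded w(2)] X(1)]
      eval_path_superpotential[of _ n ?X, OF w X0]
    using path_sum_braid[OF w(1) rt' rel X] level_sum_braid[OF neq rel X]
    by (intro sum.cong) (auto simp del: append_Cons)
qed

text \<open>Independence of the chosen moves: every derivation leads to the path sum. The
  permutation and the ascending property are carried along because the invariance of path sums
  depends on them.\<close>

lemma superpotential_via_imp:
  assumes "superpotential_via n w W"
  shows "ascending w \<and> word_perm w = longest_perm n \<and> W = path_superpotential n w"
  using assms
proof induction
  case initial
  then show ?case
    by (simp add: initial_superpotential_eq ascending_initial_word word_perm_initial_word)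
next
  case (commutation u r t v W W')
  have w: "ascending (u @ [r, t] @ v)" "word_perm (u @ [r, t] @ v) = longest_perm n"
    and W: "W = path_superpotential n (u @ [r, t] @ v)"
    using commutation.IH by auto
  have rt': "Suc r < t \<or> Suc t < r" using commutation.hyps(2) by simp
  note inv = move_invariants[OF move.commute[OF rt', of u v]]
  have "W' = path_superpotential n (u @ [t, r] @ v)"
    by (rule laurent_eqI)
      (simp only: commutation.hyps(3) W eval_path_superpotential_commute[OF w commutation.hyps(2)] simp_thms)
  then show ?case using inv w by simp
next
  case (braid u r t v W W')
  have w: "ascending (u @ [r, t, r] @ v)" "word_perm (u @ [r, t, r] @ v) = longest_perm n"
    and W: "W = path_superpotential n (u @ [r, t, r] @ v)"
    using braid.IH by auto
  have rt': "t = Suc r \<or> r = Suc t" using braid.hyps(2) by simp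
  note inv = move_invariants[OF move.braid[OF rt', of u v]]
  have "W' = path_superpotential n (u @ [t, r, t] @ v)"
  proof (rule laurent_eqI)
    fix X' :: "face \<Rightarrow> complex"
    assume X: "\<And>F. X' F \<noteq> 0" "1 + X' (After (length u)) \<noteq> 0"
    then show "laurent_eval W' X' = laurent_eval (path_superpotential n (u @ [t, r, t] @ v)) X'"
      using braid.hyps(3)[of X'] eval_path_superpotential_braid[of u r t v n X', OF w braid.hyps(2) X] W by simp
  qed
  then show ?case using inv w by simp
qed

text \<open>The existence half: the path sum satisfies the pointwise rules along any chain of moves
  from the initial word. Together with the previous uniqueness it makes the definite description in
  \<open>superpotential\<close> meaningful.\<close>

lemma superpotential_via_path_superpotential:
  assumes "set w \<subseteq> {1..<n}" "ascending w" "word_perm w = longest_perm n"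
  shows "superpotential_via n w (path_superpotential n w)"
proof -
  have "move\<^sup>*\<^sup>* (initial_word n) w"
    using assms set_initial_word ascending_initial_word word_perm_initial_word
    by (intro ascending_words_connected) auto
  then show ?thesis
  proof (induction rule: rtranclp_induct)
    case base
    then show ?case using superpotential_via.initial[of n] by (simp add: initial_superpotential_eq)
  next
    case (step w w')
    have w: "ascending w" "word_perm w = longest_perm n"
      using superpotential_via_imp[OF step.IH] by auto
    from step.hyps(2) show ?case
    proof cases
      case (commute r t u v)
      then show ?thesis
        using superpotential_via.commutation[of n u r t v "path_superpotential n w" "path_superpotential n w'"]
          eval_path_superpotential_commute[of u r t v n] step.IH w by simp
    next
      case (braid t r u v)
      then show ?thesis
        using superpotential_via.braid[of n u r t v "path_superpotential n w" "path_superpotential n w'"]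
          eval_path_superpotential_braid[of u r t v n] step.IH w by simp
    qed
  qed
qed

lemma superpotential_eq:
  assumes "set w \<subseteq> {1..<n}" "ascending w" "word_perm w = longest_perm n"
  shows "superpotential n w = path_superpotential n w"
  unfolding superpotential_def
  by (rule the_equality) (use superpotential_via_path_superpotential[OF assms] superpotential_via_imp in blast)+


section \<open>Restriction and extension of GP-paths\<close>

text \<open>GP-paths without reference to \<open>n\<close>, as needed for inductions over words. The
  bounds on \<open>p\<close> and \<open>q\<close> are implied by the heights, since letters below
  \<open>n\<close> fix all lines outside {1..n}.\<close>

definition gp_path :: "nat list \<Rightarrow> nat \<Rightarrow> piece list \<Rightarrow> bool" where
  "gp_path w i ps \<longleftrightarrow> (\<exists>p q. ps \<in> paths w i p q \<and> p \<le> i \<and> i < q \<and>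
     end_height w p \<in> {end_height w (Suc i)..end_height w i} \<and>
     end_height w q \<in> {end_height w (Suc i)..end_height w i})"

lemma end_height_outside:
  assumes "set w \<subseteq> {1..<n}" "a \<notin> {1..n}"
  shows "end_height w a = a"
  using permutes_not_in[OF word_perm_permutes[OF assms(1)] assms(2)] by (simp add: end_height_iff)

lemma end_height_inside:
  assumes "set w \<subseteq> {1..<n}" "a \<in> {1..n}"
  shows "end_height w a \<in> {1..n}"
proof (rule ccontr)
  assume "end_height w a \<notin> {1..n}"
  then have "word_perm w (end_height w a) = end_height w a"
    by (rule permutes_not_in[OF word_perm_permutes[OF assms(1)]])
  then show False using assms(2) \<open>end_height w a \<notin> {1..n}\<close> by simp
qed

lemma gp_paths_iff:
  assumes w: "set w \<subseteq> {1..<n}"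
  shows "(i, ps) \<in> gp_paths n w \<longleftrightarrow> i \<in> {1..<n} \<and> gp_path w i ps"
proof
  assume "(i, ps) \<in> gp_paths n w"
  then show "i \<in> {1..<n} \<and> gp_path w i ps"
    by (auto simp: gp_paths_def gp_path_def paths_def)
next
  assume R: "i \<in> {1..<n} \<and> gp_path w i ps"
  then obtain p q where pq: "ps \<in> paths w i p q" "p \<le> i" "i < q"
     "end_height w p \<in> {end_height w (Suc i)..end_height w i}"
     "end_height w q \<in> {end_height w (Suc i)..end_height w i}"
    by (auto simp: gp_path_def)
  have h: "end_height w i \<in> {1..n}" "end_height w (Suc i) \<in> {1..n}"
    using R by (auto intro!: end_height_inside[OF w, simplified])
  have "1 \<le> p"
    using pq h end_height_outside[OF w, of 0] by (cases p) auto
  moreover have "q \<le> n"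
    using pq h end_height_outside[OF w, of q] by (cases "q \<le> n") auto
  ultimately show "(i, ps) \<in> gp_paths n w"
    using R pq by (auto simp: gp_paths_def paths_def)
qed

text \<open>A crossing interchanges neighbouring heights, so the position relative to any third line
  is unaffected, even when one crossing line is replaced by the other.\<close>

lemma height_comparison_snoc:
  fixes w :: "nat list" and r :: nat
  defines "A \<equiv> word_perm w r" and "B \<equiv> word_perm w (Suc r)"
  assumes "x = x' \<or> {x, x'} \<subseteq> {A, B}" "y = y' \<or> {y, y'} \<subseteq> {A, B}" "\<not> {x, y} \<subseteq> {A, B}"
  shows "end_height (w @ [r]) x \<le> end_height (w @ [r]) y \<longleftrightarrow> end_height w x' \<le> end_height w y'"
proof -
  let ?h' = "end_height (w @ [r])"
  let ?h = "end_height w"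
  have h: "?h A = r" "?h B = Suc r" "?h' A = Suc r" "?h' B = r"
    by (simp_all add: A_def B_def end_height_snoc)
  have out: "?h' z = ?h z \<and> (?h z < r \<or> Suc r < ?h z)"
    if "z \<notin> {A, B}" for z
  proof -
    have "?h z \<noteq> r" "?h z \<noteq> Suc r"
      using that by (auto simp: end_height_iff A_def B_def)
    then show ?thesis using that by (auto simp: end_height_snoc_cases A_def B_def)
  qed
  consider "x \<notin> {A, B}" "y \<notin> {A, B}" | "x \<in> {A, B}" "y \<notin> {A, B}" | "x \<notin> {A, B}" "y \<in> {A, B}"
    using assms(5) by blast
  then show ?thesis
  proof cases
    case 1
    then have "x' = x" "y' = y" using assms(3,4) by auto
    then show ?thesis using out[OF 1(1)] out[OF 1(2)] by simp
  next
    case 2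
    then have "y' = y" "x' \<in> {A, B}" using assms(3,4) by auto
    then have "?h x' \<in> {r, Suc r}" "?h' x \<in> {r, Suc r}"
      using 2(1) h by auto
    then show ?thesis using out[OF 2(2)] \<open>y' = y\<close> by auto
  next
    case 3
    then have "x' = x" "y' \<in> {A, B}" using assms(3,4) by auto
    then have "?h y' \<in> {r, Suc r}" "?h' y \<in> {r, Suc r}"
      using 3(2) h by auto
    then show ?thesis using out[OF 3(1)] \<open>x' = x\<close> by auto
  qed
qed

text \<open>Comparisons that do not involve both crossing lines carry over. The remaining ones
  concern \<open>i\<close> or i + 1 crossing an end of the path; they either hold anyway or
  contradict the descent of the component.\<close>

lemma gp_path_snoc_restrict:
  assumes asc: "ascending (w @ [r])" and gp: "gp_path (w @ [r]) i ps"
  shows "\<exists>C. (\<forall>\<rho>\<in>set C. gp_path w i \<rho>) \<and>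
    (\<forall>c\<le>length w. \<forall>t. winding (w @ [r]) i ps c t = (\<Sum>\<rho>\<leftarrow>C. winding w i \<rho> c t))"
proof -
  let ?h' = "end_height (w @ [r])"
  let ?h = "end_height w"
  define A where "A = word_perm w r"
  define B where "B = word_perm w (Suc r)"
  have asc': "ascending w" "A < B" using asc by (auto simp: ascending_snoc A_def B_def)
  obtain p q where ps: "ps \<in> paths (w @ [r]) i p q" and pq: "p \<le> i" "i < q"
    and p: "?h' (Suc i) \<le> ?h' p" "?h' p \<le> ?h' i"
    and q: "?h' (Suc i) \<le> ?h' q" "?h' q \<le> ?h' i"
    using gp by (auto simp: gp_path_def)
  note cmp = height_comparison_snoc[where w = w and r = r, folded A_def B_def]
  have hAB: "?h A = r" "?h B = Suc r" by (simp_all add: A_def B_def)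
  from asc ps pq A_def B_def refl show ?thesis
  proof (cases rule: paths_snoc_cases)
    case turn
    then show ?thesis by (intro exI[of _ "[]"]) (simp add: winding_Cons)
  next
    case c: (single p2 q2 \<pi>)
    have desc: "?h q2 < ?h p2"
      by (rule path_descends[OF asc'(1) c(5,1,2)])
    have p2: "p2 = p \<or> B \<le> i \<and> (p = A \<and> p2 = B \<or> p = B \<and> p2 = A)"
      using c(1,3) pq asc'(2) by (auto simp: link_def doubleton_eq_iff split: if_splits)
    have q2: "q2 = q \<or> i < A \<and> (q = A \<and> q2 = B \<or> q = B \<and> q2 = A)"
      using c(2,4) pq asc'(2) by (auto simp: link_def doubleton_eq_iff split: if_splits)
    have p2': "p = p2 \<or> {p, p2} \<subseteq> {A, B}" and q2': "q = q2 \<or> {q, q2} \<subseteq> {A, B}"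
      using p2 q2 by auto
    have "?h (Suc i) \<le> ?h p2"
    proof (cases "{Suc i, p} \<subseteq> {A, B}")
      case False
      then show ?thesis using p(1) cmp[of "Suc i" "Suc i" p p2] p2' by simp
    next
      case True
      \<comment> \<open>Contradictory configuration: the component starts at height
        \<open>r\<close>, so \<open>q\<close> would have to end below \<open>r\<close>, whereas the
        height condition puts it above \<open>B\<close>, which is at height
        \<open>Suc r\<close>.\<close>
      then have *: "Suc i = B" "p = A" "p2 = A" using pq asc'(2) p2 by auto
      then have "q \<notin> {A, B}" "q2 = q" using desc hAB pq q2 by auto
      then show ?thesis using q(1) cmp[of "Suc i" B q q] desc hAB * by auto
    qed
    moreover have "?h p2 \<le> ?h i"
    proof (cases "{p, i} \<subseteq> {A, B}")
      case False
      then show ?thesis using p(2) cmp[of p p2 i i] p2' by simp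
    next
      case True
      then have "i = B \<and> p2 \<in> {A, B} \<or> i = p2" using pq asc'(2) p2 by auto
      then show ?thesis using hAB by auto
    qed
    moreover have "?h (Suc i) \<le> ?h q2"
    proof (cases "{Suc i, q} \<subseteq> {A, B}")
      case False
      then show ?thesis using q(1) cmp[of "Suc i" "Suc i" q q2] q2' by simp
    next
      case True
      then have "Suc i = A \<and> q2 \<in> {A, B} \<or> Suc i = q2" using pq asc'(2) q2 by auto
      then show ?thesis using hAB by auto
    qed
    moreover have "?h q2 \<le> ?h i"
    proof (cases "{q, i} \<subseteq> {A, B}")
      case False
      then show ?thesis using q(2) cmp[of q q2 i i] q2' by simp
    next
      case True
      \<comment> \<open>The mirror image: \<open>p\<close> would have to start above
        \<open>B\<close> and yet not above \<open>A\<close>.\<close>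
      then have *: "i = A" "q = B" "q2 = B" using pq asc'(2) q2 by auto
      then have "p \<notin> {A, B}" "p2 = p" using desc hAB pq p2 by auto
      then show ?thesis using p(2) cmp[of p p i A] desc hAB * by auto
    qed
    ultimately have "gp_path w i \<pi>" using c by (auto simp: gp_path_def)
    then show ?thesis using c by (intro exI[of _ "[\<pi>]"]) (simp add: winding_Cons winding_snoc_word)
  next
    case c: (double \<rho> \<rho>')
    have d: "?h B < ?h p" "?h q < ?h A"
      using c path_descends[of w \<rho> i p B] path_descends[of w \<rho>' i A q] asc' pq by auto
    have "p \<noteq> B" "q \<noteq> A" using c pq by auto
    have ne: "p \<notin> {A, B}" "q \<notin> {A, B}" using c(3,4) \<open>p \<noteq> B\<close> \<open>q \<noteq> A\<close> by auto
    have "?h p \<le> ?h i"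
      using p(2) cmp[of p p i i] ne by simp
    moreover have "?h (Suc i) \<le> ?h q"
      using q(1) cmp[of "Suc i" "Suc i" q q] ne by simp
    \<comment> \<open>The new ends \<open>A\<close> and \<open>B\<close> lie between
      \<open>q\<close> and \<open>p\<close>, hence in the admissible interval as well.\<close>
    ultimately have "?h (Suc i) \<le> ?h A" "?h B \<le> ?h i"
      "?h p \<le> ?h i" "?h (Suc i) \<le> ?h q"
      using d by linarith+
    note bounds = this
    have "gp_path w i \<rho>"
      unfolding gp_path_def using bounds c(2,5) pq d hAB
      by (intro exI[of _ p] exI[of _ B]) auto
    moreover have "gp_path w i \<rho>'"
      unfolding gp_path_def using bounds c(1,6) pq d hAB
      by (intro exI[of _ A] exI[of _ q]) auto
    ultimately show ?thesis
      using c by (intro exI[of _ "[\<rho>, \<rho>']"]) (simp add: winding_Cons winding_snoc_word)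
  qed
qed

text \<open>Each removed crossing may split every component again; the components are collected in
  one list, and winding numbers in the remaining columns add up.\<close>

lemma gp_path_restrict:
  assumes "ascending (w @ v)" "gp_path (w @ v) i ps"
  shows "\<exists>C. (\<forall>\<rho>\<in>set C. gp_path w i \<rho>) \<and>
    (\<forall>c\<le>length w. \<forall>t. winding (w @ v) i ps c t = (\<Sum>\<rho>\<leftarrow>C. winding w i \<rho> c t))"
  using assms
proof (induction v arbitrary: ps rule: rev_induct)
  case Nil
  then show ?case by (intro exI[of _ "[ps]"]) simp
next
  case (snoc r v)
  have asc: "ascending ((w @ v) @ [r])" "gp_path ((w @ v) @ [r]) i ps" using snoc.prems by simp_all
  have ascv: "ascending (w @ v)" using asc(1) unfolding ascending_snoc by blast
  obtain C where C: "\<forall>\<rho>\<in>set C. gp_path (w @ v) i \<rho>"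
    "\<forall>c\<le>length (w @ v). \<forall>t. winding ((w @ v) @ [r]) i ps c t = (\<Sum>\<rho>\<leftarrow>C. winding (w @ v) i \<rho> c t)"
    using gp_path_snoc_restrict[OF asc] by blast
  have "\<forall>\<rho>\<in>set C. \<exists>D. (\<forall>\<tau>\<in>set D. gp_path w i \<tau>) \<and>
    (\<forall>c\<le>length w. \<forall>t. winding (w @ v) i \<rho> c t = (\<Sum>\<tau>\<leftarrow>D. winding w i \<tau> c t))"
    using snoc.IH[OF ascv] C(1) by blast
  then obtain D where D: "\<forall>\<rho>\<in>set C. (\<forall>\<tau>\<in>set (D \<rho>). gp_path w i \<tau>) \<and>
    (\<forall>c\<le>length w. \<forall>t. winding (w @ v) i \<rho> c t = (\<Sum>\<tau>\<leftarrow>D \<rho>. winding w i \<tau> c t))"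
    by metis
  have "winding ((w @ v) @ [r]) i ps c t = (\<Sum>\<tau>\<leftarrow>concat (map D C). winding w i \<tau> c t)" if "c \<le> length w" for c t
  proof -
    have "winding ((w @ v) @ [r]) i ps c t = (\<Sum>\<rho>\<leftarrow>C. winding (w @ v) i \<rho> c t)"
      using C(2) that by simp
    also have "\<dots> = (\<Sum>\<rho>\<leftarrow>C. \<Sum>\<tau>\<leftarrow>D \<rho>. winding w i \<tau> c t)"
      using D that by (intro arg_cong[of _ _ sum_list] map_cong) auto
    also have "\<dots> = (\<Sum>\<tau>\<leftarrow>concat (map D C). winding w i \<tau> c t)"
      by (induction C) simp_all
    finally show ?thesis .
  qed
  moreover have "\<forall>\<tau>\<in>set (concat (map D C)). gp_path w i \<tau>" using D by auto
  ultimately show ?case by (intro exI[of _ "concat (map D C)"]) simp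
qed

lemma gp_path_snoc_extend:
  assumes asc: "ascending (w @ [r])" and gp: "gp_path w i \<pi>"
  shows "\<exists>ps. gp_path (w @ [r]) i ps \<and> (\<forall>c\<le>length w. \<forall>t. winding (w @ [r]) i ps c t = winding w i \<pi> c t)"
proof -
  let ?h' = "end_height (w @ [r])"
  let ?h = "end_height w"
  define A where "A = word_perm w r"
  define B where "B = word_perm w (Suc r)"
  define K where "K = Suc (length w)"
  have AB: "A < B" using asc by (auto simp: ascending_snoc A_def B_def)
  obtain p q where \<pi>: "\<pi> \<in> paths w i p q" and pq: "p \<le> i" "i < q"
    and p: "?h (Suc i) \<le> ?h p" "?h p \<le> ?h i"
    and q: "?h (Suc i) \<le> ?h q" "?h q \<le> ?h i"
    using gp by (auto simp: gp_path_def)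
  \<comment> \<open>A path is extended along its own lines unless this is forbidden: the smaller of
    two left-oriented lines, or the larger of two right-oriented ones, may not pass straight. In
    these cases the extension turns into the other line at the crossing.\<close>
  define p' where "p' = (if B \<le> i \<and> p = A then B else p)"
  define q' where "q' = (if i < A \<and> q = B then A else q)"
  have l: "p' \<le> i" "i < q'" "link i A B p' p" "link i A B q q'"
    using pq AB by (auto simp: p'_def q'_def link_def)
  have h: "?h' (Suc i) \<le> ?h' p' \<and> ?h' p' \<le> ?h' i \<and>
      ?h' (Suc i) \<le> ?h' q' \<and> ?h' q' \<le> ?h' i"
  proof -
    note cmp = height_comparison_snoc[where w = w and r = r, folded A_def B_def]
    have hAB: "?h' A = Suc r" "?h' B = r"
      by (simp_all add: A_def B_def end_height_snoc)
    have p2: "p' = p \<or> {p', p} \<subseteq> {A, B}" and q2: "q' = q \<or> {q', q} \<subseteq> {A, B}"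
      by (auto simp: p'_def q'_def)
    have "?h' (Suc i) \<le> ?h' p'"
    proof (cases "{Suc i, p'} \<subseteq> {A, B}")
      case False
      then show ?thesis using p(1) cmp[of "Suc i" "Suc i" p' p] p2 by simp
    next
      case True
      then have "Suc i = B" "p' = A" using AB l(1) by auto
      then show ?thesis using hAB by simp
    qed
    moreover have "?h' p' \<le> ?h' i"
    proof (cases "{p', i} \<subseteq> {A, B}")
      case False
      then show ?thesis using p(2) cmp[of p' p i i] p2 by simp
    next
      case True
      then have "i = p'" using AB pq l(1) by (auto simp: p'_def split: if_splits)
      then show ?thesis by simp
    qed
    moreover have "?h' (Suc i) \<le> ?h' q'"
    proof (cases "{Suc i, q'} \<subseteq> {A, B}")
      case False
      then show ?thesis using q(1) cmp[of "Suc i" "Suc i" q' q] q2 by simp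
    next
      case True
      then have "Suc i = q'" using AB pq l(2) by (auto simp: q'_def split: if_splits)
      then show ?thesis by simp
    qed
    moreover have "?h' q' \<le> ?h' i"
    proof (cases "{q', i} \<subseteq> {A, B}")
      case False
      then show ?thesis using q(2) cmp[of q' q i i] q2 by simp
    next
      case True
      then have "i = A" "q' = B" using AB l(2) by auto
      then show ?thesis using hAB by simp
    qed
    ultimately show ?thesis by blast
  qed
  have "(K, p') # \<pi> @ [(K, q')] \<in> paths (w @ [r]) i p' q'"
    using paths_snoc_single[OF AB[unfolded A_def B_def] pq l(1,2) l(3,4)[unfolded A_def B_def] \<pi>]
    unfolding K_def .
  moreover have "winding (w @ [r]) i ((K, p') # \<pi> @ [(K, q')]) c t = winding w i \<pi> c t" if "c \<le> length w" for c t
    using that by (simp add: K_def winding_Cons winding_snoc_word)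
  ultimately show ?thesis
    using l h unfolding gp_path_def by (intro exI[of _ "(K, p') # \<pi> @ [(K, q')]"]) auto
qed

lemma gp_path_extend:
  assumes "ascending (w @ v)" "gp_path w i \<pi>"
  shows "\<exists>ps. gp_path (w @ v) i ps \<and> (\<forall>c\<le>length w. \<forall>t. winding (w @ v) i ps c t = winding w i \<pi> c t)"
  using assms(1)
proof (induction v rule: rev_induct)
  case Nil
  then show ?case using assms(2) by auto
next
  case (snoc r v)
  have asc: "ascending ((w @ v) @ [r])" using snoc.prems by simp
  then have "ascending (w @ v)" unfolding ascending_snoc by blast
  then obtain ps where ps: "gp_path (w @ v) i ps"
    "\<forall>c\<le>length w. \<forall>t. winding (w @ v) i ps c t = winding w i \<pi> c t"
    using snoc.IH by blast
  obtain ps' where "gp_path ((w @ v) @ [r]) i ps'"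
    "\<forall>c\<le>length (w @ v). \<forall>t. winding ((w @ v) @ [r]) i ps' c t = winding (w @ v) i ps c t"
    using gp_path_snoc_extend[OF asc ps(1)] by blast
  then show ?case using ps(2) by (intro exI[of _ ps']) simp
qed

section \<open>A GP-path around the last face of a level\<close>

lemma height_above_preserved:
  "m \<notin> set z \<Longrightarrow> m < end_height (x @ z) a \<longleftrightarrow> m < end_height x a"
proof (induction z rule: rev_induct)
  case (snoc r z)
  have "end_height (x @ z @ [r]) a = adj_swap r (end_height (x @ z) a)"
    using end_height_snoc[of "x @ z" r a] by simp
  then show ?case using snoc by (auto simp: transpose_def)
qed simp

text \<open>The last face at a level is bounded by the GP-path running along its boundary.\<close>

lemma last_face_gp_path:
  assumes w: "set (y @ [m] @ z) \<subseteq> {1..<n}" "ascending (y @ [m] @ z)" "word_perm (y @ [m] @ z) = longest_perm n"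
    and m: "m \<notin> set z"
  shows "\<exists>ps. gp_path (y @ [m] @ z) (n - m) ps \<and>
    (\<forall>c<length (y @ [m] @ z). winding (y @ [m] @ z) (n - m) ps (Suc c) ((y @ [m] @ z) ! c) = of_bool (c = length y))"
proof -
  let ?w = "y @ [m] @ z"
  let ?i = "n - m"
  have m1: "1 \<le> m" "m < n" using w(1) by auto
  have split: "word_perm x (Suc m) \<le> ?i \<and> ?i < word_perm x m \<and> (h \<in> {1..n} \<longrightarrow> (word_perm x h \<le> ?i \<longleftrightarrow> m < h))"
    if "x @ z' = y @ [m] @ z" "m \<notin> set z'" for x z' h
  proof -
    have x: "set x \<subseteq> {1..<n}" using w(1) that(1) by (metis Un_subset_iff set_append)
    have "word_perm x h \<le> ?i \<longleftrightarrow> m < h" if "h \<in> {1..n}" for h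
    proof -
      have r: "word_perm x h \<in> {1..n}"
        using permutes_in_image[OF word_perm_permutes[OF x]] that by blast
      have "m < end_height (x @ z') (word_perm x h) \<longleftrightarrow> m < h"
        using height_above_preserved[OF \<open>m \<notin> set z'\<close>, of x "word_perm x h"] by simp
      then show ?thesis
        unfolding \<open>x @ z' = _\<close> end_height_longest[OF w(3)] using r m1 by auto
    qed
    from this[of "Suc m"] this[of m] this[of h] show ?thesis using m1 by auto
  qed
  have "\<exists>ps. ps \<in> paths x ?i (word_perm x (Suc m)) (word_perm x m) \<and>
     (\<forall>c<length x. winding x ?i ps (Suc c) (x ! c) = of_bool (c = length y))"
    if "x = y @ [m] @ z1" "z = z1 @ z2" for x z1 z2
    using that
  proof (induction z1 arbitrary: x z2 rule: rev_induct)
    case Nil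
    let ?A = "word_perm y m" and ?B = "word_perm y (Suc m)" and ?K = "Suc (length y)"
    have asc: "ascending (y @ [m])" using w(2) by (simp add: ascending_append)
    then have AB: "?A < ?B" by (simp add: ascending_snoc)
    have AB': "word_perm x (Suc m) = ?A" "word_perm x m = ?B"
      using Nil by (simp_all add: word_perm_snoc)
    have i: "?A \<le> ?i" "?i < ?B"
      using split[of x z2] Nil m AB' by auto
    have p: "[(?K, ?A), (?K, ?B)] \<in> paths (y @ [m]) ?i ?A ?B"
      by (rule paths_snoc_turn[OF AB i])
    have W: "winding (y @ [m]) ?i [(?K, ?A), (?K, ?B)] (Suc c) ((y @ [m]) ! c) = of_bool (c = length y)"
      if "c < length (y @ [m])" for c
    proof (cases "c = length y")
      case True
      then show ?thesis
        using winding_snoc_last[OF asc p i, of m] by (simp add: end_height_snoc)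
    qed (simp add: winding_Cons)
    show ?case
      unfolding AB' unfolding Nil(1) append_Nil2
      by (intro exI[of _ "[(?K, ?A), (?K, ?B)]"] conjI allI impI p W)
  next
    case (snoc r z1)
    define x1 where "x1 = y @ [m] @ z1"
    have x: "x = x1 @ [r]" using snoc.prems by (simp add: x1_def)
    obtain \<rho> where \<rho>: "\<rho> \<in> paths x1 ?i (word_perm x1 (Suc m)) (word_perm x1 m)"
      "\<forall>c<length x1. winding x1 ?i \<rho> (Suc c) (x1 ! c) = of_bool (c = length y)"
      using snoc.IH[of x1 "r # z2"] snoc.prems by (auto simp: x1_def)
    have r: "r \<noteq> m" "r \<in> {1..<n}" using m snoc.prems w(1) by auto
    have eq1: "x1 @ (r # z2) = y @ [m] @ z" "x @ z2 = y @ [m] @ z" using snoc.prems by (simp_all add: x1_def)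
    have asc: "ascending (x1 @ [r])"
      using w(2) eq1(2) unfolding x by (metis ascending_append)
    let ?A = "word_perm x1 r" and ?B = "word_perm x1 (Suc r)" and ?K = "Suc (length x1)"
    let ?p = "word_perm x (Suc m)" and ?q = "word_perm x m"
    have AB: "?A < ?B" using asc by (simp add: ascending_snoc)
    have z2: "m \<notin> set (r # z2)" "m \<notin> set z2" using m snoc.prems by auto
    have s1: "word_perm x1 (Suc m) \<le> ?i" "?i < word_perm x1 m" "\<And>h. h \<in> {1..n} \<Longrightarrow> word_perm x1 h \<le> ?i \<longleftrightarrow> m < h"
      using split[OF eq1(1) z2(1)] by auto
    have s2: "?p \<le> ?i" "?i < ?q" using split[OF eq1(2) z2(2)] by auto
    \<comment> \<open>The path stays at heights m + 1 and m: at a crossing of level m + 1 its upper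
      part turns, at a crossing of level m - 1 its lower part does, and all other crossings are
      bypassed.\<close>
    have lp: "link ?i ?A ?B ?p (word_perm x1 (Suc m))"
    proof (cases "r = Suc m")
      case True
      then show ?thesis unfolding x word_perm_snoc by (auto simp: link_def)
    next
      case False
      then have "?p = word_perm x1 (Suc m)" using r unfolding x word_perm_snoc by (simp add: transpose_def)
      then show ?thesis using False r by (auto simp: link_def)
    qed
    have lq: "link ?i ?A ?B (word_perm x1 m) ?q"
    proof (cases "m = Suc r")
      case True
      then show ?thesis unfolding x word_perm_snoc by (auto simp: link_def)
    next
      case False
      then have "?q = word_perm x1 m" using r unfolding x word_perm_snoc by (simp add: transpose_def)
      then show ?thesis using False r by (auto simp: link_def)
    qed
    let ?ps = "(?K, ?p) # \<rho> @ [(?K, ?q)]"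
    have ps: "?ps \<in> paths x ?i ?p ?q"
      using paths_snoc_single[OF AB s1(1,2) s2 lp lq \<rho>(1)] unfolding x .
    have "winding x ?i ?ps (Suc c) (x ! c) = of_bool (c = length y)" if "c < length x" for c
    proof (cases "c = length x1")
      case True
      have "c \<noteq> length y" using True by (simp add: x1_def)
      \<comment> \<open>The two ends are at heights m + 1 and m, and no level \<open>r\<close> other
        than \<open>m\<close> separates them.\<close>
      moreover have "winding x ?i ?ps (Suc c) r = 0"
        using winding_snoc_last[of x1 r ?ps ?i ?p ?q r] asc ps s2 r True unfolding x by auto
      ultimately show ?thesis using True x by simp
    next
      case False
      then have c: "c < length x1" using that x by simp
      then show ?thesis
        using \<rho>(2) unfolding x by (simp add: winding_Cons winding_snoc_word nth_append)
    qed
    then show ?case using ps by blast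
  qed
  from this[of "y @ [m] @ z" z "[]"] obtain ps where ps:
    "ps \<in> paths ?w ?i (word_perm ?w (Suc m)) (word_perm ?w m)"
    "\<forall>c<length ?w. winding ?w ?i ps (Suc c) (?w ! c) = of_bool (c = length y)"
    by auto
  have "word_perm ?w (Suc m) = ?i" "word_perm ?w m = Suc ?i"
    using m1 unfolding w(3) by (auto simp: longest_perm_def)
  then have "gp_path ?w ?i ps"
    using ps(1) m1 unfolding gp_path_def
    by (intro exI[of _ ?i] exI[of _ "Suc ?i"]) (auto simp: end_height_longest[OF w(3)] simp del: append_Cons)
  then show ?thesis using ps(2) by blast
qed


section \<open>The cone of the restricted superpotential\<close>

lemma sum_faces:
  "(\<Sum>F\<in>faces n w. f F) = (\<Sum>r\<in>{1..<n}. f (Initial r)) + (\<Sum>c<length w. f (After c))"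
  unfolding faces_def by (subst sum.union_disjoint) (auto simp: sum.reindex inj_on_def)

lemma lookup_sum_e_face:
  "finite S \<Longrightarrow> lookup (\<Sum>F\<in>S. e_face F) G = of_bool (G \<in> S)"
  by (simp add: lookup_sum lookup_single when_def)

lemma lookup_path_vector:
  assumes "set w \<subseteq> {1..<n}" "ascending w" "gp_path w i ps" "F \<in> faces n w"
  shows "lookup (path_vector n w i ps) F =
    (case F of Initial _ \<Rightarrow> 0 | After c \<Rightarrow> - winding w i ps (Suc c) (w ! c))"
proof -
  obtain p q where pq: "ps \<in> paths w i p q" "p \<le> i" "i < q"
    using assms(3) by (auto simp: gp_path_def)
  have "finite (enclosed_faces n w i ps)"
    unfolding enclosed_faces_def using finite_faces by simp
  then have l: "lookup (path_vector n w i ps) F = - of_bool (path_winding w i ps F > 0)"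
    unfolding path_vector_def using assms(4) by (simp add: lookup_sum_e_face enclosed_faces_def)
  show ?thesis
  proof (cases F)
    case (Initial r)
    then show ?thesis
      unfolding l using winding_column_0[OF assms(2) pq]
      by (simp add: path_winding_eq face_column_def)
  next
    case (After c)
    then have "Suc c \<le> length w" using assms(4) by (auto simp: faces_def)
    then have "winding w i ps (Suc c) (w ! c) \<in> {0, 1}"
      by (rule winding_range[OF assms(2) pq])
    then show ?thesis
      using l unfolding After by (auto simp: path_winding_eq face_column_def face_level_def)
  qed
qed

lemma pairing_path_vector:
  assumes "set (w @ v) \<subseteq> {1..<n}" "ascending (w @ v)" "gp_path (w @ v) i ps"
  shows "pairing (restrict_exponent (faces n w) (path_vector n (w @ v) i ps)) x =
    - (\<Sum>c<length w. of_int (winding (w @ v) i ps (Suc c) (w ! c)) * x (After c))"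
proof -
  have sub: "faces n w \<subseteq> faces n (w @ v)" by (auto simp: faces_def)
  have "pairing (restrict_exponent (faces n w) (path_vector n (w @ v) i ps)) x =
      (\<Sum>F\<in>faces n w. of_int (lookup (path_vector n (w @ v) i ps) F) * x F)"
    by (rule pairing_restrict_exponent[OF finite_faces])
  also have "\<dots> = (\<Sum>F\<in>faces n w. of_int (case F of Initial _ \<Rightarrow> 0
      | After c \<Rightarrow> - winding (w @ v) i ps (Suc c) ((w @ v) ! c)) * x F)"
    using lookup_path_vector[OF assms] sub by (intro sum.cong) auto
  also have "\<dots> = - (\<Sum>c<length w. of_int (winding (w @ v) i ps (Suc c) (w ! c)) * x (After c))"
    unfolding sum_faces by (simp add: nth_append sum_negf)
  finally show ?thesis .
qed

lemma level_crossings_append: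
  "\<exists>cs. level_crossings (w @ v) i = level_crossings w i @ cs \<and> (\<forall>c\<in>set cs. length w \<le> c)"
proof (induction v rule: rev_induct)
  case (snoc r v)
  then obtain cs where "level_crossings (w @ v) i = level_crossings w i @ cs" "\<forall>c\<in>set cs. length w \<le> c"
    by blast
  then show ?case
    using level_crossings_snoc[of "w @ v" r i] by (intro exI[of _ "cs @ (if r = i then [length (w @ v)] else [])"]) auto
qed simp

lemma pairing_level_vector:
  assumes "i \<in> {1..<n}"
  shows "pairing (restrict_exponent (faces n w) (level_vector (w @ v) i k)) x =
    - x (Initial i) - (\<Sum>c\<in>set (take k (level_crossings w i)). x (After c))"
proof -
  let ?S = "set (take k (level_crossings w i))"
  obtain cs where cs: "level_crossings (w @ v) i = level_crossings w i @ cs" "\<forall>c\<in>set cs. length w \<le> c"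
    using level_crossings_append by blast
  have S: "?S \<subseteq> {..<length w}"
    using set_take_subset[of k "level_crossings w i"] by (auto simp: set_level_crossings)
  have S': "c \<in> set (take k (level_crossings (w @ v) i)) \<longleftrightarrow> c \<in> ?S" if "c < length w" for c
  proof -
    have "c \<notin> set (take (k - length (level_crossings w i)) cs)"
      using cs(2) that by (meson in_set_takeD not_le)
    then show ?thesis using cs(1) by simp
  qed
  have "lookup (level_vector (w @ v) i k) F =
      - of_bool (F = Initial i) - of_bool (F \<in> After ` set (take k (level_crossings (w @ v) i)))" for F
  proof -
    have "(\<Sum>c\<in>set (take k (level_crossings (w @ v) i)). e_face (After c)) =
        (\<Sum>F\<in>After ` set (take k (level_crossings (w @ v) i)). e_face F)"
      by (simp add: sum.reindex inj_on_def)
    then show ?thesis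
      unfolding level_vector_def by (simp add: lookup_minus lookup_sum_e_face lookup_single when_def)
  qed
  then have "pairing (restrict_exponent (faces n w) (level_vector (w @ v) i k)) x =
      (\<Sum>F\<in>faces n w. (- of_bool (F = Initial i) -
        of_bool (F \<in> After ` set (take k (level_crossings (w @ v) i)))) * x F)"
    unfolding pairing_restrict_exponent[OF finite_faces] by (intro sum.cong) auto
  also have "\<dots> = (\<Sum>r\<in>{1..<n}. if r = i then - x (Initial r) else 0) +
      (\<Sum>c<length w. if c \<in> ?S then - x (After c) else 0)"
    unfolding sum_faces using S' by (intro arg_cong2[of _ _ _ _ plus] sum.cong) auto
  also have "\<dots> = - x (Initial i) - (\<Sum>c\<in>?S. x (After c))"
    using assms S by (simp add: sum.delta sum.inter_restrict[symmetric] Int_absorb1 sum_negf)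
  finally show ?thesis .
qed

lemma restrict_exponent_faces:
  assumes "keys u \<subseteq> A"
  shows "restrict_exponent A u = u"
  by (rule poly_mapping_eqI) (use assms in \<open>auto simp: lookup_restrict_exponent in_keys_iff\<close>)

lemma keys_path_vector: "keys (path_vector n w i ps) \<subseteq> faces n w"
proof
  fix F assume "F \<in> keys (path_vector n w i ps)"
  moreover have "finite (enclosed_faces n w i ps)"
    unfolding enclosed_faces_def using finite_faces by simp
  ultimately show "F \<in> faces n w"
    by (auto simp: in_keys_iff path_vector_def lookup_sum_e_face enclosed_faces_def)
qed

lemma keys_level_vector:
  assumes "i \<in> {1..<n}"
  shows "keys (level_vector w i k) \<subseteq> faces n w"
proof
  fix F assume F: "F \<in> keys (level_vector w i k)"
  have "(\<Sum>c\<in>set (take k (level_crossings w i)). e_face (After c)) =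
      (\<Sum>F\<in>After ` set (take k (level_crossings w i)). e_face F)"
    by (simp add: sum.reindex inj_on_def)
  then have "F = Initial i \<or> F \<in> After ` set (take k (level_crossings w i))"
    using F unfolding level_vector_def
    by (auto simp: in_keys_iff lookup_minus lookup_sum_e_face lookup_single when_def split: if_splits)
  then show "F \<in> faces n w"
    using assms set_take_subset[of k "level_crossings w i"] by (auto simp: faces_def set_level_crossings)
qed

lemma tropicalization_restricted_superpotential:
  assumes "set w \<subseteq> {1..<n}" "ascending w" "word_perm w = longest_perm n"
  shows "0 \<le> tropicalization (restrict_laurent A (superpotential n w)) x \<longleftrightarrow>
    (\<forall>i\<in>{1..<n}. \<forall>ps. gp_path w i ps \<longrightarrow> 0 \<le> pairing (restrict_exponent A (path_vector n w i ps)) x) \<and>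
    (\<forall>i\<in>{1..<n}. \<forall>k<length (level_crossings w i). 0 \<le> pairing (restrict_exponent A (level_vector w i k)) x)"
proof -
  have keys: "keys (restrict_laurent A (superpotential n w)) =
      restrict_exponent A ` superpotential_exponent n w ` superpotential_terms n w"
    unfolding superpotential_eq[OF assms] path_superpotential_def
    by (rule keys_restrict_laurent_sum[OF finite_superpotential_terms[OF assms(2,3)]])
  have "0 \<le> tropicalization (restrict_laurent A (superpotential n w)) x \<longleftrightarrow>
      (\<forall>j\<in>superpotential_terms n w. 0 \<le> pairing (restrict_exponent A (superpotential_exponent n w j)) x)"
    unfolding tropicalization_nonneg_iff keys by simp
  also have "\<dots> \<longleftrightarrow>
      (\<forall>(i, ps)\<in>gp_paths n w. 0 \<le> pairing (restrict_exponent A (path_vector n w i ps)) x) \<and>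
      (\<forall>(i, k)\<in>(SIGMA i:{1..<n}. {..<length (level_crossings w i)}).
        0 \<le> pairing (restrict_exponent A (level_vector w i k)) x)"
    unfolding superpotential_terms_def superpotential_exponent_def Plus_def ball_Un
    by (simp add: case_prod_unfold)
  also have "\<dots> \<longleftrightarrow>
      (\<forall>i\<in>{1..<n}. \<forall>ps. gp_path w i ps \<longrightarrow> 0 \<le> pairing (restrict_exponent A (path_vector n w i ps)) x) \<and>
      (\<forall>i\<in>{1..<n}. \<forall>k<length (level_crossings w i). 0 \<le> pairing (restrict_exponent A (level_vector w i k)) x)"
    using gp_paths_iff[OF assms(1)] by fastforce
  finally show ?thesis .
qed

text \<open>The two cones of path inequalities coincide for different reasons: an extended path has
  the same restricted exponent, whereas a restricted one gives a sum of exponents of GP-paths of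
  \<open>w\<close>.\<close>

lemma path_inequalities_iff:
  fixes x :: "face \<Rightarrow> real" and w :: "nat list" and i :: nat
  assumes "ascending (w @ v)"
  defines "val \<equiv> \<lambda>u ps. \<Sum>c<length w. of_int (winding u i ps (Suc c) (w ! c)) * x (After c)"
  shows "(\<forall>ps. gp_path (w @ v) i ps \<longrightarrow> 0 \<le> - val (w @ v) ps) \<longleftrightarrow>
    (\<forall>ps. gp_path w i ps \<longrightarrow> 0 \<le> - val w ps)"
proof
  assume L: "\<forall>ps. gp_path (w @ v) i ps \<longrightarrow> 0 \<le> - val (w @ v) ps"
  show "\<forall>ps. gp_path w i ps \<longrightarrow> 0 \<le> - val w ps"
  proof (intro allI impI)
    fix \<pi> assume "gp_path w i \<pi>"
    then obtain ps where ps: "gp_path (w @ v) i ps"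
      "\<forall>c\<le>length w. \<forall>t. winding (w @ v) i ps c t = winding w i \<pi> c t"
      using gp_path_extend[OF assms(1)] by blast
    then have "val (w @ v) ps = val w \<pi>" unfolding val_def by (intro sum.cong) auto
    then show "0 \<le> - val w \<pi>" using L ps(1) by metis
  qed
next
  assume R: "\<forall>ps. gp_path w i ps \<longrightarrow> 0 \<le> - val w ps"
  show "\<forall>ps. gp_path (w @ v) i ps \<longrightarrow> 0 \<le> - val (w @ v) ps"
  proof (intro allI impI)
    fix ps assume "gp_path (w @ v) i ps"
    then obtain C where C: "\<forall>\<rho>\<in>set C. gp_path w i \<rho>"
      "\<forall>c\<le>length w. \<forall>t. winding (w @ v) i ps c t = (\<Sum>\<rho>\<leftarrow>C. winding w i \<rho> c t)"
      using gp_path_restrict[OF assms(1)] by blast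
    have "val (w @ v) ps = (\<Sum>c<length w. of_int (\<Sum>\<rho>\<leftarrow>C. winding w i \<rho> (Suc c) (w ! c)) * x (After c))"
      unfolding val_def using C(2) by (intro sum.cong) auto
    also have "\<dots> = (\<Sum>\<rho>\<leftarrow>C. val w \<rho>)"
      unfolding val_def by (induction C) (simp_all add: distrib_right sum.distrib)
    finally have "val (w @ v) ps = (\<Sum>\<rho>\<leftarrow>C. val w \<rho>)" .
    moreover have "(\<Sum>\<rho>\<leftarrow>C. val w \<rho>) \<le> 0"
      using C(1) R by (intro sum_list_nonpos) auto
    ultimately show "0 \<le> - val (w @ v) ps" by simp
  qed
qed

lemma level_letter_occurs:
  assumes "word_perm u = longest_perm n" "m \<in> {1..<n}"
  shows "m \<in> set u"
proof (rule ccontr)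
  assume "m \<notin> set u"
  then have "m < end_height u 1 \<longleftrightarrow> m < (1 :: nat)"
    using height_above_preserved[of m u "[]" 1] by (simp add: end_height_Nil)
  then show False using assms by (simp add: end_height_longest)
qed

theorem theorem7:
  fixes n :: nat and \<sigma> :: "nat \<Rightarrow> nat" and w v :: "nat list"
  assumes "\<sigma> permutes {1..n}"
    and "reduced_expression n w \<sigma>"
    and "reduced_expression n (w @ v) (longest_perm n)"
  shows "weighted_area_cone n w =
    {x \<in> faces n w \<rightarrow>\<^sub>E UNIV.
       0 \<le> tropicalization (restrict_laurent (faces n w) (superpotential n (w @ v))) x}"
proof -
  let ?cu = "level_crossings (w @ v)"
  let ?cs = "level_crossings w"
  have u: "set (w @ v) \<subseteq> {1..<n}" "word_perm (w @ v) = longest_perm n"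
    using assms(3) by (auto simp: reduced_expression_def)
  have asc: "ascending (w @ v)" by (rule reduced_imp_ascending[OF assms(3)])
  have w: "set w \<subseteq> {1..<n}" "ascending w" using u asc by (auto simp: ascending_append)
  let ?val = "\<lambda>u i ps (x :: face \<Rightarrow> real). \<Sum>c<length w. of_int (winding u i ps (Suc c) (w ! c)) * x (After c)"
  let ?lev = "\<lambda>i k (x :: face \<Rightarrow> real). - x (Initial i) - (\<Sum>c\<in>set (take k (?cs i)). x (After c))"
  have path_w: "pairing (path_vector n w i ps) x = - ?val w i ps x" if "gp_path w i ps" for i ps x
    using pairing_path_vector[of w "[]" n i ps x] w that
    by (simp add: restrict_exponent_faces[OF keys_path_vector])
  have path_u: "pairing (restrict_exponent (faces n w) (path_vector n (w @ v) i ps)) x = - ?val (w @ v) i ps x"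
    if "gp_path (w @ v) i ps" for i ps x
    by (rule pairing_path_vector[OF u(1) asc that])
  have level_w: "pairing (level_vector w i k) x = ?lev i k x" if "i \<in> {1..<n}" for i k x
    using pairing_level_vector[OF that, of w "[]" k x]
    by (simp add: restrict_exponent_faces[OF keys_level_vector[OF that]])
  have level_u: "pairing (restrict_exponent (faces n w) (level_vector (w @ v) i k)) x = ?lev i k x"
    if "i \<in> {1..<n}" for i k x
    by (rule pairing_level_vector[OF that])
  have paths_iff: "(\<forall>ps. gp_path (w @ v) i ps \<longrightarrow> 0 \<le> - ?val (w @ v) i ps x) \<longleftrightarrow>
      (\<forall>ps. gp_path w i ps \<longrightarrow> 0 \<le> - ?val w i ps x)" for i x
    by (rule path_inequalities_iff[OF asc])
  have levels_iff: "(\<forall>k<length (?cu i). 0 \<le> ?lev i k x) \<longleftrightarrow>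
      (\<forall>k\<le>length (?cs i). 0 \<le> ?lev i k x)"
    if i: "i \<in> {1..<n}" and paths: "\<forall>i\<in>{1..<n}. \<forall>ps. gp_path (w @ v) i ps \<longrightarrow> 0 \<le> - ?val (w @ v) i ps x" for i x
  proof
    assume R: "\<forall>k\<le>length (?cs i). 0 \<le> ?lev i k x"
    show "\<forall>k<length (?cu i). 0 \<le> ?lev i k x"
    proof (intro allI impI)
      fix k
      \<comment> \<open>Crossings of \<open>v\<close> do not survive restriction, so all indices
        beyond the last crossing of \<open>w\<close> give the same vector as k = n_i.\<close>
      have "take k (?cs i) = take (min k (length (?cs i))) (?cs i)"
        by (simp add: min_def)
      then show "0 \<le> ?lev i k x" using R by (metis min.cobounded2)
    qed
  next
    assume L: "\<forall>k<length (?cu i). 0 \<le> ?lev i k x"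
    obtain cs where cs: "?cu i = ?cs i @ cs" "\<forall>c\<in>set cs. length w \<le> c"
      using level_crossings_append by blast
    show "\<forall>k\<le>length (?cs i). 0 \<le> ?lev i k x"
    proof (intro allI impI)
      fix k assume k: "k \<le> length (?cs i)"
      show "0 \<le> ?lev i k x"
      proof (cases "k < length (?cu i)")
        case True
        then show ?thesis using L by blast
      next
        case False
        \<comment> \<open>Only k = n_i can be missing, and only if \<open>v\<close> has no crossing
          at level \<open>i\<close>; otherwise the longer word provides it.\<close>
        then have "length cs = 0" and kl: "k = length (?cs i)"
          using k unfolding cs(1) length_append by linarith+
        then have same: "?cu i = ?cs i" using cs by simp
        \<comment> \<open>This makes n_i - 1 a legitimate index, whose inequality is available from
          the superpotential.\<close>
        have "?cs i \<noteq> []"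
        proof -
          have "i \<in> set (w @ v)" by (rule level_letter_occurs[OF u(2) i])
          then have "set (?cu i) \<noteq> {}"
            unfolding set_level_crossings by (auto simp only: in_set_conv_nth)
          then show ?thesis using same by auto
        qed
        then obtain ds d where ds: "?cs i = ds @ [d]" by (metis rev_exhaust)
        \<comment> \<open>\<open>d\<close> is the last crossing at level \<open>i\<close> in the
          whole word. The path around its face gives x \<le> 0 there, and adding this to the
          inequality for n_i - 1 yields the missing one for n_i.\<close>
        have d: "d < length w" "w ! d = i" using ds set_level_crossings[of w i] by auto
        have sorted: "sorted_wrt (<) (?cu i)"
          unfolding level_crossings_def by (intro sorted_wrt_filter) simp
        have later: "(w @ v) ! c \<noteq> i" if "d < c" "c < length (w @ v)" for c
        proof
          assume "(w @ v) ! c = i"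
          then have "c \<in> set (ds @ [d])"
            using that set_level_crossings[of "w @ v" i] same ds by auto
          then show False using sorted that unfolding same ds by (auto simp: sorted_wrt_append)
        qed
        define y where "y = take d (w @ v)"
        define z where "z = drop (Suc d) (w @ v)"
        have split: "w @ v = y @ [i] @ z"
          using d id_take_nth_drop[of d "w @ v"] by (simp add: y_def z_def nth_append)
        have "i \<notin> set z"
        proof
          assume "i \<in> set z"
          then obtain c where c: "c < length z" "z ! c = i" by (auto simp: in_set_conv_nth)
          then have "Suc d + c < length (w @ v)" unfolding z_def length_drop by linarith
          then show False using later[of "Suc d + c"] c d(1) by (simp add: z_def del: drop_append)
        qed
        then obtain ps where ps: "gp_path (w @ v) (n - i) ps"
          "\<forall>c<length (w @ v). winding (w @ v) (n - i) ps (Suc c) ((w @ v) ! c) = of_bool (c = length y)"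
          using last_face_gp_path[of y i z n] u asc unfolding split by blast
        have "length y = d" using d by (simp add: y_def)
        have "winding (w @ v) (n - i) ps (Suc c) (w ! c) = of_bool (c = d)" if "c < length w" for c
          using ps(2)[rule_format, of c] that \<open>length y = d\<close> by (simp add: nth_append)
        then have "?val (w @ v) (n - i) ps x = (\<Sum>c<length w. if c = d then x (After c) else 0)"
          by (intro sum.cong) auto
        also have "\<dots> = x (After d)" using d by simp
        finally have "?val (w @ v) (n - i) ps x = x (After d)" .
        then have "x (After d) \<le> 0"
          using paths ps(1) i by fastforce
        moreover have "0 \<le> ?lev i (length ds) x" using L[rule_format, of "length ds"] unfolding same ds by simp
        moreover have "d \<notin> set ds"
          using sorted unfolding same ds by (auto simp: sorted_wrt_append)
        ultimately show ?thesis unfolding kl ds by simp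
      qed
    qed
  qed
  have "x \<in> weighted_area_cone n w \<longleftrightarrow> x \<in> faces n w \<rightarrow>\<^sub>E UNIV \<and>
      0 \<le> tropicalization (restrict_laurent (faces n w) (superpotential n (w @ v))) x" for x
  proof -
    have "x \<in> weighted_area_cone n w \<longleftrightarrow> x \<in> faces n w \<rightarrow>\<^sub>E UNIV \<and>
        (\<forall>i\<in>{1..<n}. \<forall>ps. gp_path w i ps \<longrightarrow> 0 \<le> - ?val w i ps x) \<and>
        (\<forall>i\<in>{1..<n}. \<forall>k\<le>length (?cs i). 0 \<le> ?lev i k x)"
    proof -
      have "(\<forall>(i, ps)\<in>gp_paths n w. 0 \<le> pairing (path_vector n w i ps) x) \<longleftrightarrow>
          (\<forall>i\<in>{1..<n}. \<forall>ps. gp_path w i ps \<longrightarrow> 0 \<le> - ?val w i ps x)"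
      proof -
        have "(\<forall>(i, ps)\<in>gp_paths n w. 0 \<le> pairing (path_vector n w i ps) x) \<longleftrightarrow>
            (\<forall>i ps. i \<in> {1..<n} \<and> gp_path w i ps \<longrightarrow> 0 \<le> pairing (path_vector n w i ps) x)"
          unfolding gp_paths_iff[OF w(1), symmetric] by blast
        then show ?thesis using path_w by auto
      qed
      moreover have "(\<forall>i\<in>{1..<n}. \<forall>k\<le>length (?cs i). 0 \<le> pairing (level_vector w i k) x) \<longleftrightarrow>
          (\<forall>i\<in>{1..<n}. \<forall>k\<le>length (?cs i). 0 \<le> ?lev i k x)"
        using level_w by (intro ball_cong) auto
      ultimately show ?thesis unfolding weighted_area_cone_def by simp
    qed
    also have "\<dots> \<longleftrightarrow> x \<in> faces n w \<rightarrow>\<^sub>E UNIV \<and>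
        (\<forall>i\<in>{1..<n}. \<forall>ps. gp_path (w @ v) i ps \<longrightarrow> 0 \<le> - ?val (w @ v) i ps x) \<and>
        (\<forall>i\<in>{1..<n}. \<forall>k<length (?cu i). 0 \<le> ?lev i k x)"
    proof (intro conj_cong refl)
      show "(\<forall>i\<in>{1..<n}. \<forall>ps. gp_path w i ps \<longrightarrow> 0 \<le> - ?val w i ps x) \<longleftrightarrow>
          (\<forall>i\<in>{1..<n}. \<forall>ps. gp_path (w @ v) i ps \<longrightarrow> 0 \<le> - ?val (w @ v) i ps x)"
        by (intro ball_cong refl) (rule paths_iff[symmetric])
      \<comment> \<open>The level conditions are compared under the path conditions for all indices,
        since the redundancy at level \<open>i\<close> uses a path of index n - i.\<close>
      assume paths: "\<forall>i\<in>{1..<n}. \<forall>ps. gp_path (w @ v) i ps \<longrightarrow> 0 \<le> - ?val (w @ v) i ps x"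
      show "(\<forall>i\<in>{1..<n}. \<forall>k\<le>length (?cs i). 0 \<le> ?lev i k x) \<longleftrightarrow>
          (\<forall>i\<in>{1..<n}. \<forall>k<length (?cu i). 0 \<le> ?lev i k x)"
        by (intro ball_cong refl) (rule levels_iff[OF _ paths, symmetric])
    qed
    also have "\<dots> \<longleftrightarrow> x \<in> faces n w \<rightarrow>\<^sub>E UNIV \<and>
        0 \<le> tropicalization (restrict_laurent (faces n w) (superpotential n (w @ v))) x"
      unfolding tropicalization_restricted_superpotential[OF u(1) asc u(2)] using path_u level_u by simp
    finally show ?thesis .
  qed
  then show ?thesis by blast
qed

end
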